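(* Let $n\ge 1$ and let $P\in C^\infty(\mathbb{R}^n\setminus\{0\})$ be a real-valued function which is homogeneous of degree $k$ for some real $k\ge 1$, and non-singular in the sense that $\nabla P(\xi)\neq 0$ for all $\xi\in\mathbb{R}^n\setminus\{0\}$. Suppose there exists $\beta>0$ such that for every Schwartz function $\varphi\in\mathcal{S}(\mathbb{R}^n)$ with Fourier support in $\{|\xi|\simeq 1\}$ there is a constant $C_\varphi$ with $$\|T_t\varphi\|_{L^\infty(\mathbb{R}^n)}\le C_\varphi |t|^{-\beta}\qquad\text{for all } t\neq 0 .$$ Let $0\le\alpha\le n$ with $\alpha<\beta$, and let $s>(n-\alpha)/2$. Then for every $\mu\in M^\alpha(B_1)$ and every $f\in H^s(\mathbb{R}^n)$, $$\lim_{t\to 0}T_tf(x)=f(x)\qquad\text{for } \mu\text{-a.e. } x .$$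
   Context: Notation: $e(z)=e^{2\pi i z}$, $\widehat f(\xi)=\int f(x)e(-x\cdot\xi)\,dx$. $T_tf$ denotes the solution of $i\hbar\,\partial_tu+P(D)u=0$, $u(\cdot,0)=f$, with $\hbar=1/(2\pi)$ and $D=-i\hbar\partial$, i.e. $T_tf(x)=\int \widehat f(\xi)\,e(x\cdot\xi+tP(\xi))\,d\xi$. $H^s(\mathbb{R}^n)$ is the $L^2$-based Sobolev space. "Fourier support in $\{|\xi|\simeq1\}$" means that $\widehat\varphi$ is supported in an annulus $\{c_1\le|\xi|\le c_2\}$ for some constants $0<c_1<c_2$. Pointwise values: for a measurable function $g$ (in particular $g=f$ and $g=T_tf$) the value at $x$ is that of the representative $\lim_{r\to0}|B(x,r)|^{-1}\int_{B(x,r)}g$ whenever the limit exists. $M^\alpha(B_1)$ is the collection of probability measures $\mu$ supported in the unit ball $B_1$ of $\mathbb{R}^n$ for which there is a constant $C$ with $\mu(B_r)\le Cr^\alpha$ for every ball $B_r$ of radius $r$ and all $r>0$. *)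

theory Defs
  imports "HOL-Probability.Probability"
begin

section \<open>Smooth and Schwartz functions\<close>

text \<open>
  \<open>iter_partial [b\<^sub>1, \<dots>, b\<^sub>m] f\<close> is the iterated partial derivative
  \<open>\<partial>\<^sub>b\<^sub>1 \<cdots> \<partial>\<^sub>b\<^sub>m f\<close> in the directions of the basis vectors \<open>b\<^sub>i\<close>.
\<close>

primrec iter_partial ::
  "'a list \<Rightarrow> ('a::euclidean_space \<Rightarrow> 'b::real_normed_vector) \<Rightarrow> 'a \<Rightarrow> 'b" where
  "iter_partial [] f = f"
| "iter_partial (b # bs) f = (\<lambda>x. frechet_derivative (iter_partial bs f) (at x) b)"

text \<open>Meaningful for open sets only: the Frechet derivatives are taken at \<open>x\<close>, not within \<open>S\<close>.\<close>

definition smooth_on ::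
  "'a set \<Rightarrow> ('a::euclidean_space \<Rightarrow> 'b::real_normed_vector) \<Rightarrow> bool" where
  "smooth_on S f \<longleftrightarrow>
    (\<forall>bs. set bs \<subseteq> Basis \<longrightarrow> (\<forall>x\<in>S. iter_partial bs f differentiable (at x)))"

definition schwartz :: "('a::euclidean_space \<Rightarrow> complex) set" where
  "schwartz = {\<phi>. smooth_on UNIV \<phi> \<and>
    (\<forall>bs N. set bs \<subseteq> Basis \<longrightarrow>
      (\<exists>C. \<forall>x. (1 + norm x) ^ N * norm (iter_partial bs \<phi> x) \<le> C))}"


section \<open>The Fourier transform and Sobolev spaces\<close>

definition echar :: "real \<Rightarrow> complex" where
  "echar z = exp (2 * of_real pi * \<i> * of_real z)"

definition fourier :: "('a::euclidean_space \<Rightarrow> complex) \<Rightarrow> 'a \<Rightarrow> complex" where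
  "fourier f \<xi> = (LINT x|lebesgue. f x * echar (- (x \<bullet> \<xi>)))"

definition L2_fun :: "('a::euclidean_space \<Rightarrow> complex) \<Rightarrow> bool" where
  "L2_fun f \<longleftrightarrow> f \<in> borel_measurable lebesgue \<and> integrable lebesgue (\<lambda>x. (norm (f x))\<^sup>2)"

text \<open>
  \<open>L2_lim F g\<close>: \<open>g\<close> is the limit in \<open>L\<^sup>2\<close> of the family \<open>F R\<close> as \<open>R \<rightarrow> \<infinity>\<close>.
\<close>

definition L2_lim ::
  "(real \<Rightarrow> 'a::euclidean_space \<Rightarrow> complex) \<Rightarrow> ('a \<Rightarrow> complex) \<Rightarrow> bool" where
  "L2_lim F g \<longleftrightarrow> L2_fun g \<and>
    ((\<lambda>R. \<integral>\<^sup>+x. ennreal ((norm (F R x - g x))\<^sup>2) \<partial>lebesgue) \<longlongrightarrow> 0) at_top"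

text \<open>
  The Fourier transform on \<open>L\<^sup>2\<close> (Plancherel), as the \<open>L\<^sup>2\<close> limit of the integrals
  \<open>\<integral> f(x) e(-x\<cdot>\<xi>) dx\<close> over \<open>\<bar>x\<bar> \<le> R\<close>.  Like every element of \<open>L\<^sup>2\<close>, it is determined only
  up to a null set; the choice operator picks one representative.
\<close>

definition fourier_L2 :: "('a::euclidean_space \<Rightarrow> complex) \<Rightarrow> 'a \<Rightarrow> complex" where
  "fourier_L2 f = (SOME g. L2_lim (\<lambda>R. fourier (\<lambda>x. indicator (cball 0 R) x *\<^sub>R f x)) g)"

text \<open>
  The \<open>L\<^sup>2\<close>-based Sobolev space.  The requirement \<open>f \<in> L\<^sup>2\<close> is automatic only for \<open>s \<ge> 0\<close>,
  so the definition is intended for such \<open>s\<close>.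
\<close>

definition sobolev :: "real \<Rightarrow> ('a::euclidean_space \<Rightarrow> complex) set" where
  "sobolev s = {f. L2_fun f \<and>
    L2_fun (\<lambda>\<xi>. (1 + (norm \<xi>)\<^sup>2) powr (s / 2) *\<^sub>R fourier_L2 f \<xi>)}"


section \<open>The propagator\<close>

text \<open>
  \<open>T\<^sub>t f(x) = \<integral> \<hat>f(\<xi>) e(x\<cdot>\<xi> + t P(\<xi>)) d\<xi>\<close>.  For a general \<open>f\<close> in \<open>L\<^sup>2\<close> the integrand need
  not be integrable, so the integral is the \<open>L\<^sup>2\<close> limit of the integrals over \<open>\<bar>\<xi>\<bar> \<le> R\<close>, and
  \<open>T\<^sub>t f\<close> is again determined up to a null set.
\<close>

definition propagator ::
  "('a::euclidean_space \<Rightarrow> real) \<Rightarrow> real \<Rightarrow> ('a \<Rightarrow> complex) \<Rightarrow> 'a \<Rightarrow> complex" where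
  "propagator P t f = (SOME u. L2_lim
    (\<lambda>R x. LINT \<xi>:cball 0 R|lebesgue. fourier_L2 f \<xi> * echar (x \<bullet> \<xi> + t * P \<xi>)) u)"

definition Linf_norm :: "('a::euclidean_space \<Rightarrow> complex) \<Rightarrow> ereal" where
  "Linf_norm g = esssup lebesgue (\<lambda>x. ereal (norm (g x)))"


section \<open>Pointwise values and fractal measures\<close>

text \<open>
  \<open>has_value_at g x v\<close>: the averages of \<open>g\<close> over the balls \<open>B(x,r)\<close> converge to \<open>v\<close> as
  \<open>r \<rightarrow> 0\<close>.  This depends only on the equivalence class of \<open>g\<close> modulo null sets.
\<close>

definition has_value_at ::
  "('a::euclidean_space \<Rightarrow> complex) \<Rightarrow> 'a \<Rightarrow> complex \<Rightarrow> bool" where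
  "has_value_at g x v \<longleftrightarrow>
    ((\<lambda>r. (LINT y:ball x r|lebesgue. g y) /\<^sub>R measure lebesgue (ball x r)) \<longlongrightarrow> v) (at_right 0)"

definition frostman_measures :: "real \<Rightarrow> 'a::euclidean_space measure set" where
  "frostman_measures \<alpha> = {\<mu>. sets \<mu> = sets borel \<and> prob_space \<mu> \<and>
    emeasure \<mu> (- cball 0 1) = 0 \<and>
    (\<exists>C. \<forall>x r. 0 < r \<longrightarrow> measure \<mu> (ball x r) \<le> C * r powr \<alpha>)}"

end

theory Submission
  imports Defs
begin

text \<open>
  The argument linearises the maximal function \<open>sup\<^sub>t \<bar>T\<^sub>t f\<bar>\<close> at frequency \<open>\<lambda>\<close> and uses duality
  (\<open>TT\<^sup>*\<close>): it is controlled by the energy of \<open>\<mu>\<close> against \<open>sup\<^sub>t \<bar>K\<^sub>\<lambda>(x - y, t)\<bar>\<close>, where \<open>K\<^sub>\<lambda>\<close> is a rescaled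
  fixed kernel \<open>K(x, t) = \<integral> b(\<xi>) e(x\<cdot>\<xi> + t P(\<xi>)) d\<xi>\<close>.  Interpolating the dispersive bound
  \<open>\<bar>t\<bar>\<^bsup>-\<beta>\<^esup>\<close> with the integration by parts bound \<open>\<bar>x\<bar>\<^bsup>-N\<^esup> (1 + \<bar>t\<bar>)\<^bsup>N\<^esup>\<close> gives
  \<open>\<bar>K(x, t)\<bar> \<le> C (1 + \<bar>x\<bar>)\<^bsup>-\<gamma>\<^esup>\<close> uniformly in \<open>t\<close> for every \<open>\<gamma> < \<beta>\<close>.  Choosing \<open>\<gamma> < \<alpha>\<close> close to \<open>\<alpha>\<close>
  (\<open>\<gamma> = 0\<close> if \<open>\<alpha> = 0\<close>), the energy is \<open>O(\<lambda>\<^bsup>n-\<gamma>\<^esup>)\<close>, and the dyadic pieces are summable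
  because \<open>s > (n - \<gamma>) / 2\<close>.

  Since pointwise values are limits of averages over balls, the supremum is taken over the radius \<open>r\<close> of
  the ball as well as over \<open>t\<close>.  Convolution with a normalised ball preserves the decay
  \<open>(1 + \<bar>x\<bar>)\<^bsup>-\<gamma>\<^esup>\<close> for \<open>\<gamma> < n\<close>, so the same estimate holds, and the dyadic series converges uniformly
  in \<open>(t, r)\<close> at \<open>\<mu>\<close>-almost every point.
\<close>

section \<open>Square integrable functions\<close>

text \<open>The obstacle is that \<mu> may be singular, so nothing that is known only Lebesgue
  almost everywhere can be evaluated on it, in particular not the representatives of
  \<open>f\<close> and \<open>propagator P t f\<close> picked by the choice operator. Ball averages
  do have a meaning, being pairings of square integrable functions. Both values are therefore read
  off one function \<open>H (t, r)\<close> of time and radius, continuous up to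
  \<open>r = 0\<close>. Averaging is encoded by a second, independent variable, uniform in the unit
  ball. The linearised operator is then an ordinary integral over a product probability space, and
  duality works exactly as for point evaluations. By homogeneity, scaling the frequency
  \<open>l\<close> to 1 only replaces \<open>t\<close> by \<open>l powr k * t\<close>. As the kernel
  bound is uniform in time, neither this nor the time differences created by duality cost anything.
  Since \<open>P\<close> is smooth only away from 0, all amplitudes live on an annulus, and the
  frequencies in the unit ball form a separate piece that is bounded trivially by an L1 norm. The
  strict inequality between \<gamma> and \<alpha> makes the sum over dyadic balls around a point
  geometric.\<close>

lemma sigma_finite_lebesgue: "sigma_finite_measure (lebesgue :: 'a::euclidean_space measure)"
proof
  obtain A :: "nat \<Rightarrow> 'a set" where A: "range A \<subseteq> sets lborel" "(\<Union>i. A i) = space lborel"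
      "\<And>i. emeasure lborel (A i) \<noteq> \<infinity>"
    using lborel.sigma_finite by metis
  show "\<exists>A. countable A \<and> A \<subseteq> sets lebesgue \<and> \<Union>A = space (lebesgue :: 'a measure) \<and> (\<forall>a\<in>A. emeasure lebesgue a \<noteq> \<infinity>)"
    using A by (intro exI[of _ "range A"]) (auto simp: emeasure_completion subset_iff)
qed

interpretation lebesgue: sigma_finite_measure lebesgue
  by (rule sigma_finite_lebesgue)

interpretation lebesgue_pair: pair_sigma_finite lebesgue lebesgue ..

lemma borel_measurable_lebesgue [measurable (raw)]:
  "f \<in> borel_measurable borel \<Longrightarrow> f \<in> borel_measurable lebesgue"
  by (simp add: measurable_completion)

lemma sets_lebesgue_cball [measurable]: "cball a r \<in> sets lebesgue"
  and sets_lebesgue_ball [measurable]: "ball a r \<in> sets lebesgue"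
  by auto

text \<open>Squared norms with values in \<open>ennreal\<close> need no integrability side
  conditions. The price is the factor 2 in the substitute for the triangle inequality, which is
  harmless since only convergence to 0 and finiteness are ever read off.\<close>

definition L2sq :: "('a::euclidean_space \<Rightarrow> complex) \<Rightarrow> ennreal" where
  "L2sq f = (\<integral>\<^sup>+x. ennreal ((norm (f x))\<^sup>2) \<partial>lebesgue)"

lemma L2_fun_iff: "L2_fun f \<longleftrightarrow> f \<in> borel_measurable lebesgue \<and> L2sq f < \<infinity>"
  unfolding L2_fun_def L2sq_def by (auto simp: integrable_iff_bounded)

lemma L2_funD: "L2_fun f \<Longrightarrow> f \<in> borel_measurable lebesgue" "L2_fun f \<Longrightarrow> L2sq f < \<infinity>"
  by (auto simp: L2_fun_iff)

lemma L2sq_mono: "(\<And>x. norm (f x) \<le> norm (g x)) \<Longrightarrow> L2sq f \<le> L2sq g"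
  unfolding L2sq_def by (intro nn_integral_mono) (simp add: ennreal_leI power_mono)

lemma L2sq_minus_commute: "L2sq (\<lambda>x. f x - g x) = L2sq (\<lambda>x. g x - f x)"
  unfolding L2sq_def by (simp add: norm_minus_commute)

lemma norm_add_sq_le: "(norm (a + b))\<^sup>2 \<le> 2 * (norm a)\<^sup>2 + 2 * (norm (b::'a::real_normed_vector))\<^sup>2"
proof -
  have "(norm (a + b))\<^sup>2 \<le> (norm a + norm b)\<^sup>2" by (intro power_mono norm_triangle_ineq) auto
  also have "\<dots> \<le> 2 * (norm a)\<^sup>2 + 2 * (norm b)\<^sup>2"
    using sum_squares_bound[of "norm a" "norm b"] by (simp add: power2_sum)
  finally show ?thesis .
qed

lemma L2sq_add_le:
  assumes [measurable]: "f \<in> borel_measurable lebesgue" "g \<in> borel_measurable lebesgue"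
  shows "L2sq (\<lambda>x. f x + g x) \<le> 2 * L2sq f + 2 * L2sq g"
proof -
  have "L2sq (\<lambda>x. f x + g x) \<le> (\<integral>\<^sup>+x. 2 * ennreal ((norm (f x))\<^sup>2) + 2 * ennreal ((norm (g x))\<^sup>2) \<partial>lebesgue)"
    unfolding L2sq_def
  proof (intro nn_integral_mono)
    fix x
    have "ennreal ((norm (f x + g x))\<^sup>2) \<le> ennreal (2 * (norm (f x))\<^sup>2 + 2 * (norm (g x))\<^sup>2)"
      by (intro ennreal_leI norm_add_sq_le)
    also have "\<dots> = 2 * ennreal ((norm (f x))\<^sup>2) + 2 * ennreal ((norm (g x))\<^sup>2)"
      by (simp add: ennreal_plus ennreal_mult')
    finally show "ennreal ((norm (f x + g x))\<^sup>2) \<le> \<dots>" .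
  qed
  also have "\<dots> = 2 * L2sq f + 2 * L2sq g"
    unfolding L2sq_def by (simp add: nn_integral_add nn_integral_cmult)
  finally show ?thesis .
qed

lemma L2sq_uminus [simp]: "L2sq (\<lambda>x. - f x) = L2sq f"
  by (simp add: L2sq_def)

lemma L2sq_diff_le:
  assumes "f \<in> borel_measurable lebesgue" "g \<in> borel_measurable lebesgue"
  shows "L2sq (\<lambda>x. f x - g x) \<le> 2 * L2sq f + 2 * L2sq g"
  using L2sq_add_le[of f "\<lambda>x. - g x"] assms by simp

lemma L2sq_triangle:
  assumes [measurable]: "f \<in> borel_measurable lebesgue" "g \<in> borel_measurable lebesgue" "h \<in> borel_measurable lebesgue"
  shows "L2sq (\<lambda>x. f x - h x) \<le> 2 * L2sq (\<lambda>x. f x - g x) + 2 * L2sq (\<lambda>x. g x - h x)"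
  using L2sq_add_le[of "\<lambda>x. f x - g x" "\<lambda>x. g x - h x"] by simp

lemma L2_fun_diff: "L2_fun f \<Longrightarrow> L2_fun g \<Longrightarrow> L2_fun (\<lambda>x. f x - g x)"
  unfolding L2_fun_iff using L2sq_diff_le[of f g]
  by (auto simp: ennreal_mult_less_top elim!: le_less_trans)

lemma L2_fun_mono:
  assumes "L2_fun f" "g \<in> borel_measurable lebesgue" "\<And>x. norm (g x) \<le> norm (f x)"
  shows "L2_fun g"
  using assms L2sq_mono[of g f] by (auto simp: L2_fun_iff)

lemma L2_fun_of_bounded_support:
  fixes f :: "'a::euclidean_space \<Rightarrow> complex"
  assumes [measurable]: "f \<in> borel_measurable lebesgue"
    and B: "\<And>x. norm (f x) \<le> B" and R: "\<And>x. R < norm x \<Longrightarrow> f x = 0"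
  shows "L2_fun f"
proof -
  have "0 \<le> B" using norm_ge_zero B[of 0] by (rule order_trans)
  have "L2sq f \<le> (\<integral>\<^sup>+x. ennreal (B\<^sup>2) * indicator (cball 0 R) x \<partial>(lebesgue :: 'a measure))"
    unfolding L2sq_def
  proof (intro nn_integral_mono)
    fix x show "ennreal ((norm (f x))\<^sup>2) \<le> ennreal (B\<^sup>2) * indicator (cball 0 R) x"
      using B[of x] R[of x] by (cases "norm x \<le> R") (auto intro!: ennreal_leI power_mono)
  qed
  also have "\<dots> = ennreal (B\<^sup>2) * emeasure lebesgue (cball (0::'a) R)"
    by (simp add: nn_integral_cmult)
  also have "\<dots> < \<infinity>" using emeasure_bounded_finite[OF bounded_cball, of "0::'a" R]
    by (simp add: ennreal_mult_less_top)
  finally show ?thesis by (simp add: L2_fun_iff)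
qed

section \<open>Cauchy-Schwarz, L2 limits and completeness\<close>

lemma L2_Cauchy_Schwarz_nn:
  assumes [measurable]: "f \<in> borel_measurable lebesgue" "g \<in> borel_measurable lebesgue"
  shows "(\<integral>\<^sup>+x. ennreal (norm (f x * g x)) \<partial>lebesgue)\<^sup>2 \<le> L2sq f * L2sq g"
  using Cauchy_Schwarz_nn_integral[of "\<lambda>x. ennreal (norm (f x))" lebesgue "\<lambda>x. ennreal (norm (g x))"]
  by (simp add: L2sq_def norm_mult ennreal_mult ennreal_power)

lemma L2_integrable_mult:
  assumes "L2_fun f" "L2_fun g"
  shows "integrable lebesgue (\<lambda>x. f x * g x)"
proof -
  have [measurable]: "f \<in> borel_measurable lebesgue" "g \<in> borel_measurable lebesgue"
    using assms by (auto simp: L2_fun_iff)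
  have "(\<integral>\<^sup>+x. ennreal (norm (f x * g x)) \<partial>lebesgue)\<^sup>2 < \<infinity>"
    using L2_Cauchy_Schwarz_nn[of f g] assms by (auto simp: L2_fun_iff ennreal_mult_less_top elim!: le_less_trans)
  then show ?thesis
    by (auto simp: integrable_iff_bounded power_less_top_ennreal)
qed

lemma L2_Cauchy_Schwarz:
  assumes "f \<in> borel_measurable lebesgue" "g \<in> borel_measurable lebesgue"
  shows "ennreal ((norm (LINT x|lebesgue. f x * g x))\<^sup>2) \<le> L2sq f * L2sq g"
proof -
  have "ennreal (norm (LINT x|lebesgue. f x * g x)) \<le> (\<integral>\<^sup>+x. ennreal (norm (f x * g x)) \<partial>lebesgue)"
  \<comment> \<open>The Bochner integral of a non-integrable function is 0, so the bound holds for
    all measurable functions.\<close>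
  proof (cases "integrable lebesgue (\<lambda>x. f x * g x)")
    case True
    then show ?thesis by (rule integral_norm_bound_ennreal)
  qed (simp add: not_integrable_integral_eq)
  then have "(ennreal (norm (LINT x|lebesgue. f x * g x)))\<^sup>2 \<le> (\<integral>\<^sup>+x. ennreal (norm (f x * g x)) \<partial>lebesgue)\<^sup>2"
    by (rule power_mono) simp
  then show ?thesis
    using L2_Cauchy_Schwarz_nn[OF assms] by (simp add: ennreal_power)
qed

lemma ennreal_tendsto_0_sandwich:
  fixes f g :: "'b \<Rightarrow> ennreal"
  assumes "\<forall>\<^sub>F x in F. f x \<le> g x" "(g \<longlongrightarrow> 0) F"
  shows "(f \<longlongrightarrow> 0) F"
  by (rule tendsto_sandwich[OF _ assms(1) tendsto_const assms(2)]) auto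

lemma ennreal_tendsto_0_mult:
  fixes f :: "'b \<Rightarrow> ennreal"
  assumes "(f \<longlongrightarrow> 0) F" "c < \<infinity>"
  shows "((\<lambda>x. c * f x) \<longlongrightarrow> 0) F"
  using ennreal_tendsto_cmult[OF _ assms(1), of c] assms(2) by simp

lemma tendsto_of_ennreal_sq:
  fixes f :: "'b \<Rightarrow> complex"
  assumes "((\<lambda>x. ennreal ((norm (f x - l))\<^sup>2)) \<longlongrightarrow> 0) F"
  shows "(f \<longlongrightarrow> l) F"
proof -
  have "((\<lambda>x. (norm (f x - l))\<^sup>2) \<longlongrightarrow> 0) F"
    using assms by (subst (asm) ennreal_0[symmetric], subst (asm) tendsto_ennreal_iff) auto
  then have "((\<lambda>x. sqrt ((norm (f x - l))\<^sup>2)) \<longlongrightarrow> sqrt 0) F"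
    by (rule tendsto_real_sqrt)
  then show ?thesis by (simp add: tendsto_norm_zero_iff LIM_zero_iff)
qed

text \<open>Converts L2 limits, which are determined only up to null sets, into limits of numbers.
  It is applied with \<open>h\<close> the indicator of a ball or the conjugate transform of such an
  indicator.\<close>

lemma L2_tendsto_pairing:
  assumes FR: "\<And>R. L2_fun (F R)" and g: "L2_fun g" and h: "L2_fun h"
    and lim: "((\<lambda>R. L2sq (\<lambda>x. F R x - g x)) \<longlongrightarrow> 0) A"
  shows "((\<lambda>R. LINT x|lebesgue. F R x * h x) \<longlongrightarrow> (LINT x|lebesgue. g x * h x)) A"
proof (rule tendsto_of_ennreal_sq, rule ennreal_tendsto_0_sandwich)
  have "ennreal ((norm ((LINT x|lebesgue. F R x * h x) - (LINT x|lebesgue. g x * h x)))\<^sup>2)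
      \<le> L2sq h * L2sq (\<lambda>x. F R x - g x)" for R
  proof -
    have "(LINT x|lebesgue. F R x * h x) - (LINT x|lebesgue. g x * h x) = (LINT x|lebesgue. (F R x - g x) * h x)"
      using L2_integrable_mult[OF FR h] L2_integrable_mult[OF g h]
      by (simp only: left_diff_distrib Bochner_Integration.integral_diff)
    then show ?thesis
      using L2_Cauchy_Schwarz[of "\<lambda>x. F R x - g x" h] L2_fun_diff[OF FR g] h
      by (simp add: L2_fun_iff mult.commute)
  qed
  then show "\<forall>\<^sub>F R in A. ennreal ((norm ((LINT x|lebesgue. F R x * h x) - (LINT x|lebesgue. g x * h x)))\<^sup>2)
      \<le> L2sq h * L2sq (\<lambda>x. F R x - g x)" by simp
  show "((\<lambda>R. L2sq h * L2sq (\<lambda>x. F R x - g x)) \<longlongrightarrow> 0) A"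
    using ennreal_tendsto_0_mult[OF lim, of "L2sq h"] h by (simp add: L2_fun_iff)
qed

lemma L2_lim_iff:
  "L2_lim F g \<longleftrightarrow> L2_fun g \<and> ((\<lambda>R. L2sq (\<lambda>x. F R x - g x)) \<longlongrightarrow> 0) at_top"
  by (simp add: L2_lim_def L2sq_def)

lemma L2sq_eq_0_AE:
  assumes "f \<in> borel_measurable lebesgue" "L2sq f = 0"
  shows "AE x in lebesgue. f x = 0"
  using assms by (simp add: L2sq_def nn_integral_0_iff_AE)

text \<open>Identifies, up to a null set, the representatives that the choice operator picks in
  \<open>fourier_L2\<close> and \<open>propagator\<close>.\<close>

lemma L2_lim_unique:
  assumes F: "\<And>R. F R \<in> borel_measurable lebesgue" and g: "L2_lim F g" and h: "L2_lim F h"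
  shows "AE x in lebesgue. g x = h x"
proof -
  have [measurable]: "g \<in> borel_measurable lebesgue" "h \<in> borel_measurable lebesgue"
    using g h by (auto simp: L2_lim_iff L2_fun_iff)
  note F[measurable]
  have le: "L2sq (\<lambda>x. g x - h x) \<le> 2 * L2sq (\<lambda>x. F R x - g x) + 2 * L2sq (\<lambda>x. F R x - h x)" for R
    using L2sq_triangle[of g "F R" h] L2sq_minus_commute[of g "F R"] by simp
  have "((\<lambda>R. 2 * L2sq (\<lambda>x. F R x - g x) + 2 * L2sq (\<lambda>x. F R x - h x)) \<longlongrightarrow> 0 + 0) at_top"
    using g h by (intro tendsto_add ennreal_tendsto_0_mult) (auto simp: L2_lim_iff)
  then have "L2sq (\<lambda>x. g x - h x) \<le> 0"
    using le by (intro tendsto_lowerbound[where F="at_top::real filter"]) (auto simp del: le_zero_eq)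
  then have "AE x in lebesgue. g x - h x = 0"
    by (intro L2sq_eq_0_AE) auto
  then show ?thesis by simp
qed

lemma L2_truncation_tendsto:
  fixes f :: "'a::euclidean_space \<Rightarrow> complex"
  assumes f: "L2_fun f"
  shows "((\<lambda>R. L2sq (\<lambda>x. indicator (cball 0 R) x *\<^sub>R f x - f x)) \<longlongrightarrow> 0) at_top"
proof (rule tendsto_at_topI_sequentially)
  fix X :: "nat \<Rightarrow> real" assume X: "filterlim X at_top sequentially"
  have [measurable]: "f \<in> borel_measurable lebesgue" using f by (simp add: L2_fun_iff)
  have "(\<lambda>n. \<integral>\<^sup>+x. ennreal ((norm (indicator (cball 0 (X n)) x *\<^sub>R f x - f x))\<^sup>2) \<partial>lebesgue)
      \<longlonglongrightarrow> (\<integral>\<^sup>+x. 0 \<partial>(lebesgue :: 'a measure))"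
  proof (rule nn_integral_dominated_convergence[where w="\<lambda>x. ennreal ((norm (f x))\<^sup>2)"])
    show "(\<integral>\<^sup>+ x. ennreal ((norm (f x))\<^sup>2) \<partial>lebesgue) < \<infinity>"
      using f by (simp add: L2_fun_iff L2sq_def)
    show "AE x in lebesgue. (\<lambda>n. ennreal ((norm (indicator (cball 0 (X n)) x *\<^sub>R f x - f x))\<^sup>2)) \<longlonglongrightarrow> 0"
    proof (rule AE_I2)
      fix x :: 'a
      have "\<forall>\<^sub>F n in sequentially. norm x \<le> X n" using X by (simp add: filterlim_at_top)
      then have "\<forall>\<^sub>F n in sequentially. ennreal ((norm (indicator (cball 0 (X n)) x *\<^sub>R f x - f x))\<^sup>2) = 0"
        by eventually_elim auto
      then show "(\<lambda>n. ennreal ((norm (indicator (cball 0 (X n)) x *\<^sub>R f x - f x))\<^sup>2)) \<longlonglongrightarrow> 0"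
        by (rule tendsto_eventually)
    qed
    show "AE x in lebesgue. ennreal ((norm (indicator (cball 0 (X j)) x *\<^sub>R f x - f x))\<^sup>2) \<le> ennreal ((norm (f x))\<^sup>2)" for j
      by (auto simp: indicator_def)
  qed auto
  then show "(\<lambda>n. L2sq (\<lambda>x. indicator (cball 0 (X n)) x *\<^sub>R f x - f x)) \<longlonglongrightarrow> 0"
    by (simp add: L2sq_def)
qed

lemma L2_fun_truncation:
  assumes "L2_fun f"
  shows "L2_fun (\<lambda>x. indicator (cball 0 R) x *\<^sub>R f x)"
  using assms by (rule L2_fun_mono) (use assms in \<open>auto simp: L2_fun_iff indicator_def\<close>)

lemma L2_fun_indicator_cball: "L2_fun (\<lambda>x. indicator (cball (0::'a::euclidean_space) R) x)"
  by (rule L2_fun_of_bounded_support[where B=1 and R=R]) (auto simp: indicator_def)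

lemma L2_truncation_integrable:
  assumes "L2_fun f"
  shows "integrable lebesgue (\<lambda>x. indicator (cball 0 R) x *\<^sub>R f x)"
  using L2_integrable_mult[OF L2_fun_indicator_cball assms, of R]
  by (rule back_subst[of "integrable lebesgue"]) (auto simp: indicator_def)

text \<open>The Riesz-Fischer argument for a family with a real parameter: a rapidly Cauchy sequence
  of parameters gives a limit almost everywhere, and Fatou's lemma carries the estimate back to the
  whole family.\<close>

lemma L2_complete:
  fixes F :: "real \<Rightarrow> 'a::euclidean_space \<Rightarrow> complex"
  assumes F: "\<And>R. L2_fun (F R)"
    and Cauchy: "\<And>\<epsilon>. 0 < \<epsilon> \<Longrightarrow> \<exists>R0. \<forall>R\<ge>R0. \<forall>R'\<ge>R0. L2sq (\<lambda>x. F R x - F R' x) \<le> ennreal \<epsilon>"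
  shows "\<exists>g. L2_lim F g"
proof -
  have [measurable]: "\<And>R. F R \<in> borel_measurable lebesgue" using F by (simp add: L2_fun_iff)
  have "\<forall>k::nat. \<exists>R0. \<forall>R\<ge>R0. \<forall>R'\<ge>R0. L2sq (\<lambda>x. F R x - F R' x) \<le> ennreal ((1/4)^k)"
    using Cauchy by simp
  then obtain \<rho> where \<rho>: "\<And>k R R'. R \<ge> \<rho> k \<Longrightarrow> R' \<ge> \<rho> k \<Longrightarrow> L2sq (\<lambda>x. F R x - F R' x) \<le> ennreal ((1/4)^k)"
    by metis
  \<comment> \<open>The running maximum puts both \<open>r k\<close> and \<open>r (Suc k)\<close>
    beyond \<open>\<rho> k\<close>, so consecutive differences obey the bound for
    \<open>k\<close>.\<close>
  define r where "r k = Max (\<rho> ` {..k})" for k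
  have r_ge: "\<rho> k \<le> r k" and r_Suc: "\<rho> k \<le> r (Suc k)" for k
    unfolding r_def by (auto intro!: Max_ge)
  \<comment> \<open>The bound \<open>(1/4)^k\<close> for the squares leaves room for the weights
    \<open>2^k\<close>. Finiteness of the weighted sum then forces geometric decay of
    \<open>d k x\<close> with ratio \<open>sqrt (1/2)\<close> at almost every point.\<close>
  define d where "d k x = norm (F (r (Suc k)) x - F (r k) x)" for k x
  have [measurable]: "d k \<in> borel_measurable lebesgue" for k unfolding d_def by measurable
  have "(\<integral>\<^sup>+x. (\<Sum>k. ennreal (2^k * (d k x)\<^sup>2)) \<partial>lebesgue) = (\<Sum>k. (\<integral>\<^sup>+x. ennreal (2^k * (d k x)\<^sup>2) \<partial>lebesgue))"
    by (rule nn_integral_suminf) measurable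
  also have "\<dots> \<le> (\<Sum>k. ennreal ((1/2)^k))"
  proof (rule suminf_le)
    fix k
    have "(\<integral>\<^sup>+x. ennreal (2^k * (d k x)\<^sup>2) \<partial>lebesgue) = ennreal (2^k) * L2sq (\<lambda>x. F (r (Suc k)) x - F (r k) x)"
      by (simp add: L2sq_def d_def ennreal_mult nn_integral_cmult)
    also have "\<dots> \<le> ennreal (2^k) * ennreal ((1/4)^k)"
      using \<rho>[OF r_Suc r_ge, of k] by (intro mult_left_mono) auto
    also have "\<dots> = ennreal ((1/2)^k)"
      by (simp add: ennreal_mult[symmetric] power_mult_distrib[symmetric])
    finally show "(\<integral>\<^sup>+x. ennreal (2^k * (d k x)\<^sup>2) \<partial>lebesgue) \<le> ennreal ((1/2)^k)" .
  qed auto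
  also have "\<dots> < \<infinity>"
    by (subst suminf_ennreal2) (auto intro: summable_geometric)
  finally have "AE x in lebesgue. (\<Sum>k. ennreal (2^k * (d k x)\<^sup>2)) \<noteq> \<infinity>"
    by (intro nn_integral_PInf_AE) auto
  then have conv: "AE x in lebesgue. convergent (\<lambda>k. F (r k) x)"
  proof eventually_elim
    case (elim x)
    then have "summable (\<lambda>k. 2^k * (d k x)\<^sup>2)"
      by (intro summable_suminf_not_top) auto
    then have "Bseq (\<lambda>k. 2^k * (d k x)\<^sup>2)"
      using summable_LIMSEQ_zero convergent_def convergent_imp_Bseq by blast
    then obtain C where C: "C > 0" "\<And>k. 2^k * (d k x)\<^sup>2 \<le> C"
      unfolding Bseq_def by auto
    have "norm (d k x) \<le> sqrt C * (sqrt (1/2))^k" for k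
    proof -
      have "(d k x)\<^sup>2 \<le> C * (1/2)^k" using C(2)[of k] by (simp add: field_simps)
      then have "sqrt ((d k x)\<^sup>2) \<le> sqrt (C * (1/2)^k)" by (rule real_sqrt_le_mono)
      then show ?thesis by (simp add: d_def real_sqrt_mult real_sqrt_power)
    qed
    then have "summable (\<lambda>k. d k x)"
      by (intro summable_comparison_test[OF _ summable_mult[OF summable_geometric]])
         (auto simp: real_sqrt_lt_1_iff)
    then have "summable (\<lambda>k. F (r (Suc k)) x - F (r k) x)"
      unfolding d_def by (rule summable_norm_cancel)
    then have "convergent (\<lambda>n. (\<Sum>k<n. F (r (Suc k)) x - F (r k) x))"
      by (simp add: summable_iff_convergent)
    then have "convergent (\<lambda>n. F (r 0) x + (F (r n) x - F (r 0) x))"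
      by (subst convergent_add_const_iff) (simp only: sum_lessThan_telescope[of "\<lambda>k. F (r k) x"])
    then show ?case by simp
  qed
  define g where "g x = lim (\<lambda>k. F (r k) x)" for x
  have [measurable]: "g \<in> borel_measurable lebesgue" unfolding g_def by measurable
  have lim: "AE x in lebesgue. (\<lambda>k. F (r k) x) \<longlonglongrightarrow> g x"
    using conv by eventually_elim (simp add: g_def convergent_LIMSEQ_iff)
  \<comment> \<open>Fatou's lemma along the sequence \<open>r k\<close> gives the estimate for every
    \<open>R\<close> beyond the threshold, not only for members of the sequence.\<close>
  have bound: "L2sq (\<lambda>x. F R x - g x) \<le> ennreal ((1/4)^j)" if "R \<ge> \<rho> j" for R j
  proof -
    have "L2sq (\<lambda>x. F R x - g x) = (\<integral>\<^sup>+x. liminf (\<lambda>k. ennreal ((norm (F R x - F (r k) x))\<^sup>2)) \<partial>lebesgue)"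
      unfolding L2sq_def
    proof (rule nn_integral_cong_AE, use lim in eventually_elim)
      case (elim x)
      then have "(\<lambda>k. ennreal ((norm (F R x - F (r k) x))\<^sup>2)) \<longlonglongrightarrow> ennreal ((norm (F R x - g x))\<^sup>2)"
        by (intro tendsto_intros)
      then show ?case by (subst lim_imp_Liminf) auto
    qed
    also have "\<dots> \<le> liminf (\<lambda>k. L2sq (\<lambda>x. F R x - F (r k) x))"
      unfolding L2sq_def by (rule nn_integral_liminf) measurable
    also have "\<dots> \<le> ennreal ((1/4)^j)"
    proof -
      have "\<forall>\<^sub>F k in sequentially. L2sq (\<lambda>x. F R x - F (r k) x) \<le> ennreal ((1/4)^j)"
        using eventually_ge_at_top[of j]
      proof eventually_elim
        case (elim k)
        have "\<rho> j \<le> r k" unfolding r_def using elim by (auto intro!: Max_ge)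
        then show ?case using \<rho>[OF that] by simp
      qed
      then have "liminf (\<lambda>k. L2sq (\<lambda>x. F R x - F (r k) x)) \<le> liminf (\<lambda>k. ennreal ((1/4)^j))"
        by (rule Liminf_mono)
      then show ?thesis by (simp add: Liminf_const)
    qed
    finally show ?thesis .
  qed
  have "L2sq g \<le> 2 * L2sq (\<lambda>x. F (\<rho> 0) x - g x) + 2 * L2sq (F (\<rho> 0))"
    using L2sq_diff_le[of "\<lambda>x. F (\<rho> 0) x - g x" "F (\<rho> 0)"] by simp
  also have "\<dots> < \<infinity>"
    using F[of "\<rho> 0"] bound[of 0 "\<rho> 0"]
    by (auto simp: L2_fun_iff ennreal_mult_less_top intro: le_less_trans)
  finally have "L2_fun g" by (simp add: L2_fun_iff)
  moreover have "((\<lambda>R. L2sq (\<lambda>x. F R x - g x)) \<longlongrightarrow> 0) at_top"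
  proof (rule order_tendstoI)
    fix a :: ennreal assume "0 < a"
    then obtain b where b: "0 < b" "b < a" using dense by blast
    define \<epsilon> where "\<epsilon> = enn2real b"
    have "b < top" using b(2) top_greatest[of a] by (rule less_le_trans)
    then have e: "0 < \<epsilon>" "ennreal \<epsilon> < a"
      using b by (auto simp: \<epsilon>_def enn2real_positive_iff)
    obtain j :: nat where "(1/4)^j < \<epsilon>" using e real_arch_pow_inv[of \<epsilon> "1/4"] by auto
    then have "ennreal ((1/4)^j) < a" using e by (metis ennreal_leI less_eq_real_def order_le_less_trans)
    then show "\<forall>\<^sub>F R in at_top. L2sq (\<lambda>x. F R x - g x) < a"
      by (intro eventually_mono[OF eventually_ge_at_top[of "\<rho> j"]] le_less_trans[OF bound])
  qed auto
  ultimately show ?thesis by (auto simp: L2_lim_iff)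
qed

section \<open>Gaussian summation and Plancherel's inequality\<close>

lemma lborel_affine_integrable_iff:
  fixes f :: "'a::euclidean_space \<Rightarrow> 'b::{banach, second_countable_topology}"
  assumes [measurable]: "f \<in> borel_measurable borel" and c: "c \<noteq> 0"
  shows "integrable lborel (\<lambda>x. f (t + c *\<^sub>R x)) \<longleftrightarrow> integrable lborel f"
proof -
  have "integrable lborel f \<longleftrightarrow> integrable (density (distr lborel borel (\<lambda>x. t + c *\<^sub>R x)) (\<lambda>_. ennreal (\<bar>c\<bar>^DIM('a)))) f"
    using lborel_affine[OF c, of t] by (simp add: ennreal_power)
  also have "\<dots> \<longleftrightarrow> integrable lborel (\<lambda>x. f (t + c *\<^sub>R x))"
    using c integrable_scaleR_right[of "1 / \<bar>c\<bar>^DIM('a)" lborel "\<lambda>x. \<bar>c\<bar>^DIM('a) *\<^sub>R f (t + c *\<^sub>R x)"]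
    by (subst integrable_density) (auto simp: integrable_distr_eq)
  finally show ?thesis ..
qed

lemma lborel_affine_integral:
  fixes f :: "'a::euclidean_space \<Rightarrow> 'b::{banach, second_countable_topology}"
  assumes [measurable]: "f \<in> borel_measurable borel" and c: "c \<noteq> 0"
  shows "(LINT x|lborel. f x) = \<bar>c\<bar>^DIM('a) *\<^sub>R (LINT x|lborel. f (t + c *\<^sub>R x))"
proof -
  have "(LINT x|lborel. f x) = (LINT x|density (distr lborel borel (\<lambda>x. t + c *\<^sub>R x)) (\<lambda>_. ennreal (\<bar>c\<bar>^DIM('a))). f x)"
    using lborel_affine[OF c, of t] by (simp add: ennreal_power)
  also have "\<dots> = \<bar>c\<bar>^DIM('a) *\<^sub>R (LINT x|lborel. f (t + c *\<^sub>R x))"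
    by (subst integral_density) (auto simp: integral_distr)
  finally show ?thesis .
qed

lemma lborel_affine_nn_integral:
  fixes f :: "'a::euclidean_space \<Rightarrow> ennreal"
  assumes [measurable]: "f \<in> borel_measurable borel" and c: "c \<noteq> 0"
  shows "(\<integral>\<^sup>+x. f x \<partial>lborel) = ennreal (\<bar>c\<bar>^DIM('a)) * (\<integral>\<^sup>+x. f (t + c *\<^sub>R x) \<partial>lborel)"
proof -
  have "(\<integral>\<^sup>+x. f x \<partial>lborel) = (\<integral>\<^sup>+x. f x \<partial>density (distr lborel borel (\<lambda>x. t + c *\<^sub>R x)) (\<lambda>_. ennreal (\<bar>c\<bar>^DIM('a))))"
    using lborel_affine[OF c, of t] by (simp add: ennreal_power)
  also have "\<dots> = ennreal (\<bar>c\<bar>^DIM('a)) * (\<integral>\<^sup>+x. f (t + c *\<^sub>R x) \<partial>lborel)"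
    by (subst nn_integral_density) (auto simp: nn_integral_distr nn_integral_cmult)
  finally show ?thesis .
qed

lemma echar_add: "echar (a + b) = echar a * echar b"
  by (simp add: echar_def ring_distribs exp_add)

lemma echar_0 [simp]: "echar 0 = 1"
  by (simp add: echar_def)

lemma norm_echar [simp]: "norm (echar a) = 1"
  using norm_exp_i_times[of "2 * pi * a"] by (simp add: echar_def mult_ac)

lemma cnj_echar [simp]: "cnj (echar a) = echar (- a)"
  by (simp add: echar_def exp_cnj)

lemma continuous_on_echar [continuous_intros]:
  "continuous_on S f \<Longrightarrow> continuous_on S (\<lambda>x. echar (f x))"
  unfolding echar_def by (intro continuous_intros)

lemma tendsto_echar [tendsto_intros]: "(f \<longlongrightarrow> l) F \<Longrightarrow> ((\<lambda>x. echar (f x)) \<longlongrightarrow> echar l) F"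
  unfolding echar_def by (intro tendsto_intros)

lemma echar_measurable [measurable]: "echar \<in> borel_measurable borel"
  by (intro borel_measurable_continuous_onI continuous_intros)

lemma norm_integral_le_nn:
  fixes f :: "'a \<Rightarrow> 'b::{banach, second_countable_topology}"
  shows "ennreal (norm (LINT x|M. f x)) \<le> (\<integral>\<^sup>+x. ennreal (norm (f x)) \<partial>M)"
  by (cases "integrable M f") (auto simp: integral_norm_bound_ennreal not_integrable_integral_eq)

text \<open>The only form in which integrals are exchanged for Fourier integrals: each variable has
  its own integrable factor, and the coupling is merely bounded, typically a character.\<close>

lemma (in pair_sigma_finite) Fubini_bounded_kernel:
  fixes f :: "'a \<Rightarrow> complex" and k :: "'b \<Rightarrow> complex" and c :: "'a \<Rightarrow> 'b \<Rightarrow> complex"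
  assumes f: "integrable M1 f" and k: "integrable M2 k"
    and c [measurable]: "case_prod c \<in> borel_measurable (M1 \<Otimes>\<^sub>M M2)" and bound: "\<And>x y. norm (c x y) \<le> B"
  shows "(LINT x|M1. f x * (LINT y|M2. k y * c x y)) = (LINT y|M2. k y * (LINT x|M1. f x * c x y))"
proof -
  have [measurable]: "f \<in> borel_measurable M1" "k \<in> borel_measurable M2" using f k by auto
  have B: "0 \<le> B" using norm_ge_zero bound[of undefined undefined] by (rule order_trans)
  let ?F = "\<lambda>x y. f x * (k y * c x y)"
  have int: "integrable (M1 \<Otimes>\<^sub>M M2) (\<lambda>(x,y). ?F x y)"
  proof (rule integrableI_bounded)
    have "(\<integral>\<^sup>+z. ennreal (norm (case z of (x,y) \<Rightarrow> ?F x y)) \<partial>(M1 \<Otimes>\<^sub>M M2))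
       = (\<integral>\<^sup>+x. \<integral>\<^sup>+y. ennreal (norm (?F x y)) \<partial>M2 \<partial>M1)"
      by (subst M2.nn_integral_fst[symmetric]) auto
    also have "\<dots> \<le> (\<integral>\<^sup>+x. \<integral>\<^sup>+y. (ennreal B * ennreal (norm (f x))) * ennreal (norm (k y)) \<partial>M2 \<partial>M1)"
    proof (intro nn_integral_mono)
      fix x y
      have "norm (?F x y) = norm (f x) * norm (k y) * norm (c x y)" by (simp add: norm_mult)
      also have "\<dots> \<le> norm (f x) * norm (k y) * B" by (intro mult_left_mono bound) auto
      finally have "ennreal (norm (?F x y)) \<le> ennreal (B * norm (f x) * norm (k y))"
        by (intro ennreal_leI) (simp add: mult_ac)
      then show "ennreal (norm (?F x y)) \<le> (ennreal B * ennreal (norm (f x))) * ennreal (norm (k y))"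
        using B by (simp add: ennreal_mult)
    qed
    also have "\<dots> = (\<integral>\<^sup>+y. ennreal (norm (k y)) \<partial>M2) * (ennreal B * (\<integral>\<^sup>+x. ennreal (norm (f x)) \<partial>M1))"
      by (simp add: nn_integral_cmult nn_integral_multc mult_ac)
    also have "\<dots> < \<infinity>"
      using f k by (auto simp: integrable_iff_bounded ennreal_mult_less_top)
    finally show "(\<integral>\<^sup>+z. ennreal (norm (case z of (x,y) \<Rightarrow> ?F x y)) \<partial>(M1 \<Otimes>\<^sub>M M2)) < \<infinity>" .
  qed measurable
  have "(LINT x|M1. f x * (LINT y|M2. k y * c x y)) = (LINT x|M1. LINT y|M2. ?F x y)" by simp
  also have "\<dots> = (LINT y|M2. LINT x|M1. ?F x y)"
    by (rule Fubini_integral[OF int, symmetric])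
  also have "\<dots> = (LINT y|M2. LINT x|M1. k y * (f x * c x y))" by (simp only: mult.left_commute)
  finally show ?thesis by simp
qed

lemma fst_lebesgue_measurable [measurable]: "fst \<in> borel_measurable (lebesgue \<Otimes>\<^sub>M N)"
  by (rule measurable_compose[OF measurable_fst borel_measurable_lebesgue[OF measurable_ident, unfolded id_def], unfolded id_def])
     
lemma snd_lebesgue_measurable [measurable]: "snd \<in> borel_measurable (N \<Otimes>\<^sub>M lebesgue)"
  by (rule measurable_compose[OF measurable_snd borel_measurable_lebesgue[OF measurable_ident, unfolded id_def], unfolded id_def])

section \<open>Gaussians and their Fourier transforms\<close>

lemma gaussian_1d:
  fixes s :: real
  shows "integrable lborel (\<lambda>u. complex_of_real (exp (- pi * u\<^sup>2)) * echar (s * u))"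
    and "(LINT u|lborel. complex_of_real (exp (- pi * u\<^sup>2)) * echar (s * u)) = of_real (exp (- pi * s\<^sup>2))"
proof -
  \<comment> \<open>Substituting \<open>v = a * u\<close> turns the Gaussian into the standard
    normal density, whose characteristic function is known.\<close>
  define a where "a = sqrt (2 * pi)"
  have a: "a > 0" "a\<^sup>2 = 2 * pi" by (auto simp: a_def)
  let ?f = "\<lambda>v. std_normal_density v *\<^sub>R iexp (a * s * v)"
  have eq: "complex_of_real (exp (- pi * u\<^sup>2)) * echar (s * u) = a *\<^sub>R ?f (0 + a *\<^sub>R u)" for u
  proof -
    have "std_normal_density (a * u) = exp (- pi * u\<^sup>2) / a"
      by (simp add: std_normal_density_def a_def power_mult_distrib)
    moreover have "iexp (a * s * (a * u)) = echar (s * u)"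
      using a(2) unfolding echar_def power2_eq_square
      by (metis (no_types, opaque_lifting) mult.assoc mult.commute of_real_mult of_real_numeral)
    ultimately show ?thesis using a by (simp add: scaleR_conv_of_real)
  qed
  have int: "integrable lborel ?f"
  proof (rule Bochner_Integration.integrable_bound)
    show "integrable lborel std_normal_density"
      using integrable_normal_density[of 1 0] by simp
    show "AE x in lborel. norm (?f x) \<le> norm (std_normal_density x)"
      by (auto simp: norm_mult)
  qed measurable
  have "(LINT v|lborel. ?f v) = char std_normal_distribution (a * s)"
    unfolding char_def by (subst integral_density) auto
  also have "\<dots> = of_real (exp (- pi * s\<^sup>2))"
    by (simp add: char_std_normal_distribution power_mult_distrib a)
  finally have val: "(LINT v|lborel. ?f v) = of_real (exp (- pi * s\<^sup>2))" .
  show "integrable lborel (\<lambda>u. complex_of_real (exp (- pi * u\<^sup>2)) * echar (s * u))"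
    unfolding eq using lborel_affine_integrable_iff[of ?f a 0] a int by (intro integrable_scaleR_right) auto
  show "(LINT u|lborel. complex_of_real (exp (- pi * u\<^sup>2)) * echar (s * u)) = of_real (exp (- pi * s\<^sup>2))"
    unfolding eq val[symmetric] using lborel_affine_integral[of ?f a 0] a by (simp del: scaleR_scaleR)
qed

lemma echar_sum: "finite A \<Longrightarrow> echar (\<Sum>i\<in>A. f i) = (\<Prod>i\<in>A. echar (f i))"
  by (induction A rule: finite_induct) (auto simp: echar_add)

lemma gaussian_nd:
  fixes x :: "'a::euclidean_space"
  shows "integrable lborel (\<lambda>\<xi>. complex_of_real (exp (- pi * (norm \<xi>)\<^sup>2)) * echar (x \<bullet> \<xi>))" (is "integrable _ ?F")
    and "(LINT \<xi>|lborel. complex_of_real (exp (- pi * (norm \<xi>)\<^sup>2)) * echar (x \<bullet> \<xi>)) = of_real (exp (- pi * (norm x)\<^sup>2))"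
proof -
  interpret product_sigma_finite "\<lambda>_::'a. lborel :: real measure" ..
  let ?P = "\<Pi>\<^sub>M b\<in>(Basis::'a set). (lborel :: real measure)"
  let ?g = "\<lambda>f. \<Sum>b\<in>(Basis::'a set). f b *\<^sub>R b"
  let ?h = "\<lambda>b u. complex_of_real (exp (- pi * u\<^sup>2)) * echar ((x \<bullet> b) * u)"
  have norm_g: "(norm (?g f))\<^sup>2 = (\<Sum>b\<in>(Basis::'a set). (f b)\<^sup>2)" for f :: "'a \<Rightarrow> real"
    unfolding power2_norm_eq_inner
    by (subst euclidean_inner) (auto simp: power2_eq_square inner_sum_left_Basis)
  have prod: "?F (?g f) = (\<Prod>b\<in>(Basis::'a set). ?h b (f b))" for f
  proof -
    have "exp (- pi * (norm (?g f))\<^sup>2) = (\<Prod>b\<in>(Basis::'a set). exp (- pi * (f b)\<^sup>2))"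
      unfolding norm_g sum_distrib_left by (rule exp_sum) simp
    moreover have "echar (x \<bullet> ?g f) = (\<Prod>b\<in>(Basis::'a set). echar ((x \<bullet> b) * f b))"
      by (subst echar_sum[symmetric]) (auto simp: inner_sum_right mult.commute)
    ultimately show ?thesis by (simp only: prod.distrib of_real_prod)
  qed
  have gm[measurable]: "?g \<in> ?P \<rightarrow>\<^sub>M borel" by measurable
  have Fm[measurable]: "?F \<in> borel_measurable borel" by measurable
  \<comment> \<open>Lebesgue measure is the image of the product measure over the coordinates, on
    which the integrand factors.\<close>
  have L: "(lborel :: 'a measure) = distr ?P borel ?g"
    by (simp only: lborel_def[where 'a='a] lborel_eq_real)
  show "integrable lborel ?F"
    unfolding L integrable_distr_eq[OF gm Fm] unfolding prod
    by (intro product_integrable_prod gaussian_1d) auto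
  have "(LINT \<xi>|lborel. ?F \<xi>) = (LINT f|?P. (\<Prod>b\<in>(Basis::'a set). ?h b (f b)))"
    unfolding L integral_distr[OF gm Fm] unfolding prod ..
  also have "\<dots> = (\<Prod>b\<in>(Basis::'a set). of_real (exp (- pi * (x \<bullet> b)\<^sup>2)))"
    by (subst product_integral_prod[OF finite_Basis gaussian_1d(1)]) (simp only: gaussian_1d(2))
  also have "\<dots> = of_real (exp (- pi * (norm x)\<^sup>2))"
  proof -
    have "(norm x)\<^sup>2 = (\<Sum>b\<in>Basis. (x \<bullet> b)\<^sup>2)"
      using norm_g[of "\<lambda>b. x \<bullet> b"] by (simp add: euclidean_representation)
    then have "exp (- pi * (norm x)\<^sup>2) = (\<Prod>b\<in>Basis. exp (- pi * (x \<bullet> b)\<^sup>2))"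
      by (simp only: sum_distrib_left exp_sum finite_Basis)
    then show ?thesis by (simp only: of_real_prod)
  qed
  finally show "(LINT \<xi>|lborel. ?F \<xi>) = of_real (exp (- pi * (norm x)\<^sup>2))" .
qed

text \<open>For small \<open>d\<close> this is a wide cutoff close to 1, and its Fourier transform
  \<open>gauss_kernel d\<close> is an approximate identity of mass 1.\<close>

definition gauss :: "real \<Rightarrow> 'a::euclidean_space \<Rightarrow> real" where
  "gauss d x = exp (- pi * (norm (d *\<^sub>R x))\<^sup>2)"

definition gauss_kernel :: "real \<Rightarrow> 'a::euclidean_space \<Rightarrow> real" where
  "gauss_kernel d x = gauss (1 / d) x / d ^ DIM('a)"

lemma gauss_measurable [measurable]: "gauss d \<in> borel_measurable borel"
  and gauss_kernel_measurable [measurable]: "gauss_kernel d \<in> borel_measurable borel"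
  unfolding gauss_def[abs_def] gauss_kernel_def[abs_def] by measurable

lemma gauss_pos: "gauss d x > 0" and gauss_le_1: "gauss d x \<le> 1" and gauss_minus [simp]: "gauss d (- x) = gauss d x"
  by (simp_all add: gauss_def)

lemma gauss_tendsto_1: "(\<lambda>m. gauss (1 / real (Suc m)) x) \<longlonglongrightarrow> 1"
proof -
  have "(\<lambda>m. gauss (1 / real (Suc m)) x) \<longlonglongrightarrow> exp (- pi * (norm (0 *\<^sub>R x))\<^sup>2)"
    unfolding gauss_def by (intro tendsto_intros LIMSEQ_Suc[OF lim_1_over_n[where 'a=real]])
  then show ?thesis by simp
qed

lemma gauss_kernel_nonneg: "0 < d \<Longrightarrow> 0 \<le> gauss_kernel d x"
  using gauss_pos[of "1/d" x] by (simp add: gauss_kernel_def)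

lemma gauss_kernel_minus: "gauss_kernel d (x - y) = gauss_kernel d (y - x)"
  using gauss_minus[of "1/d" "x - y"] by (simp add: gauss_kernel_def)

lemma gauss_echar:
  fixes x :: "'a::euclidean_space"
  assumes d: "0 < d"
  shows "integrable lebesgue (\<lambda>\<xi>. complex_of_real (gauss d \<xi>) * echar (x \<bullet> \<xi>))" (is "integrable _ ?F")
    and "(LINT \<xi>|lebesgue. complex_of_real (gauss d \<xi>) * echar (x \<bullet> \<xi>)) = of_real (gauss_kernel d x)"
proof -
  let ?G = "\<lambda>\<eta>. complex_of_real (exp (- pi * (norm \<eta>)\<^sup>2)) * echar ((x /\<^sub>R d) \<bullet> \<eta>)"
  have eq: "?F \<xi> = ?G (0 + d *\<^sub>R \<xi>)" for \<xi> using d by (simp add: gauss_def mult.assoc[symmetric])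
  have [measurable]: "?F \<in> borel_measurable borel" by measurable
  have "integrable lborel ?F"
    unfolding eq using lborel_affine_integrable_iff[of ?G d 0] gaussian_nd(1)[of "x /\<^sub>R d"] d by auto
  then show "integrable lebesgue ?F" by (simp add: integrable_completion)
  have "(LINT \<xi>|lebesgue. ?F \<xi>) = (LINT \<xi>|lborel. ?G (0 + d *\<^sub>R \<xi>))"
    unfolding eq[symmetric] by (rule integral_completion) measurable
  also have "\<dots> = (LINT \<xi>|lborel. ?G \<xi>) / of_real (d ^ DIM('a))"
    using lborel_affine_integral[of ?G d 0] d by (simp add: scaleR_conv_of_real)
  also have "\<dots> = of_real (gauss_kernel d x)"
    using gaussian_nd(2)[of "x /\<^sub>R d"] by (simp add: gauss_kernel_def gauss_def divide_inverse)
  finally show "(LINT \<xi>|lebesgue. ?F \<xi>) = of_real (gauss_kernel d x)" .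
qed

lemma gauss_integrable: "0 < d \<Longrightarrow> integrable lebesgue (\<lambda>\<xi>. complex_of_real (gauss d \<xi>))"
  using gauss_echar(1)[of d 0] by simp

lemma gauss_kernel_nn_integral:
  fixes x :: "'a::euclidean_space"
  assumes d: "0 < d"
  shows "(\<integral>\<^sup>+y. ennreal (gauss_kernel d (x - y)) \<partial>lebesgue) = 1"
proof -
  have int: "integrable lebesgue (\<lambda>\<xi>::'a. complex_of_real (gauss (1/d) \<xi>))"
    using d by (intro gauss_integrable) auto
  then have int': "integrable lebesgue (\<lambda>\<xi>::'a. gauss (1/d) \<xi>)"
    by (subst (asm) complex_of_real_integrable_eq)
  have "complex_of_real (LINT \<xi>|lebesgue. gauss (1/d) (\<xi>::'a)) = of_real (d ^ DIM('a))"
    using gauss_echar(2)[of "1/d" "0::'a"] d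
    by (simp add: gauss_kernel_def gauss_def power_divide integral_complex_of_real)
  then have I: "(LINT \<xi>|lebesgue. gauss (1/d) (\<xi>::'a)) = d ^ DIM('a)"
    using of_real_eq_iff by blast
  have "(\<integral>\<^sup>+y. ennreal (gauss_kernel d (x - y)) \<partial>lebesgue) = (\<integral>\<^sup>+y. ennreal (gauss_kernel d (x - y)) \<partial>lborel)"
    by (simp add: nn_integral_completion)
  also have "\<dots> = (\<integral>\<^sup>+y. ennreal (gauss_kernel d y) \<partial>(lborel :: 'a measure))"
    by (subst (2) lborel_affine_nn_integral[where t=x and c="-1"]) auto
  also have "\<dots> = (\<integral>\<^sup>+y. ennreal (gauss_kernel d (y::'a)) \<partial>lebesgue)"
    by (simp add: nn_integral_completion)
  also have "\<dots> = ennreal (LINT y|lebesgue. gauss_kernel d (y::'a))"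
    using int' d by (intro nn_integral_eq_integral) (auto simp: less_imp_le[OF gauss_pos] gauss_kernel_def[abs_def])
  also have "\<dots> = 1"
    using I d by (simp add: gauss_kernel_def[abs_def])
  finally show ?thesis .
qed

section \<open>Parseval with a Gaussian cutoff and the contraction property\<close>

lemma borel_measurable_cnj [measurable]: "cnj \<in> borel_measurable borel"
  by (intro borel_measurable_continuous_onI continuous_intros)

lemma fourier_measurable [measurable]:
  assumes [measurable]: "f \<in> borel_measurable lebesgue"
  shows "fourier f \<in> borel_measurable borel"
proof -
  have [measurable]: "fst \<in> borel_measurable (borel \<Otimes>\<^sub>M lebesgue)" by (rule measurable_fst)
  show ?thesis unfolding fourier_def[abs_def] by (intro lebesgue.borel_measurable_lebesgue_integral) measurable
qed

lemma norm_fourier_le: "norm (fourier f \<xi>) \<le> (LINT x|lebesgue. norm (f x))"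
proof -
  have "norm (fourier f \<xi>) \<le> (LINT x|lebesgue. norm (f x * echar (- (x \<bullet> \<xi>))))"
    unfolding fourier_def by (rule integral_norm_bound)
  then show ?thesis by (simp add: norm_mult)
qed

text \<open>The transforms of integrable functions are bounded but perhaps not integrable. With the
  Gaussian cutoff every double integral converges absolutely, and two applications of Fubini turn
  the cutoff into a convolution with \<open>gauss_kernel d\<close>.\<close>

lemma fourier_parseval_gauss:
  fixes f h :: "'a::euclidean_space \<Rightarrow> complex"
  assumes f: "integrable lebesgue f" and h: "integrable lebesgue h" and d: "0 < d"
  shows "(LINT \<xi>|lebesgue. gauss d \<xi> * cnj (fourier h \<xi>) * fourier f \<xi>)
    = (LINT x|lebesgue. f x * cnj (LINT y|lebesgue. h y * gauss_kernel d (x - y)))"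
proof -
  note m[measurable] = borel_measurable_integrable[OF f] borel_measurable_integrable[OF h]
  have g: "integrable lebesgue (\<lambda>\<xi>. gauss d \<xi> * cnj (fourier h \<xi>))"
  proof (rule Bochner_Integration.integrable_bound[OF integrable_mult_left[OF gauss_integrable[OF d]]])
    show "AE \<xi> in lebesgue. norm (gauss d \<xi> * cnj (fourier h \<xi>)) \<le> norm (complex_of_real (gauss d \<xi>) * of_real (LINT x|lebesgue. norm (h x)))"
      using norm_fourier_le[of h] by (auto simp: norm_mult intro!: mult_left_mono)
  qed measurable
  have inner: "(LINT \<xi>|lebesgue. gauss d \<xi> * cnj (fourier h \<xi>) * echar (- (x \<bullet> \<xi>)))
      = cnj (LINT y|lebesgue. h y * gauss_kernel d (x - y))" for x
  proof -
    have [measurable]: "(\<lambda>(\<xi>, y). echar ((y - x) \<bullet> \<xi>)) \<in> borel_measurable (lebesgue \<Otimes>\<^sub>M lebesgue)" by measurable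
    have "(LINT \<xi>|lebesgue. gauss d \<xi> * cnj (fourier h \<xi>) * echar (- (x \<bullet> \<xi>)))
       = (LINT \<xi>|lebesgue. gauss d \<xi> * (LINT y|lebesgue. cnj (h y) * echar ((y - x) \<bullet> \<xi>)))"
    proof (rule Bochner_Integration.integral_cong)
      fix \<xi>
      have "cnj (fourier h \<xi>) * echar (- (x \<bullet> \<xi>)) = (LINT y|lebesgue. cnj (h y) * echar (y \<bullet> \<xi>) * echar (- (x \<bullet> \<xi>)))"
        using Bochner_Integration.integral_cnj[of lebesgue "\<lambda>y. h y * echar (- (y \<bullet> \<xi>))"] by (simp add: fourier_def)
      also have "\<dots> = (LINT y|lebesgue. cnj (h y) * echar ((y - x) \<bullet> \<xi>))"
        by (intro Bochner_Integration.integral_cong) (auto simp: inner_diff_left mult.assoc echar_add[symmetric])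
      finally show "gauss d \<xi> * cnj (fourier h \<xi>) * echar (- (x \<bullet> \<xi>)) = gauss d \<xi> * (LINT y|lebesgue. cnj (h y) * echar ((y - x) \<bullet> \<xi>))"
        by (simp add: mult.assoc)
    qed simp
    also have "\<dots> = (LINT y|lebesgue. cnj (h y) * (LINT \<xi>|lebesgue. gauss d \<xi> * echar ((y - x) \<bullet> \<xi>)))"
      using h by (intro lebesgue_pair.Fubini_bounded_kernel[where B=1] gauss_integrable[OF d]) auto
    also have "\<dots> = (LINT y|lebesgue. cnj (h y * gauss_kernel d (x - y)))"
      unfolding gauss_echar(2)[OF d] by (simp add: gauss_kernel_minus)
    finally show ?thesis by (simp only: Bochner_Integration.integral_cnj)
  qed
  have "(LINT \<xi>|lebesgue. gauss d \<xi> * cnj (fourier h \<xi>) * fourier f \<xi>)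
     = (LINT x|lebesgue. f x * (LINT \<xi>|lebesgue. gauss d \<xi> * cnj (fourier h \<xi>) * echar (- (x \<bullet> \<xi>))))"
    unfolding fourier_def[of f]
    by (rule lebesgue_pair.Fubini_bounded_kernel[where B=1, symmetric, OF f g]) auto
  then show ?thesis unfolding inner .
qed

text \<open>Schur's test: the product \<open>norm (f x) * norm (f y)\<close> is at most the mean of
  the two squares, and the symmetric kernel has mass 1 in either variable.\<close>

lemma nn_integral_gauss_kernel_le:
  fixes f :: "'a::euclidean_space \<Rightarrow> complex"
  assumes [measurable]: "f \<in> borel_measurable lebesgue" and d: "0 < d"
  shows "(\<integral>\<^sup>+x. \<integral>\<^sup>+y. ennreal (norm (f x) * norm (f y) * gauss_kernel d (x - y)) \<partial>lebesgue \<partial>lebesgue) \<le> L2sq f"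
proof -
  let ?K = "\<lambda>x y. ennreal (gauss_kernel d (x - y))"
  have [measurable]: "(\<lambda>(x,y). ?K x y) \<in> borel_measurable (lebesgue \<Otimes>\<^sub>M lebesgue)" by measurable
  have [measurable]: "?K x \<in> borel_measurable lebesgue" for x by (intro borel_measurable_lebesgue) measurable
  have [measurable]: "(\<lambda>x. ?K x y) \<in> borel_measurable lebesgue" for y by (intro borel_measurable_lebesgue) measurable
  have swap: "(\<integral>\<^sup>+x. ?K x y \<partial>lebesgue) = 1" for y
    by (rule trans[OF nn_integral_cong gauss_kernel_nn_integral[OF d, of y]]) (simp add: gauss_kernel_minus[of d y])
  have "(\<integral>\<^sup>+x. \<integral>\<^sup>+y. ennreal (norm (f x) * norm (f y) * gauss_kernel d (x - y)) \<partial>lebesgue \<partial>lebesgue)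
     \<le> (\<integral>\<^sup>+x. \<integral>\<^sup>+y. ennreal ((norm (f x))\<^sup>2 / 2) * ?K x y + ennreal ((norm (f y))\<^sup>2 / 2) * ?K x y \<partial>lebesgue \<partial>lebesgue)"
  proof (intro nn_integral_mono)
    fix x y
    have "norm (f x) * norm (f y) \<le> (norm (f x))\<^sup>2 / 2 + (norm (f y))\<^sup>2 / 2"
      using sum_squares_bound[of "norm (f x)" "norm (f y)"] by simp
    then have "norm (f x) * norm (f y) * gauss_kernel d (x - y) \<le> ((norm (f x))\<^sup>2 / 2 + (norm (f y))\<^sup>2 / 2) * gauss_kernel d (x - y)"
      using d by (intro mult_right_mono gauss_kernel_nonneg)
    then show "ennreal (norm (f x) * norm (f y) * gauss_kernel d (x - y)) \<le> ennreal ((norm (f x))\<^sup>2 / 2) * ?K x y + ennreal ((norm (f y))\<^sup>2 / 2) * ?K x y"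
      using d gauss_kernel_nonneg[OF d, of "x - y"]
      by (simp add: ennreal_mult'[symmetric] ennreal_plus[symmetric] distrib_right ennreal_leI del: ennreal_plus)
  qed
  also have "\<dots> = (\<integral>\<^sup>+x. \<integral>\<^sup>+y. ennreal ((norm (f x))\<^sup>2 / 2) * ?K x y \<partial>lebesgue \<partial>lebesgue)
      + (\<integral>\<^sup>+x. \<integral>\<^sup>+y. ennreal ((norm (f y))\<^sup>2 / 2) * ?K x y \<partial>lebesgue \<partial>lebesgue)"
    by (simp add: nn_integral_add lebesgue.borel_measurable_nn_integral)
  also have "(\<integral>\<^sup>+x. \<integral>\<^sup>+y. ennreal ((norm (f y))\<^sup>2 / 2) * ?K x y \<partial>lebesgue \<partial>lebesgue)
     = (\<integral>\<^sup>+y. \<integral>\<^sup>+x. ennreal ((norm (f y))\<^sup>2 / 2) * ?K x y \<partial>lebesgue \<partial>lebesgue)"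
    by (rule lebesgue_pair.Fubini') measurable
  also have "(\<integral>\<^sup>+y. \<integral>\<^sup>+x. ennreal ((norm (f y))\<^sup>2 / 2) * ?K x y \<partial>lebesgue \<partial>lebesgue)
      = (\<integral>\<^sup>+y. ennreal ((norm (f y))\<^sup>2 / 2) \<partial>lebesgue)"
    by (simp add: nn_integral_cmult swap)
  also have "(\<integral>\<^sup>+x. \<integral>\<^sup>+y. ennreal ((norm (f x))\<^sup>2 / 2) * ?K x y \<partial>lebesgue \<partial>lebesgue)
      = (\<integral>\<^sup>+y. ennreal ((norm (f y))\<^sup>2 / 2) \<partial>lebesgue)"
    using gauss_kernel_nn_integral[where 'a='a, OF d]
    by (simp add: nn_integral_cmult)
  also have "(\<integral>\<^sup>+y. ennreal ((norm (f y))\<^sup>2 / 2) \<partial>lebesgue) + (\<integral>\<^sup>+y. ennreal ((norm (f y))\<^sup>2 / 2) \<partial>lebesgue)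
      = (\<integral>\<^sup>+y. ennreal ((norm (f y))\<^sup>2 / 2) + ennreal ((norm (f y))\<^sup>2 / 2) \<partial>lebesgue)"
    by (rule nn_integral_add[symmetric]) auto
  also have "\<dots> = L2sq f"
    unfolding L2sq_def by (intro nn_integral_cong) (simp add: ennreal_plus[symmetric] del: ennreal_plus)
  finally show ?thesis .
qed

text \<open>Parseval with cutoff for \<open>h = f\<close> and the Schur bound control the damped
  integral by \<open>L2sq f\<close> for every \<open>d\<close>; Fatou's lemma removes the cutoff as
  \<open>d\<close> tends to 0. The right-hand side may be infinite.\<close>

lemma fourier_contraction:
  fixes f :: "'a::euclidean_space \<Rightarrow> complex"
  assumes f: "integrable lebesgue f"
  shows "L2sq (fourier f) \<le> L2sq f"
proof -
  note m[measurable] = borel_measurable_integrable[OF f]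
  have le: "(\<integral>\<^sup>+\<xi>. ennreal (gauss d \<xi> * (norm (fourier f \<xi>))\<^sup>2) \<partial>lebesgue) \<le> L2sq f" if d: "0 < d" for d
  proof -
    have sq: "gauss d \<xi> * cnj (fourier f \<xi>) * fourier f \<xi> = complex_of_real (gauss d \<xi> * (norm (fourier f \<xi>))\<^sup>2)" for \<xi>
      using complex_norm_square[of "fourier f \<xi>"] by (simp add: mult_ac)
    have bd: "(norm (fourier f \<xi>))\<^sup>2 \<le> (LINT x|lebesgue. norm (f x))\<^sup>2" for \<xi>
      by (intro power_mono norm_fourier_le) auto
    have int: "integrable lebesgue (\<lambda>\<xi>. gauss d \<xi> * (norm (fourier f \<xi>))\<^sup>2)"
    proof (rule Bochner_Integration.integrable_bound[OF integrable_mult_left[OF gauss_integrable[OF d]]])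
      show "AE \<xi> in lebesgue. norm (gauss d \<xi> * (norm (fourier f \<xi>))\<^sup>2) \<le> norm (complex_of_real (gauss d \<xi>) * of_real ((LINT x|lebesgue. norm (f x))\<^sup>2))"
        using bd by (auto simp: norm_mult abs_mult norm_power intro!: mult_left_mono)
    qed measurable
    have "(\<integral>\<^sup>+\<xi>. ennreal (gauss d \<xi> * (norm (fourier f \<xi>))\<^sup>2) \<partial>lebesgue) = ennreal (LINT \<xi>|lebesgue. gauss d \<xi> * (norm (fourier f \<xi>))\<^sup>2)"
      using int by (intro nn_integral_eq_integral) (auto simp: less_imp_le[OF gauss_pos])
    also have "(LINT \<xi>|lebesgue. gauss d \<xi> * (norm (fourier f \<xi>))\<^sup>2) = Re (LINT \<xi>|lebesgue. gauss d \<xi> * cnj (fourier f \<xi>) * fourier f \<xi>)"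
      unfolding sq by (simp only: integral_complex_of_real Re_complex_of_real)
    also have "\<dots> \<le> norm (LINT x|lebesgue. f x * cnj (LINT y|lebesgue. f y * gauss_kernel d (x - y)))"
      unfolding fourier_parseval_gauss[OF f f d] by (rule complex_Re_le_cmod)
    finally have "(\<integral>\<^sup>+\<xi>. ennreal (gauss d \<xi> * (norm (fourier f \<xi>))\<^sup>2) \<partial>lebesgue)
       \<le> ennreal (norm (LINT x|lebesgue. f x * cnj (LINT y|lebesgue. f y * gauss_kernel d (x - y))))"
      by (simp add: ennreal_leI)
    also have "\<dots> \<le> (\<integral>\<^sup>+x. ennreal (norm (f x * cnj (LINT y|lebesgue. f y * gauss_kernel d (x - y)))) \<partial>lebesgue)"
      by (rule norm_integral_le_nn)
    also have "\<dots> \<le> (\<integral>\<^sup>+x. \<integral>\<^sup>+y. ennreal (norm (f x) * norm (f y) * gauss_kernel d (x - y)) \<partial>lebesgue \<partial>lebesgue)"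
    proof (intro nn_integral_mono)
      fix x :: 'a
      have [measurable]: "(\<lambda>y. gauss_kernel d (x - y)) \<in> borel_measurable lebesgue" by (intro borel_measurable_lebesgue) measurable
      have "ennreal (norm (f x * cnj (LINT y|lebesgue. f y * gauss_kernel d (x - y))))
        = ennreal (norm (f x)) * ennreal (norm (LINT y|lebesgue. f y * gauss_kernel d (x - y)))"
        by (simp add: norm_mult ennreal_mult)
      also have "\<dots> \<le> ennreal (norm (f x)) * (\<integral>\<^sup>+y. ennreal (norm (f y * gauss_kernel d (x - y))) \<partial>lebesgue)"
        by (intro mult_left_mono norm_integral_le_nn) auto
      also have "\<dots> = (\<integral>\<^sup>+y. ennreal (norm (f x) * norm (f y) * gauss_kernel d (x - y)) \<partial>lebesgue)"
        using gauss_kernel_nonneg[OF d, of "x - _"]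
        by (subst nn_integral_cmult[symmetric]) (auto simp: norm_mult ennreal_mult mult.assoc)
      finally show "ennreal (norm (f x * cnj (LINT y|lebesgue. f y * gauss_kernel d (x - y)))) \<le> \<dots>" .
    qed
    also have "\<dots> \<le> L2sq f" by (rule nn_integral_gauss_kernel_le) (use d in auto)
    finally show ?thesis .
  qed
  have "L2sq (fourier f) = (\<integral>\<^sup>+\<xi>. liminf (\<lambda>m. ennreal (gauss (1 / real (Suc m)) \<xi> * (norm (fourier f \<xi>))\<^sup>2)) \<partial>lebesgue)"
    unfolding L2sq_def
  proof (rule nn_integral_cong)
    fix \<xi> :: 'a
    have "(\<lambda>m. ennreal (gauss (1 / real (Suc m)) \<xi> * (norm (fourier f \<xi>))\<^sup>2)) \<longlonglongrightarrow> ennreal (1 * (norm (fourier f \<xi>))\<^sup>2)"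
      by (intro tendsto_intros gauss_tendsto_1)
    then show "ennreal ((norm (fourier f \<xi>))\<^sup>2) = liminf (\<lambda>m. ennreal (gauss (1 / real (Suc m)) \<xi> * (norm (fourier f \<xi>))\<^sup>2))"
      by (subst lim_imp_Liminf) auto
  qed
  also have "\<dots> \<le> liminf (\<lambda>m. \<integral>\<^sup>+\<xi>. ennreal (gauss (1 / real (Suc m)) \<xi> * (norm (fourier f \<xi>))\<^sup>2) \<partial>lebesgue)"
    by (rule nn_integral_liminf) measurable
  also have "\<dots> \<le> liminf (\<lambda>m::nat. L2sq f)"
    by (intro Liminf_mono always_eventually allI le) simp
  also have "\<dots> = L2sq f" by (simp add: Liminf_const)
  finally show ?thesis .
qed

section \<open>The Fourier transform of square integrable functions\<close>

lemma isCont_seq_compose: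
  fixes h :: "'a::euclidean_space \<Rightarrow> 'b::topological_space"
  assumes "isCont h x" shows "(\<lambda>m. h (x + (1 / real (Suc m)) *\<^sub>R z)) \<longlonglongrightarrow> h x"
proof -
  have "(\<lambda>m. x + (1 / real (Suc m)) *\<^sub>R z) \<longlonglongrightarrow> x + 0 *\<^sub>R z"
    by (intro tendsto_intros LIMSEQ_Suc[OF lim_1_over_n[where 'a=real]])
  then show ?thesis using assms by (intro isCont_tendsto_compose[of x h]) auto
qed

text \<open>After the substitution \<open>y = x + d *\<^sub>R z\<close> the weight
  \<open>gauss 1 z\<close> is fixed and only the argument of \<open>h\<close> moves, so continuity
  of \<open>h\<close> at the single point \<open>x\<close> suffices. This allows \<open>h\<close> to
  be the indicator of a ball.\<close>

lemma gauss_kernel_tendsto: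
  fixes h :: "'a::euclidean_space \<Rightarrow> complex"
  assumes [measurable]: "h \<in> borel_measurable borel" and B: "\<And>x. norm (h x) \<le> B" and x: "isCont h x"
  shows "(\<lambda>m. LINT y|lebesgue. h y * gauss_kernel (1 / real (Suc m)) (x - y)) \<longlonglongrightarrow> h x"
proof -
  have eq: "(LINT y|lebesgue. h y * gauss_kernel d (x - y)) = (LINT z|lebesgue. h (x + d *\<^sub>R z) * gauss 1 z)"
    if d: "0 < d" for d
  proof -
    have "(LINT y|lebesgue. h y * gauss_kernel d (x - y)) = (LINT y|lborel. h y * gauss_kernel d (x - y))"
      by (rule integral_completion) measurable
    also have "\<dots> = d ^ DIM('a) *\<^sub>R (LINT z|lborel. h (x + d *\<^sub>R z) * gauss_kernel d (x - (x + d *\<^sub>R z)))"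
      using d by (subst lborel_affine_integral[where t=x and c=d]) auto
    also have "\<dots> = (LINT z|lborel. d ^ DIM('a) *\<^sub>R (h (x + d *\<^sub>R z) * gauss_kernel d (x - (x + d *\<^sub>R z))))"
      by (rule integral_scaleR_right[symmetric])
    also have "\<dots> = (LINT z|lborel. h (x + d *\<^sub>R z) * gauss 1 z)"
      using d by (intro Bochner_Integration.integral_cong) (auto simp: gauss_kernel_def gauss_def scaleR_conv_of_real)
    also have "\<dots> = (LINT z|lebesgue. h (x + d *\<^sub>R z) * gauss 1 z)"
      by (rule integral_completion[symmetric]) measurable
    finally show ?thesis .
  qed
  have one: "(LINT z|lebesgue. complex_of_real (gauss 1 (z::'a))) = 1"
    using gauss_echar(2)[of 1 "0::'a"] by (simp add: gauss_kernel_def gauss_def)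
  have "(\<lambda>m. LINT z|lebesgue. h (x + (1 / real (Suc m)) *\<^sub>R z) * gauss 1 z) \<longlonglongrightarrow> (LINT z::'a|lebesgue. h x * gauss 1 z)"
  proof (rule integral_dominated_convergence[where w="\<lambda>z. B * gauss 1 z"])
    show "integrable lebesgue (\<lambda>z::'a. B * gauss 1 z)"
      using gauss_integrable[OF zero_less_one, where 'a='a] unfolding complex_of_real_integrable_eq by (intro integrable_mult_right)
    show "AE z in lebesgue. (\<lambda>m. h (x + (1 / real (Suc m)) *\<^sub>R z) * gauss 1 z) \<longlonglongrightarrow> h x * gauss 1 z"
      by (intro AE_I2 tendsto_intros isCont_seq_compose x)
    show "AE z in lebesgue. norm (h (x + (1 / real (Suc m)) *\<^sub>R z) * gauss 1 z) \<le> B * gauss 1 z" for m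
      using less_imp_le[OF gauss_pos[where 'a='a]] by (auto simp: norm_mult intro!: mult_right_mono B)
  qed (intro borel_measurable_lebesgue, measurable)+
  moreover have "(LINT z::'a|lebesgue. h x * gauss 1 z) = h x"
    by (simp only: integral_mult_right_zero one mult_1_right)
  ultimately show ?thesis by (subst eq) auto
qed

definition ifourier :: "('a::euclidean_space \<Rightarrow> complex) \<Rightarrow> 'a \<Rightarrow> complex" where
  "ifourier f x = (LINT \<xi>|lebesgue. f \<xi> * echar (x \<bullet> \<xi>))"

lemma ifourier_eq: "ifourier f x = cnj (fourier (\<lambda>\<xi>. cnj (f \<xi>)) x)"
  using Bochner_Integration.integral_cnj[of lebesgue "\<lambda>y. cnj (f y) * echar (- (y \<bullet> x))"]
  by (simp add: ifourier_def fourier_def inner_commute)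

lemma ifourier_measurable [measurable]:
  assumes [measurable]: "f \<in> borel_measurable lebesgue"
  shows "ifourier f \<in> borel_measurable borel"
  unfolding ifourier_eq[abs_def] by measurable

lemma ifourier_contraction: "integrable lebesgue f \<Longrightarrow> L2sq (ifourier f) \<le> L2sq f"
  using fourier_contraction[of "\<lambda>x. cnj (f x)"] by (simp add: ifourier_eq L2sq_def)

lemma integrable_mult_echar:
  fixes \<theta> :: "'a::euclidean_space \<Rightarrow> real"
  assumes "integrable lebesgue f" "\<theta> \<in> borel_measurable lebesgue"
  shows "integrable lebesgue (\<lambda>x. f x * echar (\<theta> x))"
proof (rule Bochner_Integration.integrable_bound[OF assms(1)])
  show "(\<lambda>x. f x * echar (\<theta> x)) \<in> borel_measurable lebesgue"
    using borel_measurable_integrable[OF assms(1)] assms(2) by measurable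
qed (simp add: norm_mult)

lemma fourier_diff:
  assumes "integrable lebesgue f" "integrable lebesgue g"
  shows "fourier (\<lambda>x. f x - g x) = (\<lambda>\<xi>. fourier f \<xi> - fourier g \<xi>)"
  unfolding fourier_def[abs_def] left_diff_distrib using assms
  by (intro ext Bochner_Integration.integral_diff integrable_mult_echar) (auto intro!: borel_measurable_lebesgue)

lemma ifourier_diff:
  assumes "integrable lebesgue f" "integrable lebesgue g"
  shows "ifourier (\<lambda>x. f x - g x) = (\<lambda>\<xi>. ifourier f \<xi> - ifourier g \<xi>)"
  unfolding ifourier_def[abs_def] left_diff_distrib using assms
  by (intro ext Bochner_Integration.integral_diff integrable_mult_echar) (auto intro!: borel_measurable_lebesgue)

definition trunc :: "real \<Rightarrow> ('a::euclidean_space \<Rightarrow> complex) \<Rightarrow> 'a \<Rightarrow> complex" where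
  "trunc R f x = indicator (cball 0 R) x *\<^sub>R f x"

lemma trunc_L2: "L2_fun f \<Longrightarrow> L2_fun (trunc R f)"
  and trunc_integrable: "L2_fun f \<Longrightarrow> integrable lebesgue (trunc R f)"
  and trunc_tendsto: "L2_fun f \<Longrightarrow> ((\<lambda>R. L2sq (\<lambda>x. trunc R f x - f x)) \<longlongrightarrow> 0) at_top"
  unfolding trunc_def[abs_def] by (rule L2_fun_truncation L2_truncation_integrable L2_truncation_tendsto; assumption)+

lemma trunc_measurable [measurable]:
  assumes [measurable]: "f \<in> borel_measurable lebesgue"
  shows "trunc R f \<in> borel_measurable lebesgue"
  unfolding trunc_def[abs_def] by measurable

lemma L2_bounded_support_integrable:
  assumes "L2_fun f" "\<And>x. R < norm x \<Longrightarrow> f x = 0"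
  shows "integrable lebesgue f"
proof -
  have "trunc R f = f" using assms(2) by (fastforce simp: trunc_def indicator_def)
  then show ?thesis using trunc_integrable[OF assms(1), of R] by simp
qed

text \<open>The existence argument shared by the transform and its inverse: truncations of
  \<open>f\<close> are Cauchy in L2, and a contraction keeps them so.\<close>

lemma L2_lim_of_contraction:
  fixes f :: "'a::euclidean_space \<Rightarrow> complex"
  assumes f: "L2_fun f" and T: "\<And>R. L2_fun (T (trunc R f))"
    and contr: "\<And>R R'. L2sq (\<lambda>x. T (trunc R f) x - T (trunc R' f) x) \<le> L2sq (\<lambda>x. trunc R f x - trunc R' f x)"
  shows "\<exists>g. L2_lim (\<lambda>R. T (trunc R f)) g"
proof (rule L2_complete[OF T])
  fix \<epsilon> :: real assume e: "0 < \<epsilon>"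
  note [measurable] = L2_funD(1)[OF f]
  have "\<forall>\<^sub>F R in at_top. L2sq (\<lambda>x. trunc R f x - f x) < ennreal (\<epsilon> / 4)"
    using trunc_tendsto[OF f] e by (intro order_tendstoD) auto
  then obtain R0 where R0: "\<And>R. R \<ge> R0 \<Longrightarrow> L2sq (\<lambda>x. trunc R f x - f x) < ennreal (\<epsilon> / 4)"
    by (auto simp: eventually_at_top_linorder)
  have "L2sq (\<lambda>x. T (trunc R f) x - T (trunc R' f) x) \<le> ennreal \<epsilon>" if "R \<ge> R0" "R' \<ge> R0" for R R'
  proof -
    have "L2sq (\<lambda>x. T (trunc R f) x - T (trunc R' f) x) \<le> L2sq (\<lambda>x. trunc R f x - trunc R' f x)" by (rule contr)
    also have "\<dots> \<le> 2 * L2sq (\<lambda>x. trunc R f x - f x) + 2 * L2sq (\<lambda>x. trunc R' f x - f x)"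
      using L2sq_triangle[of "trunc R f" f "trunc R' f"] L2sq_minus_commute[of f "trunc R' f"] by simp
    also have "\<dots> \<le> 2 * ennreal (\<epsilon> / 4) + 2 * ennreal (\<epsilon> / 4)"
      using R0[OF that(1)] R0[OF that(2)] by (intro add_mono mult_left_mono) auto
    also have "\<dots> = ennreal (2 * (\<epsilon> / 4) + 2 * (\<epsilon> / 4))"
      using e by (simp only: ennreal_plus ennreal_mult' ennreal_numeral zero_le_numeral zero_le_mult_iff zero_le_divide_iff less_imp_le simp_thms)
    finally show ?thesis by simp
  qed
  then show "\<exists>R0. \<forall>R\<ge>R0. \<forall>R'\<ge>R0. L2sq (\<lambda>x. T (trunc R f) x - T (trunc R' f) x) \<le> ennreal \<epsilon>" by blast
qed

lemma L2_fun_fourier: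
  assumes "integrable lebesgue f" "L2_fun f" shows "L2_fun (fourier f)" "L2_fun (ifourier f)"
  using fourier_contraction[OF assms(1)] ifourier_contraction[OF assms(1)] assms(2)
  by (auto simp: L2_fun_iff intro: le_less_trans intro!: borel_measurable_lebesgue)

text \<open>Shows that the choice operator in \<open>fourier_L2\<close> has something to choose
  from, so the defining limit really holds.\<close>

lemma fourier_L2_lim:
  assumes f: "L2_fun f"
  shows "L2_lim (\<lambda>R. fourier (trunc R f)) (fourier_L2 f)"
proof -
  have "\<exists>g. L2_lim (\<lambda>R. fourier (trunc R f)) g"
  proof (rule L2_lim_of_contraction[OF f])
    show "L2_fun (fourier (trunc R f))" for R
      by (intro L2_fun_fourier trunc_integrable trunc_L2 f)
    show "L2sq (\<lambda>x. fourier (trunc R f) x - fourier (trunc R' f) x) \<le> L2sq (\<lambda>x. trunc R f x - trunc R' f x)" for R R'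
      using fourier_contraction[of "\<lambda>x. trunc R f x - trunc R' f x"] trunc_integrable[OF f]
      by (simp add: fourier_diff)
  qed
  then show ?thesis unfolding fourier_L2_def trunc_def[abs_def] by (rule someI_ex)
qed

lemma fourier_L2_L2: "L2_fun f \<Longrightarrow> L2_fun (fourier_L2 f)"
  using fourier_L2_lim L2_lim_iff by blast

lemma ifourier_L2_lim_ex:
  assumes f: "L2_fun f"
  shows "\<exists>g. L2_lim (\<lambda>R. ifourier (trunc R f)) g"
proof (rule L2_lim_of_contraction[OF f])
  show "L2_fun (ifourier (trunc R f))" for R
    by (intro L2_fun_fourier trunc_integrable trunc_L2 f)
  show "L2sq (\<lambda>x. ifourier (trunc R f) x - ifourier (trunc R' f) x) \<le> L2sq (\<lambda>x. trunc R f x - trunc R' f x)" for R R'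
    using ifourier_contraction[of "\<lambda>x. trunc R f x - trunc R' f x"] trunc_integrable[OF f]
    by (simp add: ifourier_diff)
qed

definition evolved :: "('a::euclidean_space \<Rightarrow> real) \<Rightarrow> real \<Rightarrow> ('a \<Rightarrow> complex) \<Rightarrow> 'a \<Rightarrow> complex" where
  "evolved P t g \<xi> = g \<xi> * echar (t * P \<xi>)"

lemma evolved_0 [simp]: "evolved P 0 g = g"
  by (simp add: evolved_def[abs_def])

lemma evolved_L2:
  assumes "L2_fun g" "P \<in> borel_measurable borel"
  shows "L2_fun (evolved P t g)"
proof (rule L2_fun_mono[OF assms(1)])
  have [measurable]: "g \<in> borel_measurable lebesgue" "P \<in> borel_measurable lebesgue"
    using assms by (auto intro: borel_measurable_lebesgue simp: L2_fun_iff)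
  show "evolved P t g \<in> borel_measurable lebesgue" unfolding evolved_def[abs_def] by measurable
qed (simp add: evolved_def norm_mult)

lemma propagator_eq:
  "propagator P t f = (SOME u. L2_lim (\<lambda>R. ifourier (trunc R (evolved P t (fourier_L2 f)))) u)"
proof -
  have "(LINT \<xi>:cball 0 R|lebesgue. fourier_L2 f \<xi> * echar (x \<bullet> \<xi> + t * P \<xi>))
     = ifourier (trunc R (evolved P t (fourier_L2 f))) x" for R x
    unfolding set_lebesgue_integral_def ifourier_def trunc_def evolved_def
    by (intro Bochner_Integration.integral_cong) (auto simp: echar_add scaleR_conv_of_real mult_ac)
  then show ?thesis unfolding propagator_def by simp
qed

text \<open>The multiplier \<open>echar (t * P \<xi>)\<close> is unimodular, so the evolved
  transform stays in L2 and the inverse transform of its truncations converges.\<close>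

lemma propagator_lim:
  assumes "L2_fun f" "P \<in> borel_measurable borel"
  shows "L2_lim (\<lambda>R. ifourier (trunc R (evolved P t (fourier_L2 f)))) (propagator P t f)"
  unfolding propagator_eq by (rule someI_ex[OF ifourier_L2_lim_ex]) (intro evolved_L2 fourier_L2_L2 assms)

section \<open>Averages over balls as pairings on the frequency side\<close>

lemma
  fixes a :: "'a::euclidean_space"
  shows indicator_ball_integrable: "integrable lebesgue (\<lambda>x. indicator (ball a r) x :: complex)"
  and L2_fun_indicator_ball: "L2_fun (\<lambda>x. indicator (ball a r) x)"
proof -
  have "emeasure lebesgue (ball a r) < \<infinity>" using emeasure_bounded_finite[OF bounded_ball] by simp
  then have "integrable lebesgue (\<lambda>x. complex_of_real (indicator (ball a r) x))"
    by (intro integrable_of_real integrable_real_indicator) auto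
  moreover have "complex_of_real (indicator (ball a r) x) = indicator (ball a r) x" for x
    by (simp add: indicator_def)
  ultimately show "integrable lebesgue (\<lambda>x. indicator (ball a r) x :: complex)" by simp
  show "L2_fun (\<lambda>x. indicator (ball a r) x)"
  proof (rule L2_fun_of_bounded_support[where B=1 and R="norm a + r"])
    fix x :: 'a assume "norm a + r < norm x"
    then have "x \<notin> ball a r" using norm_triangle_sub[of x a] by (auto simp: dist_norm norm_minus_commute)
    then show "indicator (ball a r) x = (0::complex)" by simp
  qed (auto simp: indicator_def)
qed

lemma set_LINT_ball: "(LINT y:ball a r|lebesgue. g y) = (LINT y|lebesgue. g y * (indicator (ball a r) y :: complex))"
  unfolding set_lebesgue_integral_def by (intro Bochner_Integration.integral_cong) (auto simp: indicator_def)

abbreviation ball_ft :: "'a::euclidean_space \<Rightarrow> real \<Rightarrow> 'a \<Rightarrow> complex" where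
  "ball_ft a r \<equiv> \<lambda>\<xi>. cnj (fourier (\<lambda>x. indicator (ball a r) x) \<xi>)"

lemma ball_ft_L2: "L2_fun (ball_ft a r)"
proof -
  have "L2_fun (fourier (\<lambda>x. indicator (ball a r) x))"
    by (intro L2_fun_fourier indicator_ball_integrable L2_fun_indicator_ball)
  then show ?thesis by (simp add: L2_fun_def)
qed

text \<open>The cutoff in \<open>fourier_parseval_gauss\<close> is removed on both sides by
  dominated convergence. On the frequency side the product of two L2 functions dominates. On the
  space side the mollified indicator is bounded by 1 and converges off the boundary sphere, a null
  set.\<close>

lemma ball_parseval_L1:
  fixes f :: "'a::euclidean_space \<Rightarrow> complex"
  assumes f: "L2_fun f" "integrable lebesgue f"
  shows "(LINT y:ball a r|lebesgue. f y) = (LINT \<xi>|lebesgue. fourier f \<xi> * ball_ft a r \<xi>)"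
proof -
  let ?h = "\<lambda>x. indicator (ball a r) x :: complex"
  let ?d = "\<lambda>m. 1 / real (Suc m)"
  note [measurable] = borel_measurable_integrable[OF f(2)]
  have [measurable]: "?h \<in> borel_measurable borel" by (intro borel_measurable_indicator) auto
  have [measurable]: "?h \<in> borel_measurable lebesgue" by (intro borel_measurable_lebesgue) measurable
  have int: "integrable lebesgue (\<lambda>\<xi>. fourier f \<xi> * ball_ft a r \<xi>)"
    by (intro L2_integrable_mult ball_ft_L2 L2_fun_fourier f)
  have "(\<lambda>m. LINT \<xi>|lebesgue. gauss (?d m) \<xi> * cnj (fourier ?h \<xi>) * fourier f \<xi>)
     \<longlonglongrightarrow> (LINT \<xi>|lebesgue. fourier f \<xi> * ball_ft a r \<xi>)"
  proof (rule integral_dominated_convergence[where w="\<lambda>\<xi>. norm (fourier f \<xi> * ball_ft a r \<xi>)"])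
    show "integrable lebesgue (\<lambda>\<xi>. norm (fourier f \<xi> * ball_ft a r \<xi>))" using int by (rule integrable_norm)
    show "AE \<xi> in lebesgue. (\<lambda>m. gauss (?d m) \<xi> * cnj (fourier ?h \<xi>) * fourier f \<xi>) \<longlonglongrightarrow> fourier f \<xi> * ball_ft a r \<xi>"
    proof (rule AE_I2)
      fix \<xi> :: 'a
      have "(\<lambda>m. gauss (?d m) \<xi> * cnj (fourier ?h \<xi>) * fourier f \<xi>) \<longlonglongrightarrow> of_real 1 * cnj (fourier ?h \<xi>) * fourier f \<xi>"
        by (intro tendsto_intros gauss_tendsto_1)
      then show "(\<lambda>m. gauss (?d m) \<xi> * cnj (fourier ?h \<xi>) * fourier f \<xi>) \<longlonglongrightarrow> fourier f \<xi> * ball_ft a r \<xi>"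
        by (simp add: mult.commute)
    qed
    show "AE \<xi> in lebesgue. norm (gauss (?d m) \<xi> * cnj (fourier ?h \<xi>) * fourier f \<xi>) \<le> norm (fourier f \<xi> * ball_ft a r \<xi>)" for m
    proof (rule AE_I2)
      fix \<xi> :: 'a
      have "norm (gauss (?d m) \<xi> * cnj (fourier ?h \<xi>) * fourier f \<xi>) = gauss (?d m) \<xi> * norm (fourier f \<xi> * ball_ft a r \<xi>)"
        using gauss_pos[of "?d m" \<xi>] by (simp add: norm_mult)
      also have "\<dots> \<le> 1 * norm (fourier f \<xi> * ball_ft a r \<xi>)"
        by (intro mult_right_mono gauss_le_1) auto
      finally show "norm (gauss (?d m) \<xi> * cnj (fourier ?h \<xi>) * fourier f \<xi>) \<le> norm (fourier f \<xi> * ball_ft a r \<xi>)" by simp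
    qed
  qed (intro borel_measurable_lebesgue, measurable)+
  moreover have "(\<lambda>m. LINT x|lebesgue. f x * cnj (LINT y|lebesgue. ?h y * gauss_kernel (?d m) (x - y)))
     \<longlonglongrightarrow> (LINT x|lebesgue. f x * ?h x)"
  proof (rule integral_dominated_convergence[where w="\<lambda>x. norm (f x)"])
    show "integrable lebesgue (\<lambda>x. norm (f x))" using f(2) by (rule integrable_norm)
    have "AE x in lebesgue. x \<notin> sphere a r"
      using negligible_sphere[of a r] by (intro AE_not_in) (simp add: negligible_iff_null_sets)
    then show "AE x in lebesgue. (\<lambda>m. f x * cnj (LINT y|lebesgue. ?h y * gauss_kernel (?d m) (x - y))) \<longlonglongrightarrow> f x * ?h x"
    proof eventually_elim
      case (elim x)
      have "isCont ?h x"
      proof (cases "x \<in> ball a r")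
        case True
        then have "\<forall>\<^sub>F y in nhds x. ?h y = 1"
          by (intro eventually_mono[OF eventually_nhds_in_open[of "ball a r"]]) auto
        then show ?thesis by (rule isCont_cong[THEN iffD2]) simp
      next
        case False
        with elim have "x \<in> - cball a r" by (auto simp: less_le)
        then have "\<forall>\<^sub>F y in nhds x. ?h y = 0"
          by (intro eventually_mono[OF eventually_nhds_in_open[of "- cball a r"]]) auto
        then show ?thesis by (rule isCont_cong[THEN iffD2]) simp
      qed
      then have "(\<lambda>m. LINT y|lebesgue. ?h y * gauss_kernel (?d m) (x - y)) \<longlonglongrightarrow> ?h x"
        by (intro gauss_kernel_tendsto[where B=1]) (auto simp: indicator_def)
      then have "(\<lambda>m. f x * cnj (LINT y|lebesgue. ?h y * gauss_kernel (?d m) (x - y))) \<longlonglongrightarrow> f x * cnj (?h x)"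
        by (intro tendsto_intros)
      moreover have "cnj (?h x) = ?h x" by (simp add: indicator_def)
      ultimately show ?case by (simp only:)
    qed
    show "AE x in lebesgue. norm (f x * cnj (LINT y|lebesgue. ?h y * gauss_kernel (?d m) (x - y))) \<le> norm (f x)" for m
    proof (rule AE_I2)
      fix x
      have "ennreal (norm (LINT y|lebesgue. ?h y * gauss_kernel (?d m) (x - y))) \<le> (\<integral>\<^sup>+y. ennreal (norm (?h y * gauss_kernel (?d m) (x - y))) \<partial>lebesgue)"
        by (rule norm_integral_le_nn)
      also have "\<dots> \<le> (\<integral>\<^sup>+y. ennreal (gauss_kernel (?d m) (x - y)) \<partial>lebesgue)"
      proof (intro nn_integral_mono ennreal_leI)
        fix y show "norm (?h y * gauss_kernel (?d m) (x - y)) \<le> gauss_kernel (?d m) (x - y)"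
          using gauss_kernel_nonneg[of "?d m" "x - y"] by (auto simp: indicator_def)
      qed
      also have "\<dots> = 1" by (rule gauss_kernel_nn_integral) simp
      finally have "norm (LINT y|lebesgue. ?h y * gauss_kernel (?d m) (x - y)) \<le> 1" by simp
      then show "norm (f x * cnj (LINT y|lebesgue. ?h y * gauss_kernel (?d m) (x - y))) \<le> norm (f x)"
        unfolding norm_mult complex_mod_cnj by (rule mult_left_le) simp
    qed
    have [measurable]: "(\<lambda>x. LINT y|lebesgue. ?h y * gauss_kernel (?d m) (x - y)) \<in> borel_measurable lebesgue" for m
      by (intro lebesgue.borel_measurable_lebesgue_integral) measurable
    show "(\<lambda>x. f x * cnj (LINT y|lebesgue. ?h y * gauss_kernel (?d m) (x - y))) \<in> borel_measurable lebesgue" for m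
      by measurable
  qed measurable
  ultimately show ?thesis
    using fourier_parseval_gauss[OF f(2) indicator_ball_integrable] set_LINT_ball[of a r f]
    by (simp add: LIMSEQ_unique)
qed

lemma ball_parseval:
  assumes f: "L2_fun f"
  shows "(LINT y:ball a r|lebesgue. f y) = (LINT \<xi>|lebesgue. fourier_L2 f \<xi> * ball_ft a r \<xi>)"
proof (rule tendsto_unique[OF trivial_limit_at_top_linorder])
  have "((\<lambda>R. LINT y|lebesgue. trunc R f y * indicator (ball a r) y) \<longlongrightarrow> (LINT y|lebesgue. f y * indicator (ball a r) y)) at_top"
    by (intro L2_tendsto_pairing trunc_L2 trunc_tendsto f L2_fun_indicator_ball)
  then show "((\<lambda>R. LINT y:ball a r|lebesgue. trunc R f y) \<longlongrightarrow> (LINT y:ball a r|lebesgue. f y)) at_top"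
    by (simp add: set_LINT_ball)
  have "((\<lambda>R. LINT y|lebesgue. fourier (trunc R f) y * ball_ft a r y) \<longlongrightarrow> (LINT y|lebesgue. fourier_L2 f y * ball_ft a r y)) at_top"
    using fourier_L2_lim[OF f]
    by (intro L2_tendsto_pairing trunc_L2 L2_fun_fourier trunc_integrable fourier_L2_L2 f ball_ft_L2) (simp add: L2_lim_iff)
  then show "((\<lambda>R. LINT y:ball a r|lebesgue. trunc R f y) \<longlongrightarrow> (LINT y|lebesgue. fourier_L2 f y * ball_ft a r y)) at_top"
    by (simp add: ball_parseval_L1 trunc_L2 trunc_integrable f)
qed

lemma LINT_ball_ifourier:
  fixes g :: "'a::euclidean_space \<Rightarrow> complex"
  assumes g: "integrable lebesgue g"
  shows "(LINT y:ball a r|lebesgue. ifourier g y) = (LINT \<xi>|lebesgue. g \<xi> * ball_ft a r \<xi>)"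
proof -
  let ?h = "\<lambda>x::'a. indicator (ball a r) x :: complex"
  have "(LINT y:ball a r|lebesgue. ifourier g y) = (LINT y|lebesgue. ?h y * (LINT \<xi>|lebesgue. g \<xi> * echar (y \<bullet> \<xi>)))"
    by (simp add: set_LINT_ball ifourier_def mult.commute)
  also have "\<dots> = (LINT \<xi>|lebesgue. g \<xi> * (LINT y|lebesgue. ?h y * echar (y \<bullet> \<xi>)))"
    by (intro lebesgue_pair.Fubini_bounded_kernel[where B=1] indicator_ball_integrable g) auto
  also have "(\<lambda>\<xi>. LINT y|lebesgue. ?h y * echar (y \<bullet> \<xi>)) = ball_ft a r"
  proof
    fix \<xi>
    have "(LINT y|lebesgue. cnj (?h y * echar (- (y \<bullet> \<xi>)))) = cnj (LINT y|lebesgue. ?h y * echar (- (y \<bullet> \<xi>)))"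
      by (rule Bochner_Integration.integral_cnj)
    moreover have "cnj (?h y) = ?h y" for y by (simp add: indicator_def)
    ultimately show "(LINT y|lebesgue. ?h y * echar (y \<bullet> \<xi>)) = ball_ft a r \<xi>"
      by (simp add: fourier_def)
  qed
  finally show ?thesis .
qed

text \<open>Averages over balls are pairings with \<open>L\<^sup>2\<close> functions, so Fourier inversion is only needed in
  this weak form.\<close>

lemma ball_integral_tendsto:
  assumes f: "L2_fun f" 
  shows "((\<lambda>R. LINT y:ball a r|lebesgue. ifourier (trunc R (fourier_L2 f)) y) \<longlongrightarrow> (LINT y:ball a r|lebesgue. f y)) at_top"
proof -
  have "((\<lambda>R. LINT \<xi>|lebesgue. trunc R (fourier_L2 f) \<xi> * ball_ft a r \<xi>) \<longlongrightarrow> (LINT \<xi>|lebesgue. fourier_L2 f \<xi> * ball_ft a r \<xi>)) at_top"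
    by (intro L2_tendsto_pairing trunc_L2 trunc_tendsto fourier_L2_L2 f ball_ft_L2)
  then show ?thesis
    by (simp add: LINT_ball_ifourier trunc_integrable fourier_L2_L2 f ball_parseval)
qed

lemma ball_integral_propagator_tendsto:
  assumes f: "L2_fun f" and P: "P \<in> borel_measurable borel"
  shows "((\<lambda>R. LINT y:ball a r|lebesgue. ifourier (trunc R (evolved P t (fourier_L2 f))) y)
    \<longlongrightarrow> (LINT y:ball a r|lebesgue. propagator P t f y)) at_top"
  unfolding set_LINT_ball
  using propagator_lim[OF f P, of t]
  by (intro L2_tendsto_pairing L2_fun_fourier trunc_integrable trunc_L2 evolved_L2 fourier_L2_L2 f P L2_fun_indicator_ball)
     (auto simp: L2_lim_iff)

section \<open>Fourier inversion for inverse transforms of test functions\<close>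

text \<open>The Gaussian cutoff turns the left-hand side into \<open>b\<close> convolved with an
  approximate identity. Since \<open>b\<close> is continuous, the inversion holds at every point;
  this matters because the support condition in the dispersive hypothesis concerns all values of
  \<open>fourier \<phi>\<close>.\<close>

lemma fourier_ifourier:
  fixes b :: "'a::euclidean_space \<Rightarrow> complex"
  assumes b: "integrable lebesgue b" "continuous_on UNIV b" "\<And>x. norm (b x) \<le> B"
    and \<phi>: "integrable lebesgue (ifourier b)"
  shows "fourier (ifourier b) \<xi> = b \<xi>"
proof -
  let ?d = "\<lambda>m. 1 / real (Suc m)"
  have [measurable]: "b \<in> borel_measurable borel" using b(2) by (rule borel_measurable_continuous_onI)
  have "(\<lambda>m. LINT x|lebesgue. (gauss (?d m) x * echar (- (x \<bullet> \<xi>))) * ifourier b x) \<longlonglongrightarrow> (LINT x|lebesgue. ifourier b x * echar (- (x \<bullet> \<xi>)))"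
  proof (rule integral_dominated_convergence[where w="\<lambda>x. norm (ifourier b x)"])
    show "integrable lebesgue (\<lambda>x. norm (ifourier b x))" using \<phi> by (rule integrable_norm)
    show "AE x in lebesgue. (\<lambda>m. (gauss (?d m) x * echar (- (x \<bullet> \<xi>))) * ifourier b x) \<longlonglongrightarrow> ifourier b x * echar (- (x \<bullet> \<xi>))"
    proof (rule AE_I2)
      fix x :: 'a
      have "(\<lambda>m. (gauss (?d m) x * echar (- (x \<bullet> \<xi>))) * ifourier b x) \<longlonglongrightarrow> (of_real 1 * echar (- (x \<bullet> \<xi>))) * ifourier b x"
        by (intro tendsto_intros gauss_tendsto_1)
      then show "(\<lambda>m. (gauss (?d m) x * echar (- (x \<bullet> \<xi>))) * ifourier b x) \<longlonglongrightarrow> ifourier b x * echar (- (x \<bullet> \<xi>))"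
        by (simp add: mult.commute)
    qed
    show "AE x in lebesgue. norm ((gauss (?d m) x * echar (- (x \<bullet> \<xi>))) * ifourier b x) \<le> norm (ifourier b x)" for m
      using gauss_le_1[of "?d m", where 'a='a] less_imp_le[OF gauss_pos[of "?d m", where 'a='a]] by (auto simp: norm_mult simp del: of_nat_Suc intro!: mult_left_le_one_le)
  qed (intro borel_measurable_lebesgue, measurable)+
  moreover have "(LINT x|lebesgue. (gauss d x * echar (- (x \<bullet> \<xi>))) * ifourier b x) = (LINT \<eta>|lebesgue. b \<eta> * gauss_kernel d (\<xi> - \<eta>))"
    if d: "0 < d" for d
  proof -
    have "(LINT x|lebesgue. (gauss d x * echar (- (x \<bullet> \<xi>))) * ifourier b x)
       = (LINT \<eta>|lebesgue. b \<eta> * (LINT x|lebesgue. (gauss d x * echar (- (x \<bullet> \<xi>))) * echar (x \<bullet> \<eta>)))"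
      unfolding ifourier_def
      by (intro lebesgue_pair.Fubini_bounded_kernel[where B=1] integrable_mult_echar gauss_integrable d b)
         (auto intro!: borel_measurable_lebesgue)
    also have "(\<lambda>\<eta>. LINT x|lebesgue. (gauss d x * echar (- (x \<bullet> \<xi>))) * echar (x \<bullet> \<eta>)) = (\<lambda>\<eta>. complex_of_real (gauss_kernel d (\<xi> - \<eta>)))"
    proof
      fix \<eta>
      have "(LINT x|lebesgue. (gauss d x * echar (- (x \<bullet> \<xi>))) * echar (x \<bullet> \<eta>)) = (LINT x|lebesgue. gauss d x * echar ((\<eta> - \<xi>) \<bullet> x))"
        by (intro Bochner_Integration.integral_cong) (auto simp: mult.assoc echar_add[symmetric] inner_diff_left inner_diff_right inner_commute)
      then show "(LINT x|lebesgue. (gauss d x * echar (- (x \<bullet> \<xi>))) * echar (x \<bullet> \<eta>)) = complex_of_real (gauss_kernel d (\<xi> - \<eta>))"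
        unfolding gauss_echar(2)[OF d] gauss_kernel_minus[of d \<xi>] .
    qed
    finally show ?thesis .
  qed
  moreover have "(\<lambda>m. LINT \<eta>|lebesgue. b \<eta> * gauss_kernel (?d m) (\<xi> - \<eta>)) \<longlonglongrightarrow> b \<xi>"
    using b by (intro gauss_kernel_tendsto) (auto simp: continuous_on_eq_continuous_at)
  ultimately show ?thesis
    by (simp add: fourier_def LIMSEQ_unique)
qed

lemma fourier_L2_eq_fourier:
  assumes f: "L2_fun f" "integrable lebesgue f"
  shows "AE \<xi> in lebesgue. fourier_L2 f \<xi> = fourier f \<xi>"
proof (rule L2_lim_unique[OF _ fourier_L2_lim[OF f(1)]])
  show "fourier (trunc R f) \<in> borel_measurable lebesgue" for R
    by (intro borel_measurable_lebesgue fourier_measurable trunc_measurable L2_funD f)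
  have "L2sq (\<lambda>x. fourier (trunc R f) x - fourier f x) \<le> L2sq (\<lambda>x. trunc R f x - f x)" for R
    using fourier_contraction[of "\<lambda>x. trunc R f x - f x"] trunc_integrable[OF f(1)] f(2)
    by (simp add: fourier_diff)
  then show "L2_lim (\<lambda>R. fourier (trunc R f)) (fourier f)"
    using L2_fun_fourier[OF f(2,1)] ennreal_tendsto_0_sandwich[OF _ trunc_tendsto[OF f(1)]]
    by (auto simp: L2_lim_iff)
qed

lemma ifourier_cong_AE:
  fixes f g :: "'a::euclidean_space \<Rightarrow> complex"
  assumes "AE \<xi> in lebesgue. f \<xi> = g \<xi>" "f \<in> borel_measurable lebesgue" "g \<in> borel_measurable lebesgue"
  shows "ifourier f = ifourier g"
proof
  fix x :: 'a
  have [measurable]: "(\<lambda>\<xi>. echar (x \<bullet> \<xi>)) \<in> borel_measurable lebesgue" by (intro borel_measurable_lebesgue) measurable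
  show "ifourier f x = ifourier g x"
    unfolding ifourier_def using assms by (intro integral_cong_AE) (auto elim!: eventually_mono)
qed

text \<open>The link between the dispersive hypothesis, which speaks of \<open>propagator\<close>,
  and the kernel: for test functions of this kind the chosen L2 limits agree almost everywhere with
  an absolutely convergent oscillatory integral.\<close>

lemma propagator_ifourier:
  fixes b :: "'a::euclidean_space \<Rightarrow> complex"
  assumes b: "continuous_on UNIV b" "\<And>x. norm (b x) \<le> B" "\<And>x. R < norm x \<Longrightarrow> b x = 0"
    and \<phi>: "integrable lebesgue (ifourier b)" and P: "P \<in> borel_measurable borel"
  shows "AE x in lebesgue. propagator P t (ifourier b) x = ifourier (evolved P t b) x"
proof -
  have [measurable]: "b \<in> borel_measurable borel" "P \<in> borel_measurable borel" 
    using b(1) P by (auto intro: borel_measurable_continuous_onI)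
  have b2: "L2_fun b" using b by (intro L2_fun_of_bounded_support) auto
  have trunc_b: "trunc r b = b" if "r \<ge> R" for r
    using b(3) that by (fastforce simp: trunc_def indicator_def)
  have trunc_e: "trunc r (evolved P t b) = evolved P t b" if "r \<ge> R" for r
    using b(3) that by (fastforce simp: trunc_def indicator_def evolved_def)
  have b1: "integrable lebesgue b" using trunc_integrable[OF b2, of R] trunc_b by simp
  have e2: "L2_fun (evolved P t b)" by (intro evolved_L2 b2 P)
  have e1: "integrable lebesgue (evolved P t b)" using trunc_integrable[OF e2, of R] trunc_e by simp
  have \<phi>2: "L2_fun (ifourier b)" by (intro L2_fun_fourier b1 b2)
  have "AE \<xi> in lebesgue. fourier_L2 (ifourier b) \<xi> = b \<xi>"
    using fourier_L2_eq_fourier[OF \<phi>2 \<phi>] fourier_ifourier[OF b1 b(1,2) \<phi>] by simp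
  then have ae: "AE \<xi> in lebesgue. trunc r (evolved P t (fourier_L2 (ifourier b))) \<xi> = trunc r (evolved P t b) \<xi>" for r
    by eventually_elim (simp add: trunc_def evolved_def)
  have eq: "ifourier (trunc r (evolved P t (fourier_L2 (ifourier b)))) = ifourier (trunc r (evolved P t b))" for r
    by (rule ifourier_cong_AE[OF ae]) (intro L2_funD trunc_L2 e2 evolved_L2 fourier_L2_L2 \<phi>2 P)+
  \<comment> \<open>Once \<open>r\<close> exceeds the support radius the truncation does nothing, so
    the family is eventually constant.\<close>
  have "L2_lim (\<lambda>r. ifourier (trunc r (evolved P t b))) (ifourier (evolved P t b))"
    unfolding L2_lim_iff
  proof
    show "L2_fun (ifourier (evolved P t b))" by (intro L2_fun_fourier e1 e2)
    show "((\<lambda>r. L2sq (\<lambda>x. ifourier (trunc r (evolved P t b)) x - ifourier (evolved P t b) x)) \<longlongrightarrow> 0) at_top"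
      by (rule tendsto_eventually, rule eventually_mono[OF eventually_ge_at_top[of R]]) (simp add: trunc_e L2sq_def)
  qed
  then show ?thesis
    using propagator_lim[OF \<phi>2 P, of t] unfolding eq
    by (intro L2_lim_unique[of "\<lambda>r. ifourier (trunc r (evolved P t b))"]) (simp_all add: borel_measurable_lebesgue ifourier_measurable L2_funD trunc_L2 e2)
qed

section \<open>Smooth functions\<close>

abbreviation partial :: "'a::euclidean_space \<Rightarrow> ('a \<Rightarrow> 'b::real_normed_vector) \<Rightarrow> 'a \<Rightarrow> 'b" where
  "partial b f x \<equiv> frechet_derivative f (at x) b"

text \<open>The recursion peels off the innermost derivative, while \<open>iter_partial\<close>
  peels off the outermost one. This direction permits induction over the order with the function
  generalised, as the product and chain rules require.\<close>

primrec differentiable_upto :: "nat \<Rightarrow> 'a set \<Rightarrow> ('a::euclidean_space \<Rightarrow> 'b::real_normed_vector) \<Rightarrow> bool" where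
  "differentiable_upto 0 S f \<longleftrightarrow> (\<forall>x\<in>S. f differentiable at x)"
| "differentiable_upto (Suc m) S f \<longleftrightarrow> (\<forall>x\<in>S. f differentiable at x) \<and>
    (\<forall>b\<in>Basis. differentiable_upto m S (partial b f))"

lemma differentiable_uptoD: "differentiable_upto m S f \<Longrightarrow> x \<in> S \<Longrightarrow> f differentiable at x"
  by (cases m) auto

lemma differentiable_upto_SucD: "differentiable_upto (Suc m) S f \<Longrightarrow> differentiable_upto m S f"
  by (induction m arbitrary: f) auto

lemma iter_partial_snoc: "iter_partial (bs @ [b]) f = iter_partial bs (partial b f)"
  by (induction bs) auto

lemma differentiable_upto_iff_iter_partial:
  "differentiable_upto m S f \<longleftrightarrow>
    (\<forall>bs. set bs \<subseteq> Basis \<and> length bs \<le> m \<longrightarrow> (\<forall>x\<in>S. iter_partial bs f differentiable at x))"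
proof (induction m arbitrary: f)
  case (Suc m)
  have "(\<forall>bs. set bs \<subseteq> Basis \<and> length bs \<le> Suc m \<longrightarrow> (\<forall>x\<in>S. iter_partial bs f differentiable at x))
    \<longleftrightarrow> (\<forall>x\<in>S. f differentiable at x) \<and> (\<forall>b\<in>Basis. \<forall>bs. set bs \<subseteq> Basis \<and> length bs \<le> m \<longrightarrow>
         (\<forall>x\<in>S. iter_partial bs (partial b f) differentiable at x))" (is "?L \<longleftrightarrow> ?R")
  proof
    assume L: ?L
    show ?R
    proof (intro conjI ballI allI impI)
      show "f differentiable at x" if "x \<in> S" for x
        using L[rule_format, of "[]"] that by simp
      show "iter_partial bs (partial b f) differentiable at x"
        if "b \<in> Basis" "set bs \<subseteq> Basis \<and> length bs \<le> m" "x \<in> S" for b bs x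
        using L[rule_format, of "bs @ [b]" x] that by (simp add: iter_partial_snoc)
    qed
  next
    assume R: ?R
    show ?L
    proof (intro allI impI ballI)
      fix bs :: "'a list" and x assume bs: "set bs \<subseteq> Basis \<and> length bs \<le> Suc m" "x \<in> S"
      show "iter_partial bs f differentiable at x"
      proof (cases bs rule: rev_cases)
        case (snoc cs b)
        then show ?thesis using R bs by (auto simp: iter_partial_snoc)
      qed (use R bs in auto)
    qed
  qed
  then show ?case by (simp add: Suc.IH)
qed auto

lemma smooth_on_iff: "smooth_on S f \<longleftrightarrow> (\<forall>m. differentiable_upto m S f)"
  unfolding smooth_on_def differentiable_upto_iff_iter_partial by auto

lemma smooth_onD: "smooth_on S f \<Longrightarrow> x \<in> S \<Longrightarrow> f differentiable at x"
  by (meson differentiable_uptoD smooth_on_iff)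

lemma smooth_on_partial: "smooth_on S f \<Longrightarrow> b \<in> Basis \<Longrightarrow> smooth_on S (partial b f)"
  unfolding smooth_on_iff by (metis differentiable_upto.simps(2))

lemma partial_eq: "(f has_derivative f') (at x) \<Longrightarrow> partial b f x = f' b"
  by (drule frechet_derivative_at) simp

lemma partial_cong:
  assumes "open S" "x \<in> S" "\<And>x. x \<in> S \<Longrightarrow> f x = g x" "f differentiable at x"
  shows "partial b f x = partial b g x"
  using frechet_derivative_transform_within_open[OF assms(4,1,2,3)] by simp

lemma differentiable_transform_open:
  assumes "f differentiable at x" "x \<in> S" "open S" "\<And>x. x \<in> S \<Longrightarrow> f x = g x"
  shows "g differentiable at x"
  using assms has_derivative_transform_within_open[of f _ x UNIV S g] unfolding differentiable_def by blast

lemma (in bounded_linear) differentiable: "g differentiable F \<Longrightarrow> (\<lambda>x. f (g x)) differentiable F"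
  using has_derivative unfolding differentiable_def by blast

lemma (in bounded_bilinear) differentiable:
  "f differentiable at x \<Longrightarrow> g differentiable at x \<Longrightarrow> (\<lambda>x. prod (f x) (g x)) differentiable at x"
  using FDERIV unfolding differentiable_def by blast

text \<open>On an open set derivatives depend only on the values there. A formula for a partial
  derivative that holds only on \<open>S\<close> can thus be substituted under the
  recursion.\<close>

lemma differentiable_upto_cong:
  assumes "open S" "\<And>x. x \<in> S \<Longrightarrow> f x = g x" "differentiable_upto m S f"
  shows "differentiable_upto m S g"
  using assms(2,3)
proof (induction m arbitrary: f g)
  case 0
  then show ?case
    by (auto intro: differentiable_transform_open[OF _ _ assms(1)])
next
  case (Suc m)
  have "g differentiable at x" if "x \<in> S" for x
    using Suc.prems that differentiable_transform_open[of f x S g] assms(1) by auto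
  moreover have "differentiable_upto m S (partial b g)" if "b \<in> Basis" for b
  proof (rule Suc.IH[of "partial b f"])
    show "partial b f x = partial b g x" if "x \<in> S" for x
      using Suc.prems that by (intro partial_cong[OF assms(1) that]) auto
    show "differentiable_upto m S (partial b f)" using Suc.prems that by simp
  qed
  ultimately show ?case by simp
qed

lemma differentiable_upto_add:
  assumes "open S" "differentiable_upto m S f" "differentiable_upto m S g"
  shows "differentiable_upto m S (\<lambda>x. f x + g x)"
  using assms(2,3)
proof (induction m arbitrary: f g)
  case (Suc m)
  have "differentiable_upto m S (partial b (\<lambda>x. f x + g x))" if "b \<in> Basis" for b
  proof (rule differentiable_upto_cong[OF assms(1)])
    show "differentiable_upto m S (\<lambda>x. partial b f x + partial b g x)"
      using Suc that by auto
    show "partial b f x + partial b g x = partial b (\<lambda>x. f x + g x) x" if "x \<in> S" for x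
      using Suc.prems that
      by (intro partial_eq[symmetric, THEN trans]) (auto intro!: derivative_eq_intros simp: frechet_derivative_works)
  qed
  then show ?case using Suc.prems by auto
qed auto

lemma (in bounded_bilinear) differentiable_upto_prod:
  assumes "open S" "differentiable_upto m S f" "differentiable_upto m S g"
  shows "differentiable_upto m S (\<lambda>x. prod (f x) (g x))"
  using assms(2,3)
proof (induction m arbitrary: f g)
  case 0
  then show ?case by (auto intro: differentiable)
next
  case (Suc m)
  have "differentiable_upto m S (partial b (\<lambda>x. prod (f x) (g x)))" if "b \<in> Basis" for b
  proof (rule differentiable_upto_cong[OF assms(1)])
    show "differentiable_upto m S (\<lambda>x. prod (f x) (partial b g x) + prod (partial b f x) (g x))"
      using Suc.prems differentiable_upto_SucD[OF Suc.prems(1)] differentiable_upto_SucD[OF Suc.prems(2)] that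
      by (intro differentiable_upto_add[OF assms(1)] Suc.IH) auto
    show "prod (f x) (partial b g x) + prod (partial b f x) (g x) = partial b (\<lambda>x. prod (f x) (g x)) x" if "x \<in> S" for x
      using Suc.prems that
      by (intro partial_eq[OF FDERIV, symmetric]) (auto simp: frechet_derivative_works)
  qed
  then show ?case using Suc.prems by (auto intro: differentiable)
qed

lemma differentiable_upto_const: "differentiable_upto m S (\<lambda>x. c)"
  by (induction m arbitrary: c) auto

lemma differentiable_upto_linear: "bounded_linear f \<Longrightarrow> differentiable_upto m S f"
proof (cases m)
  case (Suc k)
  assume f: "bounded_linear f"
  have "partial b f = (\<lambda>x. f b)" for b
    using f by (intro ext partial_eq bounded_linear_imp_has_derivative)
  then show ?thesis
    using f Suc by (auto simp: differentiable_upto_const intro!: differentiableI bounded_linear_imp_has_derivative)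
qed (auto intro!: differentiableI bounded_linear_imp_has_derivative)

lemma differentiable_upto_bounded_linear:
  assumes "bounded_linear L" "differentiable_upto m S f"  "open S"
  shows "differentiable_upto m S (\<lambda>x. L (f x))"
  using assms(2)
proof (induction m arbitrary: f)
  case 0
  then show ?case using bounded_linear.differentiable[OF assms(1)] by auto
next
  case (Suc m)
  have "differentiable_upto m S (partial b (\<lambda>x. L (f x)))" if "b \<in> Basis" for b
  proof (rule differentiable_upto_cong[OF assms(3)])
    show "differentiable_upto m S (\<lambda>x. L (partial b f x))" using Suc that by auto
    show "L (partial b f x) = partial b (\<lambda>x. L (f x)) x" if "x \<in> S" for x
      using Suc.prems that
      by (intro partial_eq[OF bounded_linear.has_derivative[OF assms(1)], symmetric]) (auto simp: frechet_derivative_works)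
  qed
  then show ?case using Suc.prems bounded_linear.differentiable[OF assms(1)] by auto
qed

lemma smooth_on_mult:
  fixes f g :: "'a::euclidean_space \<Rightarrow> 'b::real_normed_algebra"
  shows "open S \<Longrightarrow> smooth_on S f \<Longrightarrow> smooth_on S g \<Longrightarrow> smooth_on S (\<lambda>x. f x * g x)"
  unfolding smooth_on_iff using bounded_bilinear.differentiable_upto_prod[OF bounded_bilinear_mult] by blast

lemma smooth_on_const: "smooth_on S (\<lambda>x. c)"
  by (simp add: smooth_on_iff differentiable_upto_const)

lemma smooth_on_of_real:
  fixes f :: "'a::euclidean_space \<Rightarrow> real"
  shows "open S \<Longrightarrow> smooth_on S f \<Longrightarrow> smooth_on S (\<lambda>x. complex_of_real (f x))"
  unfolding smooth_on_iff using differentiable_upto_bounded_linear[OF bounded_linear_of_real] by blast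

lemma smooth_on_inner: "smooth_on S (\<lambda>x. x \<bullet> b)"
  by (simp add: smooth_on_iff differentiable_upto_linear bounded_linear_inner_left)

subsection \<open>A smooth bump function on an annulus\<close>

text \<open>\<open>flat 0\<close> is the classical smooth function that vanishes on the negative
  axis. Dividing by powers of \<open>u\<close> yields a family in which every derivative is a linear
  combination of members.\<close>

definition flat :: "nat \<Rightarrow> real \<Rightarrow> real" where
  "flat m u = (if 0 < u then exp (- 1 / u) / u ^ m else 0)"

lemma flat_tendsto_0: "(flat m \<longlongrightarrow> 0) (at 0)"
proof -
  have "((\<lambda>u. flat m u) \<longlongrightarrow> 0) (at_left 0)"
    by (rule tendsto_eventually) (auto simp: flat_def eventually_at_left_field intro: exI[of _ "-1"])
  moreover have "((\<lambda>u. flat m u) \<longlongrightarrow> 0) (at_right 0)"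
  proof -
    have "((\<lambda>u::real. (inverse u) ^ m / exp (inverse u)) \<longlongrightarrow> 0) (at_right 0)"
      by (rule filterlim_compose[OF tendsto_power_div_exp_0 filterlim_inverse_at_top_right])
    then show ?thesis
      by (rule Lim_transform_eventually)
         (auto simp: flat_def eventually_at_right_field exp_minus field_simps intro: exI[of _ 1])
  qed
  ultimately show ?thesis by (simp add: filterlim_split_at)
qed

lemma flat_DERIV: "DERIV (flat m) u :> flat (m + 2) u - real m * flat (m + 1) u"
proof (cases "u = 0")
  case True
  have "((\<lambda>h. flat (m + 1) h) \<longlongrightarrow> 0) (at 0)" by (rule flat_tendsto_0)
  \<comment> \<open>At 0 the difference quotient of \<open>flat m\<close> is itself
    \<open>flat (m + 1)\<close>.\<close>
  then have "((\<lambda>h. (flat m (0 + h) - flat m 0) / h) \<longlongrightarrow> 0) (at 0)"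
    by (rule Lim_transform_eventually) (auto simp: flat_def)
  then show ?thesis unfolding True DERIV_def by (simp add: flat_def)
next
  case False
  show ?thesis
  proof (cases "u > 0")
    case True
    have "DERIV (\<lambda>u. u ^ m) u :> real m * u ^ (m - 1)"
      using DERIV_pow[of m u UNIV] by simp
    also have "real m * u ^ (m - 1) = real m * u ^ m / u"
      using True by (cases m) auto
    finally have pow: "DERIV (\<lambda>u. u ^ m) u :> real m * u ^ m / u" .
    have "DERIV (\<lambda>u. exp (- 1 / u)) u :> exp (- 1 / u) / (u * u)"
      using True by (auto intro!: derivative_eq_intros)
    from DERIV_divide[OF this pow]
    have "DERIV (\<lambda>u. exp (- 1 / u) / u ^ m) u :> flat (m + 2) u - real m * flat (m + 1) u"
      by (rule DERIV_cong) (use True in \<open>auto simp: flat_def field_simps\<close>)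
    then show ?thesis
      by (rule has_field_derivative_transform_within_open[of _ _ _ "{0<..}"]) (use True in \<open>auto simp: flat_def\<close>)
  next
    case neg: False
    have "DERIV (\<lambda>u. 0::real) u :> flat (m + 2) u - real m * flat (m + 1) u"
      using neg by (auto simp: flat_def)
    then show ?thesis
      by (rule has_field_derivative_transform_within_open[of _ _ _ "{..<0}"]) (use False neg in \<open>auto simp: flat_def\<close>)
  qed
qed

text \<open>Each derivative lowers the order \<open>m\<close> but raises the index of
  \<open>flat\<close>, hence an induction over \<open>m\<close> for all indices at once.\<close>

lemma differentiable_upto_flat:
  fixes q :: "'a::euclidean_space \<Rightarrow> real"
  assumes S: "open S" and q: "\<And>k. differentiable_upto k S q"
  shows "differentiable_upto m S (\<lambda>x. flat k (q x))"
proof (induction m arbitrary: k)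
  have D: "((\<lambda>x. flat k (q x)) has_derivative (\<lambda>h. (flat (k + 2) (q x) - real k * flat (k + 1) (q x)) * frechet_derivative q (at x) h)) (at x)"
    if "x \<in> S" for x k
  proof -
    have "(q has_derivative frechet_derivative q (at x)) (at x)"
      using differentiable_uptoD[OF q that] by (simp add: frechet_derivative_works)
    then show ?thesis
      using flat_DERIV[of k "q x"] unfolding has_field_derivative_def by (rule has_derivative_compose)
  qed
  { case 0
    show ?case using D by (auto intro: differentiableI) }
  case (Suc m)
  have "differentiable_upto m S (partial b (\<lambda>x. flat k (q x)))" if b: "b \<in> Basis" for b
  proof (rule differentiable_upto_cong[OF S])
    have "differentiable_upto m S (\<lambda>x. (flat (k + 2) (q x) + (- real k) * flat (k + 1) (q x)) * partial b q x)"
      using q[of "Suc m"] b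
      by (intro bounded_bilinear.differentiable_upto_prod[OF bounded_bilinear_mult S] differentiable_upto_add[OF S]
          differentiable_upto_const Suc.IH) auto
    then show "differentiable_upto m S (\<lambda>x. (flat (k + 2) (q x) - real k * flat (k + 1) (q x)) * partial b q x)" by simp
    show "(flat (k + 2) (q x) - real k * flat (k + 1) (q x)) * partial b q x = partial b (\<lambda>x. flat k (q x)) x" if "x \<in> S" for x
      using partial_eq[OF D[OF that]] by simp
  qed
  then show ?case using D by (auto intro: differentiableI)
qed

text \<open>The two factors cut off at radii 1/2 and 3, which leaves a margin around the annulus
  between 1 and 2 where a rescaled dyadic piece lives. The use of
  \<open>\<xi> \<bullet> \<xi>\<close> instead of the norm keeps the argument polynomial.\<close>

definition bump :: "'a::euclidean_space \<Rightarrow> real" where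
  "bump \<xi> = flat 0 (\<xi> \<bullet> \<xi> - 1/4) * flat 0 (9 - \<xi> \<bullet> \<xi>)"

lemma bump_smooth: "smooth_on UNIV bump"
proof -
  have sq: "differentiable_upto k UNIV (\<lambda>x::'a. x \<bullet> x)" for k
    by (intro bounded_bilinear.differentiable_upto_prod[OF bounded_bilinear_inner] differentiable_upto_linear bounded_linear_ident) auto
  have "differentiable_upto k UNIV (\<lambda>x::'a. x \<bullet> x + (- 1/4))" for k
    by (intro differentiable_upto_add sq differentiable_upto_const) auto
  moreover have "differentiable_upto k UNIV (\<lambda>x::'a. 9 + (-1) * (x \<bullet> x))" for k
    by (intro differentiable_upto_add bounded_bilinear.differentiable_upto_prod[OF bounded_bilinear_mult] sq differentiable_upto_const) auto
  ultimately show ?thesis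
    unfolding bump_def[abs_def]
    by (intro smooth_on_mult) (auto simp: smooth_on_iff intro!: differentiable_upto_flat)
qed

lemma bump_nonneg: "0 \<le> bump \<xi>"
  by (simp add: bump_def flat_def)

lemma bump_support:
  assumes "bump \<xi> \<noteq> 0" shows "1/2 \<le> norm \<xi>" "norm \<xi> \<le> 3"
proof -
  have "\<xi> \<bullet> \<xi> > 1/4" "\<xi> \<bullet> \<xi> < 9" using assms by (auto simp: bump_def flat_def split: if_splits)
  then have "(norm \<xi>)\<^sup>2 > (1/2)\<^sup>2" "(norm \<xi>)\<^sup>2 < 3\<^sup>2" by (auto simp: power2_norm_eq_inner power_divide)
  then show "1/2 \<le> norm \<xi>" "norm \<xi> \<le> 3"
    using power_less_imp_less_base[of "1/2" 2 "norm \<xi>"] power_less_imp_less_base[of "norm \<xi>" 2 3] by auto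
qed

lemma bump_lower_bound: "\<exists>c>0. \<forall>\<xi>. 1 \<le> norm \<xi> \<and> norm \<xi> \<le> 2 \<longrightarrow> c \<le> bump \<xi>"
proof (intro exI conjI allI impI)
  \<comment> \<open>On this annulus the argument of the first factor is at least 3/4, that of the
    second at least 5.\<close>
  show "0 < exp (-4/3 :: real) * exp (-1/5)" by simp
  fix \<xi> :: 'a assume x: "1 \<le> norm \<xi> \<and> norm \<xi> \<le> 2"
  have "1\<^sup>2 \<le> (norm \<xi>)\<^sup>2" "(norm \<xi>)\<^sup>2 \<le> 2\<^sup>2" using x by (intro power_mono; auto)+
  then have "1 \<le> \<xi> \<bullet> \<xi>" "\<xi> \<bullet> \<xi> \<le> 4" by (auto simp: power2_norm_eq_inner)
  then show "exp (-4/3) * exp (-1/5) \<le> bump \<xi>"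
    unfolding bump_def by (intro mult_mono) (auto simp: flat_def field_simps)
qed

subsection \<open>Amplitudes supported in an annulus\<close>

text \<open>Smoothness is demanded only away from 0, so that amplitudes may be multiplied by
  derivatives of \<open>P\<close>, about which nothing is known at 0. Vanishing near the origin
  makes them differentiable there as well.\<close>

definition amplitude :: "('a::euclidean_space \<Rightarrow> complex) \<Rightarrow> bool" where
  "amplitude a \<longleftrightarrow> smooth_on (- {0}) a \<and> (\<forall>\<xi>. a \<xi> \<noteq> 0 \<longrightarrow> 1/2 \<le> norm \<xi> \<and> norm \<xi> \<le> 3)"

lemma amplitude_zero: "amplitude a \<Longrightarrow> norm \<xi> < 1/2 \<or> 3 < norm \<xi> \<Longrightarrow> a \<xi> = 0"
  unfolding amplitude_def by fastforce

lemma open_annulus_complement: "open {\<xi>::'a::real_normed_vector. norm \<xi> < 1/2 \<or> 3 < norm \<xi>}"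
  by (intro open_Collect_disj open_Collect_less continuous_intros)

lemma amplitude_differentiable:
  fixes a :: "'a::euclidean_space \<Rightarrow> complex"
  assumes a: "amplitude a" shows "a differentiable at \<xi>"
proof (cases "\<xi> = 0")
  case True
  have "(\<lambda>x::'a. 0::complex) differentiable at \<xi>" by simp
  then show ?thesis
    by (rule differentiable_transform_open[OF _ _ open_annulus_complement])
       (use True amplitude_zero[OF a] in auto)
next
  case False
  then show ?thesis using a smooth_onD[of "- {0}" a \<xi>] by (auto simp: amplitude_def)
qed

lemma amplitude_has_derivative:
  "amplitude a \<Longrightarrow> (a has_derivative frechet_derivative a (at \<xi>)) (at \<xi>)"
  using amplitude_differentiable[of a \<xi>] by (simp add: frechet_derivative_works)

lemma amplitude_partial:
  fixes a :: "'a::euclidean_space \<Rightarrow> complex"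
  assumes a: "amplitude a" and b: "b \<in> Basis" shows "amplitude (partial b a)"
  unfolding amplitude_def
proof (intro conjI allI impI)
  show "smooth_on (- {0}) (partial b a)" using a b by (intro smooth_on_partial) (auto simp: amplitude_def)
  have "partial b a \<xi> = 0" if "norm \<xi> < 1/2 \<or> 3 < norm \<xi>" for \<xi>
    using partial_cong[OF open_annulus_complement _ _ amplitude_differentiable[OF a], of \<xi> "\<lambda>_. 0" b]
      amplitude_zero[OF a] that by auto
  then show "1/2 \<le> norm \<xi>" "norm \<xi> \<le> 3" if "partial b a \<xi> \<noteq> 0" for \<xi>
    using that by force+
qed

lemma amplitude_mult:
  assumes "amplitude a" "smooth_on (- {0}) q" shows "amplitude (\<lambda>\<xi>. q \<xi> * a \<xi>)"
  using assms by (auto simp: amplitude_def intro!: smooth_on_mult)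

lemma amplitude_continuous: "amplitude a \<Longrightarrow> continuous_on UNIV a"
  by (metis amplitude_differentiable continuous_at_imp_continuous_on differentiable_imp_continuous_within)

lemma amplitude_bounded:
  fixes a :: "'a::euclidean_space \<Rightarrow> complex"
  assumes a: "amplitude a" shows "\<exists>B. \<forall>\<xi>. norm (a \<xi>) \<le> B"
proof -
  have "compact (a ` cball 0 3)"
    using amplitude_continuous[OF a] by (intro compact_continuous_image) (auto intro: continuous_on_subset)
  then obtain B where B: "\<And>\<xi>. \<xi> \<in> cball 0 3 \<Longrightarrow> norm (a \<xi>) \<le> B"
    by (meson bounded_iff compact_imp_bounded image_eqI)
  have "norm (a \<xi>) \<le> max B 0" for \<xi>
    using B[of \<xi>] amplitude_zero[OF a, of \<xi>] by (cases "3 < norm \<xi>") auto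
  then show ?thesis by blast
qed

lemma amplitude_measurable: "amplitude a \<Longrightarrow> a \<in> borel_measurable borel"
  by (intro borel_measurable_continuous_onI amplitude_continuous)

lemma amplitude_L2: "amplitude a \<Longrightarrow> L2_fun a"
  using amplitude_bounded[of a] by (metis L2_fun_of_bounded_support amplitude_measurable amplitude_zero borel_measurable_lebesgue)

lemma amplitude_integrable: "amplitude a \<Longrightarrow> integrable lebesgue a"
  by (rule L2_bounded_support_integrable[OF amplitude_L2, of a 3]) (auto simp: amplitude_zero)

lemma amplitude_bump: "amplitude (\<lambda>\<xi>. complex_of_real (bump \<xi>))"
proof -
  have "smooth_on (- {0}) bump" using bump_smooth by (auto simp: smooth_on_def)
  then show ?thesis
    unfolding amplitude_def using bump_support by (auto intro!: smooth_on_of_real)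
qed

section \<open>Oscillatory integrals\<close>

lemma echar_has_derivative [derivative_intros]:
  assumes "(\<theta> has_derivative \<theta>') (at x within S)"
  shows "((\<lambda>x. echar (\<theta> x)) has_derivative (\<lambda>h. 2 * of_real pi * \<i> * of_real (\<theta>' h) * echar (\<theta> x))) (at x within S)"
proof -
  have "((\<lambda>x. 2 * of_real pi * \<i> * complex_of_real (\<theta> x)) has_derivative (\<lambda>h. 2 * of_real pi * \<i> * of_real (\<theta>' h))) (at x within S)"
    by (intro has_derivative_mult_right has_derivative_of_real assms)
  from has_derivative_compose[OF this DERIV_exp[unfolded has_field_derivative_def]]
  show ?thesis by (simp add: echar_def mult_ac)
qed

lemma integral_translation_difference:
  fixes F :: "'a::euclidean_space \<Rightarrow> complex"
  assumes [measurable]: "F \<in> borel_measurable borel" and int: "integrable lebesgue F"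
  shows "(LINT x|lebesgue. F (x + v) - F x) = 0"
proof -
  have int': "integrable lborel F" using int by (simp add: integrable_completion)
  have int2: "integrable lborel (\<lambda>x. F (x + v))"
    using lborel_affine_integrable_iff[of F 1 v] int' by (simp add: add.commute)
  have "(LINT x|lborel. F (x + v)) = (LINT x|lborel. F x)"
    using lborel_affine_integral[of F 1 v] by (simp add: add.commute)
  then have "(LINT x|lborel. F (x + v) - F x) = 0" using int' int2 by simp
  then show ?thesis by (subst integral_completion) auto
qed

text \<open>Integration by parts in the form needed here. Integrals of difference quotients vanish
  by translation invariance, and the bound on the directional derivative permits dominated
  convergence; continuity of the derivative is not assumed.\<close>

lemma integral_directional_derivative_eq_0:
  fixes F :: "'a::euclidean_space \<Rightarrow> complex"
  assumes D: "\<And>\<xi>. (F has_derivative F' \<xi>) (at \<xi>)" and supp: "\<And>\<xi>. R < norm \<xi> \<Longrightarrow> F \<xi> = 0"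
    and B: "\<And>\<xi>. norm (F' \<xi> b) \<le> B" and b: "norm b = 1"
  shows "(LINT \<xi>|lebesgue. F' \<xi> b) = 0"
proof -
  have cont: "continuous_on UNIV F"
    using D by (meson continuous_at_imp_continuous_on has_derivative_continuous)
  have [measurable]: "F \<in> borel_measurable borel" using cont by (rule borel_measurable_continuous_onI)
  have B0: "0 \<le> B" using norm_ge_zero B[of 0] by (rule order_trans)
  have lip: "norm (F (\<xi> + h *\<^sub>R b) - F \<xi>) \<le> B * h" if "0 \<le> h" for \<xi> h
  proof -
    have der: "((\<lambda>u. F (\<xi> + u *\<^sub>R b)) has_derivative (\<lambda>v. F' (\<xi> + u *\<^sub>R b) (v *\<^sub>R b))) (at u within {0..h})" for u
      by (rule has_derivative_compose[OF _ D, of "\<lambda>u. \<xi> + u *\<^sub>R b"]) (auto intro!: derivative_eq_intros)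
    have on: "onorm (\<lambda>v. F' (\<xi> + u *\<^sub>R b) (v *\<^sub>R b)) \<le> B" for u
    proof (rule onorm_bound[OF B0])
      fix v :: real
      have "F' (\<xi> + u *\<^sub>R b) (v *\<^sub>R b) = v *\<^sub>R F' (\<xi> + u *\<^sub>R b) b"
        using has_derivative_linear[OF D] by (rule linear_scale)
      then show "norm (F' (\<xi> + u *\<^sub>R b) (v *\<^sub>R b)) \<le> B * norm v"
        using mult_right_mono[OF B, of "\<bar>v\<bar>" "\<xi> + u *\<^sub>R b"] by (simp add: mult.commute)
    qed
    have "norm (F (\<xi> + h *\<^sub>R b) - F (\<xi> + 0 *\<^sub>R b)) \<le> B * norm (h - 0)"
      using that by (intro differentiable_bound[of "{0..h}", OF _ der on]) auto
    then show ?thesis using that by simp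
  qed
  \<comment> \<open>The increments are at most 1, so all difference quotients live in the ball of
    radius \<open>R + 1\<close>, where \<open>lip\<close> bounds them by \<open>B\<close>.\<close>
  let ?h = "\<lambda>m. 1 / real (Suc m)"
  let ?D = "\<lambda>m \<xi>. (1 / ?h m) *\<^sub>R (F (\<xi> + ?h m *\<^sub>R b) - F \<xi>)"
  have F_int: "integrable lebesgue F"
  proof -
    have "compact (F ` cball 0 R)" using cont by (intro compact_continuous_image) (auto intro: continuous_on_subset)
    then obtain C where C: "\<And>\<xi>. \<xi> \<in> cball 0 R \<Longrightarrow> norm (F \<xi>) \<le> C"
      by (meson bounded_iff compact_imp_bounded image_eqI)
    have "norm (F \<xi>) \<le> max C 0" for \<xi> using C[of \<xi>] supp[of \<xi>] by (cases "R < norm \<xi>") auto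
    then have "L2_fun F" using supp by (intro L2_fun_of_bounded_support[where R=R]) auto
    then show ?thesis using supp by (rule L2_bounded_support_integrable)
  qed
  have lim: "(\<lambda>m. ?D m \<xi>) \<longlonglongrightarrow> F' \<xi> b" for \<xi>
  proof -
    have "((\<lambda>u. F (\<xi> + u *\<^sub>R b)) has_derivative (\<lambda>v. F' (\<xi> + 0 *\<^sub>R b) (v *\<^sub>R b))) (at 0)"
      by (rule has_derivative_compose[OF _ D, of "\<lambda>u. \<xi> + u *\<^sub>R b"]) (auto intro!: derivative_eq_intros)
    then have "((\<lambda>u. F (\<xi> + u *\<^sub>R b)) has_vector_derivative F' \<xi> b) (at 0)"
      unfolding has_vector_derivative_def using linear_scale[OF has_derivative_linear[OF D]] by simp
    then have lim0: "((\<lambda>h. norm (F (\<xi> + h *\<^sub>R b) - F \<xi> - h *\<^sub>R F' \<xi> b) / \<bar>h\<bar>) \<longlongrightarrow> 0) (at 0)"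
      unfolding has_vector_derivative_def has_derivative_at by simp
    have "norm ((1 / h) *\<^sub>R (F (\<xi> + h *\<^sub>R b) - F \<xi>) - F' \<xi> b) = norm (F (\<xi> + h *\<^sub>R b) - F \<xi> - h *\<^sub>R F' \<xi> b) / \<bar>h\<bar>"
      if "h \<noteq> 0" for h
    proof -
      have "(1 / h) *\<^sub>R (F (\<xi> + h *\<^sub>R b) - F \<xi>) - F' \<xi> b = (1 / h) *\<^sub>R (F (\<xi> + h *\<^sub>R b) - F \<xi> - h *\<^sub>R F' \<xi> b)"
        using that by (simp add: scaleR_diff_right)
      then show ?thesis by (simp only: norm_scaleR) (simp add: divide_inverse mult.commute)
    qed
    then have "((\<lambda>h. norm ((1 / h) *\<^sub>R (F (\<xi> + h *\<^sub>R b) - F \<xi>) - F' \<xi> b)) \<longlongrightarrow> 0) (at 0)"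
      by (intro Lim_transform_eventually[OF lim0]) (auto simp: eventually_at_filter)
    then have "((\<lambda>h. (1 / h) *\<^sub>R (F (\<xi> + h *\<^sub>R b) - F \<xi>)) \<longlongrightarrow> F' \<xi> b) (at 0)"
      by (simp only: tendsto_norm_zero_iff LIM_zero_iff)
    moreover have "filterlim ?h (at 0) sequentially"
      unfolding filterlim_at using LIMSEQ_Suc[OF lim_1_over_n[where 'a=real]] by auto
    ultimately show ?thesis by (rule filterlim_compose)
  qed
  have "(\<lambda>m. LINT \<xi>|lebesgue. ?D m \<xi>) \<longlonglongrightarrow> (LINT \<xi>|lebesgue. F' \<xi> b)"
  proof (rule integral_dominated_convergence[where w="\<lambda>\<xi>. B * indicator (cball 0 (R + 1)) \<xi>"])
    show "(\<lambda>\<xi>. F' \<xi> b) \<in> borel_measurable lebesgue"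
      using lim by (rule borel_measurable_LIMSEQ_metric[rotated]) measurable
    have "emeasure lebesgue (cball (0::'a) (R + 1)) < \<infinity>" using emeasure_bounded_finite[OF bounded_cball] by simp
    then show "integrable lebesgue (\<lambda>\<xi>::'a. B * indicator (cball 0 (R + 1)) \<xi>)"
      by (intro integrable_mult_right integrable_real_indicator) auto
    show "AE \<xi> in lebesgue. norm (?D m \<xi>) \<le> B * indicator (cball 0 (R + 1)) \<xi>" for m
    proof (rule AE_I2)
      fix \<xi> :: 'a
      show "norm (?D m \<xi>) \<le> B * indicator (cball 0 (R + 1)) \<xi>"
      proof (cases "norm \<xi> \<le> R + 1")
        case True
        then show ?thesis using mult_left_mono[OF lip[of "?h m" \<xi>], of "1 / ?h m"] by simp
      next
        case False
        have "?h m \<le> 1" by simp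
        moreover have "norm \<xi> - ?h m \<le> norm (\<xi> + ?h m *\<^sub>R b)"
          using norm_diff_ineq[of \<xi> "?h m *\<^sub>R b"] b by simp
        ultimately have "R < norm (\<xi> + ?h m *\<^sub>R b)" "R < norm \<xi>" using False by linarith+
        then show ?thesis using supp False by simp
      qed
    qed
    show "AE \<xi> in lebesgue. (\<lambda>m. ?D m \<xi>) \<longlonglongrightarrow> F' \<xi> b" by (intro AE_I2 lim)
  qed measurable
  moreover have "(LINT \<xi>|lebesgue. ?D m \<xi>) = 0" for m
    using integral_translation_difference[OF _ F_int, of "?h m *\<^sub>R b"] by simp
  ultimately show ?thesis by (simp add: LIMSEQ_const_iff)
qed

section \<open>Decay of oscillatory integrals through integration by parts\<close>

lemma smooth_on_punctured_measurable:
  fixes P :: "'a::euclidean_space \<Rightarrow> real"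
  assumes "smooth_on (- {0}) P" shows "P \<in> borel_measurable borel"
proof (rule borel_measurable_continuous_countable_exceptions)
  show "countable {0::'a}" by simp
  show "continuous_on (- {0}) P"
    using assms by (intro continuous_at_imp_continuous_on ballI differentiable_imp_continuous_within smooth_onD)
qed

abbreviation osc :: "('a::euclidean_space \<Rightarrow> real) \<Rightarrow> ('a \<Rightarrow> complex) \<Rightarrow> 'a \<Rightarrow> real \<Rightarrow> complex" where
  "osc P a x t \<equiv> ifourier (evolved P t a) x"

lemma osc_eq: "osc P a x t = (LINT \<xi>|lebesgue. a \<xi> * echar (x \<bullet> \<xi> + t * P \<xi>))"
  unfolding ifourier_def evolved_def by (simp add: echar_add mult_ac)

lemma osc_integrable:
  assumes "integrable lebesgue a" "P \<in> borel_measurable borel"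
  shows "integrable lebesgue (\<lambda>\<xi>. a \<xi> * echar (x \<bullet> \<xi> + t * P \<xi>))"
  using assms by (intro integrable_mult_echar borel_measurable_lebesgue) measurable

lemma norm_osc_le:
  assumes "integrable lebesgue a" "P \<in> borel_measurable borel"
  shows "norm (osc P a x t) \<le> (LINT \<xi>|lebesgue. norm (a \<xi>))"
proof -
  have "norm (osc P a x t) \<le> (LINT \<xi>|lebesgue. norm (a \<xi> * echar (x \<bullet> \<xi> + t * P \<xi>)))"
    unfolding osc_eq by (rule integral_norm_bound)
  then show ?thesis by (simp add: norm_mult)
qed

text \<open>Up to the factor \<open>t\<close>, the amplitude that arises when a derivative falls on
  \<open>echar (t * P \<xi>)\<close>.\<close>

definition phase_amplitude :: "'a::euclidean_space \<Rightarrow> ('a \<Rightarrow> real) \<Rightarrow> ('a \<Rightarrow> complex) \<Rightarrow> 'a \<Rightarrow> complex" where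
  "phase_amplitude b P a \<xi> = (2 * of_real pi * \<i> * of_real (partial b P \<xi>)) * a \<xi>"

lemma amplitude_phase:
  assumes "amplitude a" "smooth_on (- {0}) P" "b \<in> Basis"
  shows "amplitude (phase_amplitude b P a)"
  unfolding phase_amplitude_def[abs_def]
  using assms by (intro amplitude_mult smooth_on_mult smooth_on_const smooth_on_of_real smooth_on_partial) auto

text \<open>The integral of a partial derivative of the whole integrand is 0; the term in which the
  linear phase is differentiated is isolated on the left. One such step gains a factor
  \<open>x \<bullet> b\<close> and costs at most \<open>1 + \<bar>t\<bar>\<close>.\<close>

lemma osc_by_parts:
  fixes P :: "'a::euclidean_space \<Rightarrow> real"
  assumes a: "amplitude a" and P: "smooth_on (- {0}) P" and b: "b \<in> Basis"
  shows "2 * of_real pi * \<i> * of_real (x \<bullet> b) * osc P a x t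
    = - osc P (partial b a) x t - of_real t * osc P (phase_amplitude b P a) x t"
proof -
  let ?\<theta> = "\<lambda>\<xi>. x \<bullet> \<xi> + t * P \<xi>"
  let ?F' = "\<lambda>\<xi> h. frechet_derivative a (at \<xi>) h * echar (?\<theta> \<xi>)
     + a \<xi> * (2 * of_real pi * \<i> * of_real (x \<bullet> h + t * frechet_derivative P (at \<xi>) h) * echar (?\<theta> \<xi>))"
  note Pm = smooth_on_punctured_measurable[OF P]
  note amps = a amplitude_partial[OF a b] amplitude_phase[OF a P b]
  note ints = amps[THEN amplitude_integrable, THEN osc_integrable, OF Pm, of x t]
  have D: "((\<lambda>\<xi>. a \<xi> * echar (?\<theta> \<xi>)) has_derivative ?F' \<xi>) (at \<xi>)" for \<xi>
  proof (cases "\<xi> = 0")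
    \<comment> \<open>Nothing is known about \<open>P\<close> at 0, but \<open>a\<close> vanishes in
      a neighbourhood.\<close>
    case True
    let ?S = "{\<xi>::'a. norm \<xi> < 1/2 \<or> 3 < norm \<xi>}"
    have z: "a x = 0" if "x \<in> ?S" for x using amplitude_zero[OF a] that by auto
    have "(a has_derivative (\<lambda>h. 0)) (at \<xi>)"
      by (rule has_derivative_transform_within_open[OF has_derivative_const open_annulus_complement]) (use True z in auto)
    then have "frechet_derivative a (at \<xi>) = (\<lambda>h. 0)" by (metis frechet_derivative_at)
    moreover have "((\<lambda>\<xi>. a \<xi> * echar (?\<theta> \<xi>)) has_derivative (\<lambda>h. 0)) (at \<xi>)"
      by (rule has_derivative_transform_within_open[OF has_derivative_const open_annulus_complement]) (use True z in auto)
    ultimately show ?thesis using z True by simp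
  next
    case False
    then have "(P has_derivative frechet_derivative P (at \<xi>)) (at \<xi>)"
      using smooth_onD[OF P, of \<xi>] by (simp add: frechet_derivative_works)
    then show ?thesis
      by (auto intro!: derivative_eq_intros amplitude_has_derivative[OF a])
  qed
  have split: "?F' \<xi> b = (partial b a \<xi> * echar (?\<theta> \<xi>) + of_real t * (phase_amplitude b P a \<xi> * echar (?\<theta> \<xi>)))
      + 2 * of_real pi * \<i> * of_real (x \<bullet> b) * (a \<xi> * echar (?\<theta> \<xi>))" for \<xi>
    by (simp add: phase_amplitude_def algebra_simps)
  obtain B1 B2 B3 where Bs: "\<And>\<xi>. norm (a \<xi>) \<le> B1" "\<And>\<xi>. norm (partial b a \<xi>) \<le> B2"
      "\<And>\<xi>. norm (phase_amplitude b P a \<xi>) \<le> B3"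
    using amps[THEN amplitude_bounded] by auto
  have "(LINT \<xi>|lebesgue. ?F' \<xi> b) = 0"
  proof (rule integral_directional_derivative_eq_0[OF D])
    show "a \<xi> * echar (?\<theta> \<xi>) = 0" if "3 < norm \<xi>" for \<xi>
      using amplitude_zero[OF a] that by simp
    show "norm b = 1" using b by simp
    show "norm (?F' \<xi> b) \<le> (B2 + \<bar>t\<bar> * B3) + 2 * pi * \<bar>x \<bullet> b\<bar> * B1" for \<xi>
      unfolding split
      by (intro norm_triangle_mono) (auto simp: norm_mult abs_mult intro!: mult_left_mono Bs)
  qed
  then have "(osc P (partial b a) x t + of_real t * osc P (phase_amplitude b P a) x t)
      + 2 * of_real pi * \<i> * of_real (x \<bullet> b) * osc P a x t = 0"
    unfolding split osc_eq using ints by simp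
  then show ?thesis by (simp add: eq_neg_iff_add_eq_0 algebra_simps)
qed

text \<open>Both integrals produced by \<open>osc_by_parts\<close> again have amplitudes in the same
  class, so the step can be iterated with \<open>a\<close> generalised.\<close>

lemma osc_decay_coordinate:
  fixes P :: "'a::euclidean_space \<Rightarrow> real"
  assumes P: "smooth_on (- {0}) P" and b: "b \<in> Basis" and a: "amplitude a"
  shows "\<exists>C. \<forall>x t. \<bar>x \<bullet> b\<bar> ^ N * norm (osc P a x t) \<le> C * (1 + \<bar>t\<bar>) ^ N"
  using a
proof (induction N arbitrary: a)
  case 0
  then show ?case using norm_osc_le[OF amplitude_integrable smooth_on_punctured_measurable[OF P]] by auto
next
  case (Suc N)
  obtain C1 where C1: "\<And>x t. \<bar>x \<bullet> b\<bar> ^ N * norm (osc P (partial b a) x t) \<le> C1 * (1 + \<bar>t\<bar>) ^ N"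
    using Suc.IH[OF amplitude_partial[OF Suc.prems b]] by blast
  obtain C2 where C2: "\<And>x t. \<bar>x \<bullet> b\<bar> ^ N * norm (osc P (phase_amplitude b P a) x t) \<le> C2 * (1 + \<bar>t\<bar>) ^ N"
    using Suc.IH[OF amplitude_phase[OF Suc.prems P b]] by blast
  have nonneg: "0 \<le> C1" "0 \<le> C2"
    using order_trans[OF _ C1[of 0 0]] order_trans[OF _ C2[of 0 0]] by auto
  have "\<bar>x \<bullet> b\<bar> ^ Suc N * norm (osc P a x t) \<le> (C1 + C2) * (1 + \<bar>t\<bar>) ^ Suc N" for x t
  proof -
    have "1 * (\<bar>x \<bullet> b\<bar> * norm (osc P a x t)) \<le> 2 * pi * (\<bar>x \<bullet> b\<bar> * norm (osc P a x t))"
      using pi_ge_two by (intro mult_right_mono) auto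
    also have "\<dots> = norm (2 * of_real pi * \<i> * of_real (x \<bullet> b) * osc P a x t)"
      by (simp add: norm_mult)
    also have "\<dots> \<le> norm (osc P (partial b a) x t) + \<bar>t\<bar> * norm (osc P (phase_amplitude b P a) x t)"
      unfolding osc_by_parts[OF Suc.prems P b]
      using norm_triangle_ineq4[of "- osc P (partial b a) x t" "of_real t * osc P (phase_amplitude b P a) x t"]
      by (simp add: norm_mult)
    finally have "\<bar>x \<bullet> b\<bar> ^ N * (\<bar>x \<bullet> b\<bar> * norm (osc P a x t))
        \<le> \<bar>x \<bullet> b\<bar> ^ N * (norm (osc P (partial b a) x t) + \<bar>t\<bar> * norm (osc P (phase_amplitude b P a) x t))"
      by (intro mult_left_mono) auto
    also have "\<dots> = \<bar>x \<bullet> b\<bar> ^ N * norm (osc P (partial b a) x t) + \<bar>t\<bar> * (\<bar>x \<bullet> b\<bar> ^ N * norm (osc P (phase_amplitude b P a) x t))"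
      by (simp add: algebra_simps)
    also have "\<dots> \<le> C1 * (1 + \<bar>t\<bar>) ^ N + \<bar>t\<bar> * (C2 * (1 + \<bar>t\<bar>) ^ N)"
      by (intro add_mono mult_left_mono C1 C2) auto
    also have "\<dots> \<le> (1 + \<bar>t\<bar>) * (C1 * (1 + \<bar>t\<bar>) ^ N) + (1 + \<bar>t\<bar>) * (C2 * (1 + \<bar>t\<bar>) ^ N)"
    proof (intro add_mono mult_right_mono)
      have "1 * (C1 * (1 + \<bar>t\<bar>) ^ N) \<le> (1 + \<bar>t\<bar>) * (C1 * (1 + \<bar>t\<bar>) ^ N)"
        using nonneg by (intro mult_right_mono) auto
      then show "C1 * (1 + \<bar>t\<bar>) ^ N \<le> (1 + \<bar>t\<bar>) * (C1 * (1 + \<bar>t\<bar>) ^ N)" by simp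
    qed (use nonneg in auto)
    finally show ?thesis by (simp add: algebra_simps)
  qed
  then show ?case by blast
qed

lemma exists_large_coordinate:
  fixes x :: "'a::euclidean_space"
  shows "\<exists>b\<in>Basis. norm x \<le> DIM('a) * \<bar>x \<bullet> b\<bar>"
proof (rule ccontr)
  assume "\<not> ?thesis"
  then have "\<bar>x \<bullet> b\<bar> < norm x / DIM('a)" if "b \<in> Basis" for b
    using that by (auto simp: not_le field_simps)
  then have "(\<Sum>b\<in>Basis. \<bar>x \<bullet> b\<bar>) < (\<Sum>b\<in>(Basis::'a set). norm x / DIM('a))"
    by (intro sum_strict_mono) auto
  then show False using norm_le_l1[of x] by simp
qed

lemma osc_decay:
  fixes P :: "'a::euclidean_space \<Rightarrow> real"
  assumes P: "smooth_on (- {0}) P" and a: "amplitude a"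
  shows "\<exists>C\<ge>0. \<forall>x t. norm x ^ N * norm (osc P a x t) \<le> C * (1 + \<bar>t\<bar>) ^ N"
proof -
  obtain C where C: "\<And>b x t. b \<in> Basis \<Longrightarrow> \<bar>x \<bullet> b\<bar> ^ N * norm (osc P a x t) \<le> C b * (1 + \<bar>t\<bar>) ^ N"
    using osc_decay_coordinate[OF P _ a, of _ N] by metis
  have Cnn: "0 \<le> C b" if "b \<in> Basis" for b
    using order_trans[OF _ C[OF that, of 0 0]] by auto
  \<comment> \<open>The dominant coordinate depends on \<open>x\<close>; summing the constants over
    all coordinates makes the bound uniform.\<close>
  define C' where "C' = real DIM('a) ^ N * (\<Sum>b\<in>Basis. C b)"
  have "norm x ^ N * norm (osc P a x t) \<le> C' * (1 + \<bar>t\<bar>) ^ N" for x t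
  proof -
    obtain b where b: "b \<in> Basis" "norm x \<le> DIM('a) * \<bar>x \<bullet> b\<bar>" using exists_large_coordinate by blast
    have "norm x ^ N * norm (osc P a x t) \<le> (DIM('a) * \<bar>x \<bullet> b\<bar>) ^ N * norm (osc P a x t)"
      using b by (intro mult_right_mono power_mono) auto
    also have "\<dots> = real DIM('a) ^ N * (\<bar>x \<bullet> b\<bar> ^ N * norm (osc P a x t))" by (simp add: power_mult_distrib)
    also have "\<dots> \<le> real DIM('a) ^ N * (C b * (1 + \<bar>t\<bar>) ^ N)" by (intro mult_left_mono C b) auto
    also have "\<dots> \<le> real DIM('a) ^ N * ((\<Sum>b\<in>Basis. C b) * (1 + \<bar>t\<bar>) ^ N)"
      using b Cnn by (intro mult_left_mono mult_right_mono member_le_sum) auto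
    finally show ?thesis by (simp add: C'_def mult_ac)
  qed
  moreover have "0 \<le> C'" unfolding C'_def using Cnn by (intro mult_nonneg_nonneg sum_nonneg) auto
  ultimately show ?thesis by blast
qed

text \<open>The interpolation splits at \<open>\<bar>t\<bar> = \<bar>x\<bar>\<^bsup>\<gamma>/\<beta>\<^esup>\<close>.  Giving up the endpoint \<open>\<gamma> = \<beta>\<close> avoids the nonstationary
  phase argument in the region where \<open>\<bar>x\<bar>\<close> is much larger than \<open>\<bar>t\<bar>\<close>.\<close>

lemma osc_uniform_decay:
  fixes P :: "'a::euclidean_space \<Rightarrow> real"
  assumes P: "smooth_on (- {0}) P" and a: "amplitude a" and \<gamma>: "0 \<le> \<gamma>" "\<gamma> < \<beta>"
    and disp: "\<And>x t. t \<noteq> 0 \<Longrightarrow> norm (osc P a x t) \<le> D * \<bar>t\<bar> powr (- \<beta>)"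
  shows "\<exists>C\<ge>0. \<forall>x t. norm (osc P a x t) \<le> C * (1 + norm x) powr (- \<gamma>)"
proof -
  define \<theta> where "\<theta> = \<gamma> / \<beta>"
  have \<theta>: "0 \<le> \<theta>" "\<theta> < 1" using \<gamma> by (auto simp: \<theta>_def)
  \<comment> \<open>Where \<open>\<bar>t\<bar> < norm x powr \<theta>\<close>, integration by parts
    yields decay of order \<open>(1 - \<theta>) * N\<close>, which has to reach \<gamma>.\<close>
  obtain N :: nat where "\<gamma> / (1 - \<theta>) \<le> real N" using real_arch_simple by blast
  then have N: "\<gamma> \<le> (1 - \<theta>) * real N" using \<theta> by (simp add: field_simps)
  obtain C0 where C0: "0 \<le> C0" "\<And>x t. norm (osc P a x t) \<le> C0"
    using osc_decay[OF P a, of 0] by auto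
  obtain C1 where C1: "0 \<le> C1" "\<And>x t. norm x ^ N * norm (osc P a x t) \<le> C1 * (1 + \<bar>t\<bar>) ^ N"
    using osc_decay[OF P a, of N] by blast
  have D: "0 \<le> D" using order_trans[OF norm_ge_zero disp[of 1 0]] by simp
  have large: "norm (osc P a x t) \<le> (D + 2 ^ N * C1) * norm x powr (- \<gamma>)" if x: "1 \<le> norm x" for x t
  proof (cases "norm x powr \<theta> \<le> \<bar>t\<bar>")
    case True
    have p: "1 \<le> norm x powr \<theta>" using x \<theta> by (simp add: ge_one_powr_ge_zero)
    have "norm (osc P a x t) \<le> D * \<bar>t\<bar> powr (- \<beta>)" using True p by (intro disp) auto
    also have "\<dots> \<le> D * (norm x powr \<theta>) powr (- \<beta>)"
      using True p \<gamma> D by (intro mult_left_mono powr_mono2') auto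
    also have "(norm x powr \<theta>) powr (- \<beta>) = norm x powr (- \<gamma>)"
      using \<gamma> by (simp add: powr_powr \<theta>_def)
    also have "D * norm x powr (- \<gamma>) \<le> (D + 2 ^ N * C1) * norm x powr (- \<gamma>)"
      using C1(1) by (intro mult_right_mono) auto
    finally show ?thesis .
  next
    case False
    have p: "1 \<le> norm x powr \<theta>" using x \<theta> by (simp add: ge_one_powr_ge_zero)
    have "norm x powr real N * norm (osc P a x t) = norm x ^ N * norm (osc P a x t)"
      using x powr_realpow[of "norm x" N] by (cases "x = 0") auto
    also have "\<dots> \<le> C1 * (1 + \<bar>t\<bar>) ^ N" by (rule C1)
    also have "\<dots> \<le> C1 * (2 * norm x powr \<theta>) ^ N"
      using False p C1(1) by (intro mult_left_mono power_mono) auto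
    also have "(2 * norm x powr \<theta>) ^ N = 2 ^ N * norm x powr (\<theta> * real N)"
      using x powr_realpow[of "norm x powr \<theta>" N] by (cases "x = 0") (auto simp: power_mult_distrib powr_powr)
    also have "C1 * (2 ^ N * norm x powr (\<theta> * real N)) = 2 ^ N * C1 * norm x powr (\<theta> * real N)"
      by simp
    finally have "norm x powr (- real N) * (norm x powr real N * norm (osc P a x t))
        \<le> norm x powr (- real N) * (2 ^ N * C1 * norm x powr (\<theta> * real N))"
      by (intro mult_left_mono) auto
    moreover have "norm x powr (- real N) * (norm x powr real N * norm (osc P a x t)) = norm (osc P a x t)"
    proof -
      have "norm x powr (- real N) * norm x powr real N = 1" using x by (cases "x = 0") (auto simp flip: powr_add)
      then show ?thesis by (simp only: mult.assoc[symmetric] mult_1)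
    qed
    ultimately have "norm (osc P a x t) \<le> 2 ^ N * C1 * (norm x powr (- real N) * norm x powr (\<theta> * real N))"
      by (simp only: mult.left_commute[of "norm x powr (- real N)"])
    also have "norm x powr (- real N) * norm x powr (\<theta> * real N) = norm x powr (- ((1 - \<theta>) * real N))"
      by (simp add: algebra_simps flip: powr_add)
    also have "2 ^ N * C1 * norm x powr (- ((1 - \<theta>) * real N)) \<le> 2 ^ N * C1 * norm x powr (- \<gamma>)"
      using x N C1(1) by (intro mult_left_mono powr_mono) auto
    also have "\<dots> \<le> (D + 2 ^ N * C1) * norm x powr (- \<gamma>)"
      using D by (intro mult_right_mono) auto
    finally show ?thesis .
  qed
  \<comment> \<open>The factor \<open>2 powr \<gamma>\<close> pays for passing from
    \<open>norm x\<close> to \<open>(1 + norm x) / 2\<close>, and \<open>C0\<close> covers the unit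
    ball.\<close>
  define C where "C = 2 powr \<gamma> * (C0 + D + 2 ^ N * C1)"
  have "norm (osc P a x t) \<le> C * (1 + norm x) powr (- \<gamma>)" for x t
  proof (cases "1 \<le> norm x")
    case True
    have "norm (osc P a x t) \<le> (D + 2 ^ N * C1) * norm x powr (- \<gamma>)" using large[OF True] .
    also have "\<dots> \<le> (C0 + D + 2 ^ N * C1) * ((1 + norm x) / 2) powr (- \<gamma>)"
      using True C0 C1 D \<gamma> by (intro mult_mono powr_mono2') auto
    also have "\<dots> = C * (1 + norm x) powr (- \<gamma>)"
      unfolding C_def by (subst powr_divide) (auto simp: powr_minus field_simps)
    finally show ?thesis .
  next
    case False
    have "norm (osc P a x t) \<le> C0" by (rule C0)
    also have "\<dots> \<le> (C0 + D + 2 ^ N * C1) * 1" using D C1 by simp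
    also have "\<dots> \<le> (C0 + D + 2 ^ N * C1) * ((1 + norm x) / 2) powr (- \<gamma>)"
    proof (intro mult_left_mono)
      have "1 powr (- \<gamma>) \<le> ((1 + norm x) / 2) powr (- \<gamma>)"
        using False \<gamma> by (intro powr_mono2') (auto intro: add_pos_nonneg)
      then show "1 \<le> ((1 + norm x) / 2) powr (- \<gamma>)" by simp
    qed (use C0 C1 D in auto)
    also have "\<dots> = C * (1 + norm x) powr (- \<gamma>)"
      unfolding C_def by (subst powr_divide) (auto simp: powr_minus field_simps)
    finally show ?thesis .
  qed
  moreover have "0 \<le> C" using C0 C1 D by (simp add: C_def)
  ultimately show ?thesis by blast
qed

section \<open>Test functions\<close>

lemma continuous_on_osc:
  fixes P :: "'a::euclidean_space \<Rightarrow> real"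
  assumes g: "integrable lebesgue g" and P: "P \<in> borel_measurable borel"
  shows "continuous_on UNIV (\<lambda>(t, x). osc P g x t)"
  unfolding continuous_on_eq_continuous_at[OF open_UNIV] continuous_at_sequentially
proof (intro ballI allI impI)
  fix p :: "real \<times> 'a" and z assume z: "z \<longlonglongrightarrow> p"
  have z1: "(\<lambda>n. fst (z n)) \<longlonglongrightarrow> fst p" and z2: "(\<lambda>n. snd (z n)) \<longlonglongrightarrow> snd p"
    using z by (auto intro: tendsto_intros)
  note [measurable] = borel_measurable_integrable[OF g] P
  have m: "(\<lambda>\<xi>. g \<xi> * echar (y \<bullet> \<xi> + t * P \<xi>)) \<in> borel_measurable lebesgue" for y t
    using borel_measurable_integrable[OF osc_integrable[OF g P]] .
  have "(\<lambda>n. LINT \<xi>|lebesgue. g \<xi> * echar (snd (z n) \<bullet> \<xi> + fst (z n) * P \<xi>))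
      \<longlonglongrightarrow> (LINT \<xi>|lebesgue. g \<xi> * echar (snd p \<bullet> \<xi> + fst p * P \<xi>))"
  proof (rule integral_dominated_convergence[where w="\<lambda>\<xi>. norm (g \<xi>)"])
    show "integrable lebesgue (\<lambda>\<xi>. norm (g \<xi>))" using g by (rule integrable_norm)
    show "AE \<xi> in lebesgue. (\<lambda>n. g \<xi> * echar (snd (z n) \<bullet> \<xi> + fst (z n) * P \<xi>)) \<longlonglongrightarrow> g \<xi> * echar (snd p \<bullet> \<xi> + fst p * P \<xi>)"
      by (intro AE_I2 tendsto_intros z1 z2)
  qed (auto simp: norm_mult m)
  then show "((\<lambda>(t, x). osc P g x t) \<circ> z) \<longlonglongrightarrow> (case p of (t, x) \<Rightarrow> osc P g x t)"
    by (simp add: osc_eq o_def split_beta)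
qed

lemma continuous_on_osc_at: 
  fixes P :: "'a::euclidean_space \<Rightarrow> real"
  assumes "integrable lebesgue g" "P \<in> borel_measurable borel"
  shows "continuous_on UNIV (\<lambda>x. osc P g x t)"
proof -
  have "continuous_on UNIV (\<lambda>x. (\<lambda>(t, x). osc P g x t) (t, x))"
    by (rule continuous_on_compose2[OF continuous_on_osc[OF assms]]) (auto intro!: continuous_intros)
  then show ?thesis by simp
qed

text \<open>Upgrades the essential supremum of the dispersive hypothesis to a bound at every point,
  as is needed before the kernel is integrated against possibly singular measures. A violation would
  persist on a nonempty open set.\<close>

lemma AE_le_imp_le:
  fixes f :: "'a::euclidean_space \<Rightarrow> real"
  assumes "AE x in lebesgue. f x \<le> c" "continuous_on UNIV f"
  shows "f x \<le> c"
proof (rule ccontr)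
  assume "\<not> f x \<le> c"
  then have ne: "{x. c < f x} \<noteq> {}" by (auto simp: not_le)
  have op: "open {x. c < f x}"
    using assms(2) by (intro open_Collect_less) auto
  have "{x. c < f x} \<in> null_sets lebesgue"
    using assms(1) op by (subst AE_iff_null_sets) (auto simp: not_less)
  then show False using open_not_negligible[OF op ne] by (simp add: negligible_iff_null_sets)
qed

text \<open>The amplitude whose inverse transform is the derivative of \<open>ifourier a\<close> in
  the direction \<open>h\<close>.\<close>

definition frequency_weight :: "'a::euclidean_space \<Rightarrow> ('a \<Rightarrow> complex) \<Rightarrow> 'a \<Rightarrow> complex" where
  "frequency_weight h a \<xi> = (2 * of_real pi * \<i> * of_real (\<xi> \<bullet> h)) * a \<xi>"

lemma amplitude_frequency_weight: "amplitude a \<Longrightarrow> amplitude (frequency_weight h a)"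
  unfolding frequency_weight_def[abs_def]
  by (intro amplitude_mult smooth_on_mult smooth_on_const smooth_on_of_real smooth_on_inner) auto

lemma ifourier_has_derivative:
  fixes a :: "'a::euclidean_space \<Rightarrow> complex"
  assumes a: "amplitude a"
  shows "(ifourier a has_derivative (\<lambda>h. ifourier (frequency_weight h a) x)) (at x)"
proof (rule has_derivativeI_sandwich[where e=1 and H="\<lambda>y. 18 * pi\<^sup>2 * (LINT \<xi>|lebesgue. norm (a \<xi>)) * norm (y - x)"])
  note int = amplitude_integrable[OF a] amplitude_integrable[OF amplitude_frequency_weight[OF a]]
  have inte: "integrable lebesgue (\<lambda>\<xi>. a \<xi> * echar (x \<bullet> \<xi>))"
    "integrable lebesgue (\<lambda>\<xi>. frequency_weight h a \<xi> * echar (x \<bullet> \<xi>))" for x h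
    using int by (auto intro!: integrable_mult_echar borel_measurable_lebesgue)
  have "linear (\<lambda>h. ifourier (frequency_weight h a) x)"
  proof (rule linearI)
    fix h k
    have "frequency_weight (h + k) a \<xi> * echar (x \<bullet> \<xi>) = frequency_weight h a \<xi> * echar (x \<bullet> \<xi>) + frequency_weight k a \<xi> * echar (x \<bullet> \<xi>)" for \<xi>
      by (simp add: frequency_weight_def inner_add_right algebra_simps)
    then show "ifourier (frequency_weight (h + k) a) x = ifourier (frequency_weight h a) x + ifourier (frequency_weight k a) x"
      unfolding ifourier_def using inte by simp
  next
    fix c h
    have "frequency_weight (c *\<^sub>R h) a \<xi> * echar (x \<bullet> \<xi>) = c *\<^sub>R (frequency_weight h a \<xi> * echar (x \<bullet> \<xi>))" for \<xi>
      by (simp add: frequency_weight_def scaleR_conv_of_real)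
    then show "ifourier (frequency_weight (c *\<^sub>R h) a) x = c *\<^sub>R ifourier (frequency_weight h a) x"
      unfolding ifourier_def by simp
  qed
  then show "bounded_linear (\<lambda>h. ifourier (frequency_weight h a) x)" by (simp add: linear_conv_bounded_linear)
  fix y assume "y \<noteq> x"
  define h where "h = y - x"
  have y: "y = x + h" and h: "h \<noteq> 0" using \<open>y \<noteq> x\<close> by (auto simp: h_def)
  \<comment> \<open>On the support of \<open>a\<close> the frequency is at most 3 in norm. The
    second order remainder of the exponential is thus at most
    \<open>(2 * pi * (3 * norm h))\<^sup>2 / 2\<close>, whence the constant
    \<open>18 * pi\<^sup>2\<close>.\<close>
  have pt: "norm (a \<xi> * echar (y \<bullet> \<xi>) - a \<xi> * echar (x \<bullet> \<xi>) - frequency_weight h a \<xi> * echar (x \<bullet> \<xi>))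
      \<le> 18 * pi\<^sup>2 * (norm h)\<^sup>2 * norm (a \<xi>)" for \<xi>
  proof (cases "a \<xi> = 0")
    case True
    then show ?thesis by (simp add: frequency_weight_def)
  next
    case False
    then have x3: "norm \<xi> \<le> 3" using amplitude_zero[OF a, of \<xi>] by fastforce
    let ?u = "2 * pi * (\<xi> \<bullet> h)"
    have e: "echar (h \<bullet> \<xi>) = iexp ?u" by (simp add: echar_def inner_commute mult_ac)
    have "a \<xi> * echar (y \<bullet> \<xi>) - a \<xi> * echar (x \<bullet> \<xi>) - frequency_weight h a \<xi> * echar (x \<bullet> \<xi>)
        = a \<xi> * echar (x \<bullet> \<xi>) * (echar (h \<bullet> \<xi>) - (1 + \<i> * ?u))"
      by (simp add: y inner_add_left echar_add frequency_weight_def algebra_simps)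
    then have eq: "norm (a \<xi> * echar (y \<bullet> \<xi>) - a \<xi> * echar (x \<bullet> \<xi>) - frequency_weight h a \<xi> * echar (x \<bullet> \<xi>))
        = norm (a \<xi>) * norm (iexp ?u - (1 + \<i> * ?u))"
      unfolding e by (simp add: norm_mult)
    have "norm (iexp ?u - (1 + \<i> * ?u)) \<le> \<bar>?u\<bar>\<^sup>2 / 2"
      using iexp_approx1[of ?u 1] by (simp add: power2_eq_square fact_numeral)
    also have "\<bar>?u\<bar>\<^sup>2 / 2 \<le> (2 * pi * (3 * norm h))\<^sup>2 / 2"
    proof (intro divide_right_mono power_mono)
      have "\<bar>\<xi> \<bullet> h\<bar> \<le> norm \<xi> * norm h" by (rule Cauchy_Schwarz_ineq2)
      also have "\<dots> \<le> 3 * norm h" using x3 by (intro mult_right_mono) auto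
      finally show "\<bar>?u\<bar> \<le> 2 * pi * (3 * norm h)" by (simp add: abs_mult)
    qed auto
    also have "(2 * pi * (3 * norm h))\<^sup>2 / 2 = 18 * pi\<^sup>2 * (norm h)\<^sup>2" by (simp add: power2_eq_square)
    finally show ?thesis unfolding eq mult.commute[of _ "norm (a \<xi>)"] by (rule mult_left_mono) simp
  qed
  have "ifourier a y - ifourier a x - ifourier (frequency_weight h a) x
      = (LINT \<xi>|lebesgue. a \<xi> * echar (y \<bullet> \<xi>) - a \<xi> * echar (x \<bullet> \<xi>) - frequency_weight h a \<xi> * echar (x \<bullet> \<xi>))"
    unfolding ifourier_def using inte by simp
  also have "norm \<dots> \<le> (LINT \<xi>|lebesgue. 18 * pi\<^sup>2 * (norm h)\<^sup>2 * norm (a \<xi>))"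
    using inte int(1) by (intro Bochner_Integration.integral_norm_bound_integral pt Bochner_Integration.integrable_diff integrable_mult_right integrable_norm) auto
  also have "\<dots> = 18 * pi\<^sup>2 * (norm h)\<^sup>2 * (LINT \<xi>|lebesgue. norm (a \<xi>))" by simp
  finally have "norm (ifourier a y - ifourier a x - ifourier (frequency_weight h a) x) / norm h
      \<le> 18 * pi\<^sup>2 * (norm h)\<^sup>2 * (LINT \<xi>|lebesgue. norm (a \<xi>)) / norm h"
    by (intro divide_right_mono) auto
  also have "\<dots> = 18 * pi\<^sup>2 * (LINT \<xi>|lebesgue. norm (a \<xi>)) * norm h" using h by (simp add: power2_eq_square)
  finally show "norm (ifourier a y - ifourier a x - ifourier (frequency_weight (y - x) a) x) / norm (y - x)
      \<le> 18 * pi\<^sup>2 * (LINT \<xi>|lebesgue. norm (a \<xi>)) * norm (y - x)"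
    by (simp add: h_def)
next
  have "((\<lambda>y. 18 * pi\<^sup>2 * (LINT \<xi>|lebesgue. norm (a \<xi>)) * norm (y - x)) \<longlongrightarrow> 18 * pi\<^sup>2 * (LINT \<xi>|lebesgue. norm (a \<xi>)) * norm (x - x)) (at x)"
    by (intro tendsto_intros)
  then show "((\<lambda>y. 18 * pi\<^sup>2 * (LINT \<xi>|lebesgue. norm (a \<xi>)) * norm (y - x)) \<longlongrightarrow> 0) (at x)" by simp
qed simp

text \<open>Differentiation stays within inverse transforms of amplitudes, so all Schwartz seminorms
  reduce to the decay of a single such transform.\<close>

lemma iter_partial_ifourier:
  assumes "amplitude a" "set bs \<subseteq> Basis"
  shows "\<exists>a'. amplitude a' \<and> iter_partial bs (ifourier a) = ifourier a'"
  using assms(2)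
proof (induction bs)
  case (Cons b bs)
  then obtain a' where a': "amplitude a'" "iter_partial bs (ifourier a) = ifourier a'" by auto
  have "iter_partial (b # bs) (ifourier a) = ifourier (frequency_weight b a')"
    by (rule ext) (simp add: a' partial_eq[OF ifourier_has_derivative[OF a'(1)]])
  then show ?case using amplitude_frequency_weight[OF a'(1)] by blast
qed (use assms in auto)

text \<open>This is \<open>osc_decay\<close> for the phase 0 at time 0; the exponents 0 and
  \<open>N\<close> together replace \<open>norm x\<close> by \<open>1 + norm x\<close>.\<close>

lemma ifourier_rapid_decay:
  fixes a :: "'a::euclidean_space \<Rightarrow> complex"
  assumes "amplitude a" shows "\<exists>C. \<forall>x. (1 + norm x) ^ N * norm (ifourier a x) \<le> C"
proof -
  have P: "smooth_on (- {0}) (\<lambda>_::'a. 0::real)" by (rule smooth_on_const)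
  have e: "evolved (\<lambda>_. 0) 0 a = a" by (rule evolved_0)
  obtain C0 where C0: "0 \<le> C0" "\<And>x. norm (ifourier a x) \<le> C0"
    using osc_decay[OF P assms, of 0] e by (metis mult_1 power_0 mult.right_neutral)
  obtain C1 where C1: "0 \<le> C1" "\<And>x. norm x ^ N * norm (ifourier a x) \<le> C1"
    using osc_decay[OF P assms, of N] e by (metis abs_zero add.right_neutral mult.right_neutral power_one)
  have "(1 + norm x) ^ N * norm (ifourier a x) \<le> 2 ^ N * (C0 + C1)" for x
  proof (cases "norm x \<le> 1")
    case True
    have "(1 + norm x) ^ N * norm (ifourier a x) \<le> 2 ^ N * C0"
      using True C0 by (intro mult_mono power_mono) auto
    also have "\<dots> \<le> 2 ^ N * (C0 + C1)" using C1 by simp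
    finally show ?thesis .
  next
    case False
    have "(1 + norm x) ^ N * norm (ifourier a x) \<le> (2 * norm x) ^ N * norm (ifourier a x)"
      using False by (intro mult_right_mono power_mono) auto
    also have "\<dots> = 2 ^ N * (norm x ^ N * norm (ifourier a x))" by (simp add: power_mult_distrib)
    also have "\<dots> \<le> 2 ^ N * (C0 + C1)" using C1(2)[of x] C0(1) by (intro mult_left_mono) auto
    finally show ?thesis .
  qed
  then show ?thesis by blast
qed

lemma ifourier_schwartz:
  assumes a: "amplitude a" shows "ifourier a \<in> schwartz"
proof -
  have "iter_partial bs (ifourier a) differentiable at x" if "set bs \<subseteq> Basis" for bs x
    using iter_partial_ifourier[OF a that] differentiableI[OF ifourier_has_derivative] by auto
  moreover have "\<exists>C. \<forall>x. (1 + norm x) ^ N * norm (iter_partial bs (ifourier a) x) \<le> C" if "set bs \<subseteq> Basis" for bs N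
    using iter_partial_ifourier[OF a that] ifourier_rapid_decay by metis
  ultimately show ?thesis by (auto simp: schwartz_def smooth_on_def)
qed

text \<open>A product of one-dimensional weights is integrable by Tonelli, without polar
  coordinates.\<close>

lemma integrable_product_weight:
  "(\<integral>\<^sup>+x. ennreal (\<Prod>b\<in>Basis. inverse (1 + (x \<bullet> b)\<^sup>2)) \<partial>(lborel :: 'a::euclidean_space measure)) < \<infinity>"
proof -
  have "integrable lborel (\<lambda>u::real. inverse (1 + u\<^sup>2))"
    using integrable_inverse_1_plus_square by (simp add: set_integrable_def)
  then have fin: "(\<integral>\<^sup>+u. ennreal (inverse (1 + u\<^sup>2)) \<partial>(lborel :: real measure)) < \<infinity>"
    by (auto simp: integrable_iff_bounded)
  have "(\<integral>\<^sup>+x. ennreal (\<Prod>b\<in>Basis. inverse (1 + (x \<bullet> b)\<^sup>2)) \<partial>(lborel :: 'a measure))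
     = (\<integral>\<^sup>+x. (\<Prod>b\<in>Basis. ennreal (inverse (1 + (x \<bullet> b)\<^sup>2))) \<partial>(lborel :: 'a measure))"
    by (simp add: prod_ennreal)
  also have "\<dots> = (\<Prod>b\<in>(Basis::'a set). \<integral>\<^sup>+u. ennreal (inverse (1 + u\<^sup>2)) \<partial>lborel)"
    by (rule nn_integral_lborel_prod) auto
  also have "\<dots> < \<infinity>"
    using fin by (auto simp: power_less_top_ennreal)
  finally show ?thesis .
qed

lemma ifourier_integrable:
  fixes a :: "'a::euclidean_space \<Rightarrow> complex"
  assumes a: "amplitude a" shows "integrable lebesgue (ifourier a)"
proof -
  \<comment> \<open>Each of the \<open>DIM('a)\<close> factors
    \<open>1 + (x \<bullet> b)\<^sup>2\<close> is at most \<open>(1 + norm x)\<^sup>2\<close>, which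
    explains the exponent.\<close>
  obtain C where C: "\<And>x. (1 + norm x) ^ (2 * DIM('a)) * norm (ifourier a x) \<le> C"
    using ifourier_rapid_decay[OF a] by blast
  have C0: "0 \<le> C" using order_trans[OF _ C[of 0]] by auto
  have m: "ifourier a \<in> borel_measurable borel"
    by (intro ifourier_measurable borel_measurable_lebesgue amplitude_measurable a)
  have bound: "norm (ifourier a x) \<le> C * (\<Prod>b\<in>Basis. inverse (1 + (x \<bullet> b)\<^sup>2))" for x
  proof -
    have "(\<Prod>b\<in>Basis. 1 + (x \<bullet> b)\<^sup>2) \<le> (\<Prod>b\<in>(Basis::'a set). (1 + norm x)\<^sup>2)"
    proof (intro prod_mono conjI)
      fix b :: 'a assume b: "b \<in> Basis"
      have "(x \<bullet> b)\<^sup>2 \<le> (norm x)\<^sup>2" using Basis_le_norm[OF b, of x] by (intro abs_le_square_iff[THEN iffD1]) simp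
      then show "1 + (x \<bullet> b)\<^sup>2 \<le> (1 + norm x)\<^sup>2" unfolding power2_sum by (simp add: add_increasing2)
    qed auto
    also have "\<dots> = (1 + norm x) ^ (2 * DIM('a))" by (simp add: power_mult)
    finally have "(\<Prod>b\<in>Basis. 1 + (x \<bullet> b)\<^sup>2) * norm (ifourier a x) \<le> (1 + norm x) ^ (2 * DIM('a)) * norm (ifourier a x)"
      by (intro mult_right_mono) auto
    also have "\<dots> \<le> C" by (rule C)
    finally have le: "(\<Prod>b\<in>Basis. 1 + (x \<bullet> b)\<^sup>2) * norm (ifourier a x) \<le> C" .
    have pos: "0 < (\<Prod>b\<in>Basis. 1 + (x \<bullet> b)\<^sup>2)" by (intro prod_pos) (auto intro: add_pos_nonneg)
    have "norm (ifourier a x) \<le> C / (\<Prod>b\<in>Basis. 1 + (x \<bullet> b)\<^sup>2)"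
      using le pos by (simp add: pos_le_divide_eq mult.commute)
    then show ?thesis by (simp add: divide_inverse prod_inversef[symmetric])
  qed
  have "(\<integral>\<^sup>+x. ennreal (norm (ifourier a x)) \<partial>lborel) \<le> (\<integral>\<^sup>+x. ennreal C * ennreal (\<Prod>b\<in>Basis. inverse (1 + (x \<bullet> b)\<^sup>2)) \<partial>(lborel :: 'a measure))"
  proof (intro nn_integral_mono)
    fix x :: 'a
    show "ennreal (norm (ifourier a x)) \<le> ennreal C * ennreal (\<Prod>b\<in>Basis. inverse (1 + (x \<bullet> b)\<^sup>2))"
      using bound[of x] C0 by (simp add: ennreal_mult'[symmetric] ennreal_leI)
  qed
  also have "\<dots> = ennreal C * (\<integral>\<^sup>+x. ennreal (\<Prod>b\<in>Basis. inverse (1 + (x \<bullet> b)\<^sup>2)) \<partial>(lborel :: 'a measure))"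
    by (rule nn_integral_cmult) measurable
  also have "\<dots> < \<infinity>" using integrable_product_weight[where 'a='a] by (simp add: ennreal_mult_less_top)
  finally have "integrable lborel (ifourier a)" using m by (auto simp: integrable_iff_bounded)
  then show ?thesis using m by (simp add: integrable_completion)
qed

section \<open>The dispersive hypothesis for the model kernel\<close>

abbreviation cbump :: "'a::euclidean_space \<Rightarrow> complex" where
  "cbump \<xi> \<equiv> of_real (bump \<xi>)"

text \<open>The dispersive hypothesis enters through one test function, the inverse transform of the
  bump. Every other frequency is reached from it by scaling.\<close>

lemma dispersive_kernel_bound:
  fixes P :: "'a::euclidean_space \<Rightarrow> real"
  assumes P: "smooth_on (- {0}) P"
    and decay: "\<forall>\<phi>\<in>schwartz.
      (\<exists>c1 c2. 0 < c1 \<and> c1 < c2 \<and> (\<forall>\<xi>. fourier \<phi> \<xi> \<noteq> 0 \<longrightarrow> c1 \<le> norm \<xi> \<and> norm \<xi> \<le> c2)) \<longrightarrow>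
      (\<exists>C. \<forall>t. t \<noteq> 0 \<longrightarrow> Linf_norm (propagator P t \<phi>) \<le> ereal (C * \<bar>t\<bar> powr (- \<beta>)))"
    and \<gamma>: "0 \<le> \<gamma>" "\<gamma> < \<beta>"
  shows "\<exists>C\<ge>0. \<forall>x t. norm (osc P cbump x t) \<le> C * (1 + norm x) powr (- \<gamma>)"
proof -
  note a = amplitude_bump[where 'a='a] and Pm = smooth_on_punctured_measurable[OF P]
  obtain B where B: "\<And>\<xi>. norm (cbump (\<xi>::'a)) \<le> B" using amplitude_bounded[OF a] by blast
  have "fourier (ifourier cbump) \<xi> = cbump (\<xi>::'a)" for \<xi>
    by (intro fourier_ifourier[OF _ _ B] amplitude_integrable amplitude_continuous ifourier_integrable a)
  then have "\<forall>\<xi>::'a. fourier (ifourier cbump) \<xi> \<noteq> 0 \<longrightarrow> 1/2 \<le> norm \<xi> \<and> norm \<xi> \<le> 3"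
    using bump_support[where 'a='a] by auto
  then have "\<exists>c1 c2. 0 < c1 \<and> c1 < c2 \<and> (\<forall>\<xi>::'a. fourier (ifourier cbump) \<xi> \<noteq> 0 \<longrightarrow> c1 \<le> norm \<xi> \<and> norm \<xi> \<le> c2)"
    by (intro exI[of _ "1/2::real"] exI[of _ "3::real"]) auto
  then obtain D where D: "\<And>t. t \<noteq> 0 \<Longrightarrow> Linf_norm (propagator P t (ifourier cbump)) \<le> ereal (D * \<bar>t\<bar> powr (- \<beta>))"
    using decay ifourier_schwartz[OF a] by meson
  have "norm (osc P cbump x t) \<le> D * \<bar>t\<bar> powr (- \<beta>)" if t: "t \<noteq> 0" for x t
  proof (rule AE_le_imp_le[of "\<lambda>x. norm (osc P cbump x t)"])
    have "AE x in lebesgue. ereal (norm (propagator P t (ifourier cbump) x)) \<le> Linf_norm (propagator P t (ifourier cbump))"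
      unfolding Linf_norm_def by (rule esssup_AE)
    moreover have "AE x in lebesgue. propagator P t (ifourier cbump) x = osc P cbump x t"
      by (rule propagator_ifourier[where R=3, OF amplitude_continuous[OF a] B _ ifourier_integrable[OF a] Pm])
         (use amplitude_zero[OF a] in auto)
    ultimately show "AE x in lebesgue. norm (osc P cbump x t) \<le> D * \<bar>t\<bar> powr (- \<beta>)"
    proof eventually_elim
      case (elim x)
      then show ?case using order_trans[OF elim(1) D[OF t]] by simp
    qed
    show "continuous_on UNIV (\<lambda>x. norm (osc P cbump x t))"
      by (intro continuous_on_norm continuous_on_osc_at amplitude_integrable a Pm)
  qed
  then show ?thesis by (intro osc_uniform_decay[OF P a \<gamma>])
qed

section \<open>Riesz-type energies and averages over balls\<close>

text \<open>Take the least \<open>j\<close> for which \<open>(1/2) ^ Suc j\<close> is at most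
  \<open>d + 1 / l\<close>. Minimality gives the first inequality, and for \<open>j = 0\<close> it
  is the assumption \<open>d < 1\<close>.\<close>

lemma one_le_dyadic:
  fixes d l :: real
  assumes d: "0 \<le> d" "d < 1" and l: "0 < l"
  shows "\<exists>j::nat. d < (1/2) ^ j \<and> l * (1/2) ^ Suc j \<le> 1 + l * d"
proof -
  have "0 < d + 1 / l" using d l by (simp add: add_nonneg_pos)
  then obtain i :: nat where "(1/2) ^ i < d + 1 / l" using real_arch_pow_inv[of "d + 1/l" "1/2"] by auto
  moreover have "(1/2::real) ^ Suc i \<le> (1/2) ^ i" by simp
  ultimately have ex: "(1/2) ^ Suc i \<le> d + 1 / l" by linarith
  define j where "j = (LEAST j. (1/2::real) ^ Suc j \<le> d + 1 / l)"
  have j: "(1/2) ^ Suc j \<le> d + 1 / l" unfolding j_def by (rule LeastI[of _ i]) (rule ex)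
  have "l * (1/2) ^ Suc j \<le> l * (d + 1 / l)" using j l by (intro mult_left_mono) auto
  also have "\<dots> = 1 + l * d" using l by (simp add: field_simps)
  finally have 1: "l * (1/2) ^ Suc j \<le> 1 + l * d" .
  have "d < (1/2) ^ j"
  proof (cases j)
    case (Suc k)
    have "\<not> (1/2) ^ Suc k \<le> d + 1 / l" using not_less_Least[of k "\<lambda>j. (1/2::real) ^ Suc j \<le> d + 1 / l"] Suc j_def by simp
    then show ?thesis using Suc l by (smt (verit) divide_pos_pos)
  qed (use d in simp)
  with 1 show ?thesis by blast
qed

text \<open>The kernel is dominated by a weighted sum of indicators of dyadic balls around
  \<open>x\<close>, to which the Frostman bound applies. The measure is kept general because the
  lemma serves both \<mu> with its exponent \<alpha> and the uniform measure on the unit ball with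
  the full dimension.\<close>

lemma frostman_potential_bound:
  fixes \<nu> :: "'a::euclidean_space measure"
  assumes \<nu>: "prob_space \<nu>" "sets \<nu> = sets borel"
    and ball: "\<And>x r. 0 < r \<Longrightarrow> measure \<nu> (ball x r) \<le> C * r powr a"
    and \<gamma>: "\<gamma> = 0 \<or> 0 < \<gamma> \<and> \<gamma> < a"
  shows "\<exists>C'\<ge>0. \<forall>x l. 0 < l \<longrightarrow> (\<integral>\<^sup>+y. ennreal ((1 + l * norm (y - x)) powr (- \<gamma>)) \<partial>\<nu>) \<le> ennreal (C' * l powr (- \<gamma>))"
proof -
  interpret prob_space \<nu> by fact
  note [measurable_cong] = \<nu>(2)
  have sp: "space \<nu> = UNIV" using sets_eq_imp_space_eq[OF \<nu>(2)] by simp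
  have C: "0 \<le> C" using order_trans[OF measure_nonneg ball[of 1 0]] by simp
  show ?thesis
  proof (cases "\<gamma> = 0")
    case True
    have "(\<integral>\<^sup>+y. ennreal ((1 + l * norm (y - x)) powr (- \<gamma>)) \<partial>\<nu>) \<le> 1" if "0 < l" for x l
    proof -
      have "(\<integral>\<^sup>+y. ennreal ((1 + l * norm (y - x)) powr (- \<gamma>)) \<partial>\<nu>) \<le> (\<integral>\<^sup>+y. 1 \<partial>\<nu>)"
        using True by (intro nn_integral_mono) auto
      then show ?thesis by (simp add: emeasure_space_1)
    qed
    then show ?thesis using True by (intro exI[of _ 1]) auto
  next
    case False
    then have \<gamma>: "0 < \<gamma>" "\<gamma> < a" using \<gamma> by auto
    \<comment> \<open>This is \<open>((1/2) ^ Suc j) powr (- \<gamma>)\<close>. The ball of radius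
      \<open>(1/2) ^ j\<close> has measure at most \<open>C * (2 powr (- a)) ^ j\<close>, so the
      products decay like \<open>q ^ j\<close>.\<close>
    let ?A = "\<lambda>j. 2 powr \<gamma> * (2 powr \<gamma>) ^ j"
    define q where "q = 2 powr (\<gamma> - a)"
    have q: "0 \<le> q" "q < 1" using \<gamma> by (auto simp: q_def powr_less_one)
    \<comment> \<open>The summand 1 accounts for points at distance at least 1 from
      \<open>x\<close>, the rest for the geometric series.\<close>
    define S where "S = 1 + C * 2 powr \<gamma> * (1 / (1 - q))"
    have S0: "0 \<le> S" using C q by (simp add: S_def)
    have "(\<integral>\<^sup>+y. ennreal ((1 + l * norm (y - x)) powr (- \<gamma>)) \<partial>\<nu>) \<le> ennreal (S * l powr (- \<gamma>))" if l: "0 < l" for x l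
    proof -
      have pt: "ennreal ((1 + l * norm (y - x)) powr (- \<gamma>))
         \<le> ennreal (l powr (- \<gamma>)) * (1 + (\<Sum>j. ennreal (?A j) * indicator (ball x ((1/2) ^ j)) y))" for y
      proof (cases "1 \<le> norm (y - x)")
        case True
        have "l * 1 \<le> l * norm (y - x)" using True l by (intro mult_left_mono) auto
        then have "l \<le> 1 + l * norm (y - x)" by linarith
        then have "(1 + l * norm (y - x)) powr (- \<gamma>) \<le> l powr (- \<gamma>)"
          using l \<gamma> by (intro powr_mono2') auto
        then have "ennreal ((1 + l * norm (y - x)) powr (- \<gamma>)) \<le> ennreal (l powr (- \<gamma>)) * (1 + 0)"
          by (simp add: ennreal_leI)
        also have "\<dots> \<le> ennreal (l powr (- \<gamma>)) * (1 + (\<Sum>j. ennreal (?A j) * indicator (ball x ((1/2) ^ j)) y))"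
          by (intro mult_left_mono add_left_mono) auto
        finally show ?thesis .
      next
        case False
        then obtain j :: nat where j: "norm (y - x) < (1/2) ^ j" "l * (1/2) ^ Suc j \<le> 1 + l * norm (y - x)"
          using one_le_dyadic[of "norm (y - x)" l] l by auto
        have "(1 + l * norm (y - x)) powr (- \<gamma>) \<le> (l * (1/2) ^ Suc j) powr (- \<gamma>)"
          using j(2) l \<gamma> by (intro powr_mono2') auto
        also have "\<dots> = l powr (- \<gamma>) * ((1/2) ^ Suc j) powr (- \<gamma>)" by (rule powr_mult)
        also have "((1/2::real) ^ Suc j) powr (- \<gamma>) = ?A j"
        proof -
          have "((1/2::real) ^ Suc j) powr (- \<gamma>) = (2 powr (- real (Suc j))) powr (- \<gamma>)"
            by (simp add: powr_minus powr_realpow power_one_over inverse_eq_divide del: of_nat_Suc power_Suc)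
          also have "\<dots> = 2 powr (\<gamma> + real j * \<gamma>)" by (simp add: powr_powr algebra_simps)
          also have "\<dots> = ?A j" by (simp add: powr_add powr_powr mult.commute flip: powr_realpow)
          finally show ?thesis .
        qed
        finally have "ennreal ((1 + l * norm (y - x)) powr (- \<gamma>)) \<le> ennreal (l powr (- \<gamma>)) * ennreal (?A j)"
          by (simp add: ennreal_mult'[symmetric] ennreal_leI)
        also have "ennreal (?A j) = (\<Sum>i\<in>{j}. ennreal (?A i) * indicator (ball x ((1/2) ^ i)) y)"
          using j(1) by (simp add: dist_norm norm_minus_commute)
        also have "\<dots> \<le> (\<Sum>i. ennreal (?A i) * indicator (ball x ((1/2) ^ i)) y)"
          by (rule sum_le_suminf) auto
        also have "\<dots> \<le> 1 + \<dots>" by (rule add_increasing) auto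
        finally show ?thesis by (simp add: mult_left_mono)
      qed
      have "(\<integral>\<^sup>+y. ennreal ((1 + l * norm (y - x)) powr (- \<gamma>)) \<partial>\<nu>)
          \<le> (\<integral>\<^sup>+y. ennreal (l powr (- \<gamma>)) * (1 + (\<Sum>j. ennreal (?A j) * indicator (ball x ((1/2) ^ j)) y)) \<partial>\<nu>)"
        by (intro nn_integral_mono pt)
      also have "\<dots> = ennreal (l powr (- \<gamma>)) * (1 + (\<Sum>j. ennreal (?A j) * emeasure \<nu> (ball x ((1/2) ^ j))))"
      proof -
        have [measurable]: "ball x r \<in> sets \<nu>" for r using \<nu>(2) by simp
        show ?thesis
          by (simp add: nn_integral_cmult nn_integral_add nn_integral_suminf emeasure_space_1)
      qed
      also have "\<dots> \<le> ennreal (l powr (- \<gamma>)) * (1 + (\<Sum>j. ennreal (C * 2 powr \<gamma> * q ^ j)))"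
      proof (intro mult_left_mono add_left_mono suminf_le)
        fix j :: nat
        have "?A j * measure \<nu> (ball x ((1/2) ^ j)) \<le> ?A j * (C * ((1/2) ^ j) powr a)"
          by (intro mult_left_mono ball) auto
        also have "((1/2::real) ^ j) powr a = (2 powr (- a)) ^ j"
        proof -
          have "((1/2::real) ^ j) powr a = (2 powr (- real j)) powr a"
            by (simp add: powr_minus powr_realpow power_one_over inverse_eq_divide)
          also have "\<dots> = (2 powr (- a)) ^ j" by (simp add: powr_powr mult.commute flip: powr_realpow)
          finally show ?thesis .
        qed
        also have "?A j * (C * (2 powr (- a)) ^ j) = C * 2 powr \<gamma> * (2 powr \<gamma> * 2 powr (- a)) ^ j"
          by (simp add: power_mult_distrib)
        also have "2 powr \<gamma> * 2 powr (- a) = q" by (simp add: q_def flip: powr_add)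
        finally show "ennreal (?A j) * emeasure \<nu> (ball x ((1/2) ^ j)) \<le> ennreal (C * 2 powr \<gamma> * q ^ j)"
          by (simp add: emeasure_eq_measure ennreal_mult'[symmetric] ennreal_leI)
      qed auto
      also have "(\<Sum>j. ennreal (C * 2 powr \<gamma> * q ^ j)) = ennreal (C * 2 powr \<gamma> * (1 / (1 - q)))"
        using C q by (subst suminf_ennreal2) (auto intro!: summable_mult summable_geometric simp: suminf_mult suminf_geometric)
      also have "1 + ennreal (C * 2 powr \<gamma> * (1 / (1 - q))) = ennreal S"
        using C q unfolding S_def by (subst ennreal_plus) auto
      also have "ennreal (l powr (- \<gamma>)) * ennreal S = ennreal (S * l powr (- \<gamma>))"
        using S0 by (simp add: ennreal_mult'[symmetric] mult.commute)
      finally show ?thesis .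
    qed
    then show ?thesis using S0 by blast
  qed
qed

text \<open>The uniform distribution on the unit ball. Averages over \<open>ball x r\<close> become
  expectations of \<open>g (x + r *\<^sub>R z)\<close>, which still make sense at
  \<open>r = 0\<close>.\<close>

definition ball_measure :: "'a::euclidean_space measure" where
  "ball_measure = density lborel (\<lambda>z. ennreal (indicator (ball 0 1) z / measure lborel (ball (0::'a) 1)))"

lemma sets_ball_measure [simp, measurable_cong]: "sets ball_measure = sets borel"
  and space_ball_measure [simp]: "space ball_measure = UNIV"
  by (simp_all add: ball_measure_def)

lemma measure_unit_ball_pos: "0 < measure lborel (ball (0::'a::euclidean_space) 1)"
  by (simp add: content_ball)

lemma ball_measure_density_measurable [measurable]:
  "(\<lambda>z::'a::euclidean_space. indicator (ball 0 1) z / measure lborel (ball (0::'a) 1)) \<in> borel_measurable borel"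
  by (intro borel_measurable_divide borel_measurable_indicator) auto

lemma measure_ball_measure:
  assumes "A \<in> sets borel"
  shows "emeasure ball_measure A = ennreal (measure lborel (A \<inter> ball (0::'a::euclidean_space) 1) / measure lborel (ball (0::'a) 1))"
proof -
  let ?V = "measure lborel (ball (0::'a) 1)"
  have fin: "emeasure lborel (A \<inter> ball (0::'a) 1) \<noteq> \<infinity>"
    using emeasure_mono[of "A \<inter> ball (0::'a) 1" "ball 0 1" lborel] emeasure_lborel_ball_finite[of "0::'a" 1]
    by (auto simp: top_unique)
  have "emeasure ball_measure A = (\<integral>\<^sup>+z. ennreal (indicator (ball 0 1) z / ?V) * indicator A z \<partial>lborel)"
    unfolding ball_measure_def using assms by (subst emeasure_density) auto
  also have "\<dots> = (\<integral>\<^sup>+z. ennreal (1 / ?V) * indicator (A \<inter> ball 0 1) z \<partial>lborel)"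
    by (intro nn_integral_cong) (auto simp: indicator_def)
  also have "\<dots> = ennreal (1 / ?V) * emeasure lborel (A \<inter> ball 0 1)"
    using assms by (intro nn_integral_cmult_indicator) auto
  also have "\<dots> = ennreal (1 / ?V) * ennreal (measure lborel (A \<inter> ball 0 1))"
    using fin by (simp add: emeasure_eq_ennreal_measure)
  also have "\<dots> = ennreal (measure lborel (A \<inter> ball 0 1) / ?V)"
    by (simp add: ennreal_mult'[symmetric])
  finally show ?thesis .
qed

lemma prob_space_ball_measure: "prob_space (ball_measure :: 'a::euclidean_space measure)"
proof
  show "emeasure ball_measure (space (ball_measure :: 'a measure)) = 1"
    using measure_ball_measure[of "UNIV :: 'a set"] measure_unit_ball_pos[where 'a='a] by simp
qed

interpretation ball_measure: prob_space ball_measure by (rule prob_space_ball_measure)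

lemma ball_measure_ball_le:
  assumes "0 < r"
  shows "measure ball_measure (ball (x::'a::euclidean_space) r) \<le> 1 * r powr real DIM('a)"
proof -
  have "measure lborel (ball x r \<inter> ball 0 1) \<le> measure lborel (ball x r)"
    using emeasure_lborel_ball_finite[of x r] by (intro measure_mono_fmeasurable) (auto simp: fmeasurable_def)
  then have "measure lborel (ball x r \<inter> ball 0 1) / measure lborel (ball (0::'a) 1)
      \<le> measure lborel (ball x r) / measure lborel (ball (0::'a) 1)"
    by (intro divide_right_mono) auto
  also have "\<dots> = r ^ DIM('a)" 
    using less_imp_neq[OF unit_ball_vol_pos[of "real DIM('a)"]] assms by (simp add: content_ball)
  finally show ?thesis
    using assms by (simp add: measure_def measure_ball_measure powr_realpow)
qed

lemma AE_ball_measure: "AE z in ball_measure. norm z < 1"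
  unfolding ball_measure_def by (subst AE_density) (auto simp: indicator_def)

text \<open>Averaging preserves the decay, with a constant independent of the radius. If
  \<open>l * \<bar>r\<bar>\<close> is at most half of \<open>1 + l * norm x\<close>, the shift
  changes that quantity by at most a factor 2. Otherwise factoring out \<open>r\<close> gives a
  potential of the uniform measure at scale \<open>l * \<bar>r\<bar>\<close>, which then exceeds
  half of \<open>1 + l * norm x\<close>.\<close>

lemma average_kernel_bound:
  assumes \<gamma>: "\<gamma> = 0 \<or> 0 < \<gamma> \<and> \<gamma> < real DIM('a)"
  shows "\<exists>C\<ge>0. \<forall>(x::'a::euclidean_space) r l. 0 < l \<longrightarrow>
    (\<integral>\<^sup>+z. ennreal ((1 + l * norm (x + r *\<^sub>R z)) powr (- \<gamma>)) \<partial>ball_measure) \<le> ennreal (C * (1 + l * norm x) powr (- \<gamma>))"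
proof -
  obtain C' where C': "0 \<le> C'" "\<And>(x::'a) l. 0 < l \<Longrightarrow>
      (\<integral>\<^sup>+y. ennreal ((1 + l * norm (y - x)) powr (- \<gamma>)) \<partial>ball_measure) \<le> ennreal (C' * l powr (- \<gamma>))"
    using frostman_potential_bound[OF prob_space_ball_measure sets_ball_measure ball_measure_ball_le \<gamma>] by blast
  have \<gamma>0: "0 \<le> \<gamma>" using \<gamma> by auto
  define C where "C = (1 + C') * 2 powr \<gamma>"
  have half: "((1 + l * norm x) / 2) powr (- \<gamma>) = 2 powr \<gamma> * (1 + l * norm x) powr (- \<gamma>)" if "0 < l" for l and x :: 'a
    using that by (subst powr_divide) (auto simp: powr_minus field_simps)
  have "(\<integral>\<^sup>+z. ennreal ((1 + l * norm (x + r *\<^sub>R z)) powr (- \<gamma>)) \<partial>ball_measure) \<le> ennreal (C * (1 + l * norm x) powr (- \<gamma>))"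
    if l: "0 < l" for x :: 'a and r l
  proof (cases "l * \<bar>r\<bar> \<le> (1 + l * norm x) / 2")
    case True
    have pos: "0 < 1 + l * norm x" using l by (simp add: add_pos_nonneg)
    have "(\<integral>\<^sup>+z. ennreal ((1 + l * norm (x + r *\<^sub>R z)) powr (- \<gamma>)) \<partial>ball_measure) 
        \<le> (\<integral>\<^sup>+z. ennreal (C * (1 + l * norm x) powr (- \<gamma>)) \<partial>(ball_measure :: 'a measure))"
    proof (rule nn_integral_mono_AE, rule AE_mp[OF AE_ball_measure], rule AE_I2, rule impI, rule ennreal_leI)
      fix z :: 'a assume z: "norm z < 1"
      have "norm x - norm (r *\<^sub>R z) \<le> norm (x + r *\<^sub>R z)" by (rule norm_diff_ineq)
      moreover have "norm (r *\<^sub>R z) \<le> \<bar>r\<bar>" using z by (simp add: mult_left_le)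
      ultimately have "l * (norm x - \<bar>r\<bar>) \<le> l * norm (x + r *\<^sub>R z)" using l by (intro mult_left_mono) auto
      then have "(1 + l * norm x) / 2 \<le> 1 + l * norm (x + r *\<^sub>R z)" using True by (simp add: algebra_simps)
      then have "(1 + l * norm (x + r *\<^sub>R z)) powr (- \<gamma>) \<le> ((1 + l * norm x) / 2) powr (- \<gamma>)"
        using pos \<gamma>0 by (intro powr_mono2') auto
      also have "\<dots> \<le> C * (1 + l * norm x) powr (- \<gamma>)"
        unfolding half[OF l] C_def using C'(1) by (intro mult_right_mono) auto
      finally show "(1 + l * norm (x + r *\<^sub>R z)) powr (- \<gamma>) \<le> C * (1 + l * norm x) powr (- \<gamma>)" .
    qed
    then show ?thesis by (simp add: ball_measure.emeasure_space_1[simplified])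
  next
    case False
    have pos: "0 < 1 + l * norm x" using l by (simp add: add_pos_nonneg)
    then have "0 < (1 + l * norm x) / 2" by simp
    with False have lr: "0 < l * \<bar>r\<bar>" unfolding not_le by (rule less_trans[rotated])
    then have r: "r \<noteq> 0" by auto
    have "norm (x + r *\<^sub>R z) = \<bar>r\<bar> * norm (z - (- (x /\<^sub>R r)))" for z
    proof -
      have "x + r *\<^sub>R z = r *\<^sub>R (z - (- (x /\<^sub>R r)))" using r by (simp add: scaleR_add_right)
      then show ?thesis by (simp only: norm_scaleR)
    qed
    then have "(\<integral>\<^sup>+z. ennreal ((1 + l * norm (x + r *\<^sub>R z)) powr (- \<gamma>)) \<partial>ball_measure)
        = (\<integral>\<^sup>+z. ennreal ((1 + (l * \<bar>r\<bar>) * norm (z - (- (x /\<^sub>R r)))) powr (- \<gamma>)) \<partial>ball_measure)"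
      by (simp only: mult.assoc)
    also have "\<dots> \<le> ennreal (C' * (l * \<bar>r\<bar>) powr (- \<gamma>))" by (rule C'(2)[OF lr])
    also have "\<dots> \<le> ennreal (C' * ((1 + l * norm x) / 2) powr (- \<gamma>))"
      using False pos C'(1) \<gamma>0 by (intro ennreal_leI mult_left_mono powr_mono2') auto
    also have "\<dots> \<le> ennreal (C * (1 + l * norm x) powr (- \<gamma>))"
      unfolding half[OF l] C_def using C'(1) by (intro ennreal_leI) (auto simp: algebra_simps)
    finally show ?thesis .
  qed
  moreover have "0 \<le> C" using C'(1) by (simp add: C_def)
  ultimately show ?thesis by blast
qed

lemma ball_average_eq:
  fixes g :: "'a::euclidean_space \<Rightarrow> complex"
  assumes [measurable]: "g \<in> borel_measurable borel" and r: "0 < r"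
  shows "(LINT y:ball x r|lebesgue. g y) /\<^sub>R measure lebesgue (ball x r) = (LINT z|ball_measure. g (x + r *\<^sub>R z))"
proof -
  let ?V = "measure lborel (ball (0::'a) 1)"
  have [measurable]: "(\<lambda>y. indicator (ball x r) y *\<^sub>R g y) \<in> borel_measurable borel" for x r
    by (intro borel_measurable_scaleR borel_measurable_indicator) auto
  have "(LINT y:ball x r|lebesgue. g y) = (LINT y|lborel. indicator (ball x r) y *\<^sub>R g y)"
    unfolding set_lebesgue_integral_def by (rule integral_completion) measurable
  also have "\<dots> = r ^ DIM('a) *\<^sub>R (LINT z|lborel. indicator (ball x r) (x + r *\<^sub>R z) *\<^sub>R g (x + r *\<^sub>R z))"
    using r by (subst lborel_affine_integral[where t=x and c=r]) auto
  also have "(\<lambda>z. indicator (ball x r) (x + r *\<^sub>R z) *\<^sub>R g (x + r *\<^sub>R z)) = (\<lambda>z. indicator (ball 0 1) z *\<^sub>R g (x + r *\<^sub>R z))"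
    using r by (auto simp: indicator_def dist_norm)
  finally have 1: "(LINT y:ball x r|lebesgue. g y) = r ^ DIM('a) *\<^sub>R (LINT z|lborel. indicator (ball 0 1) z *\<^sub>R g (x + r *\<^sub>R z))" .
  have "(LINT z|ball_measure. g (x + r *\<^sub>R z)) = (LINT z|lborel. (indicator (ball 0 1) z / ?V) *\<^sub>R g (x + r *\<^sub>R z))"
    unfolding ball_measure_def by (rule integral_density) auto
  also have "\<dots> = (LINT z|lborel. (1 / ?V) *\<^sub>R (indicator (ball 0 1) z *\<^sub>R g (x + r *\<^sub>R z)))"
    by (intro Bochner_Integration.integral_cong) auto
  also have "\<dots> = (1 / ?V) *\<^sub>R (LINT z|lborel. indicator (ball 0 1) z *\<^sub>R g (x + r *\<^sub>R z))"
    by (rule integral_scaleR_right)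
  finally have 2: "(LINT z|ball_measure. g (x + r *\<^sub>R z)) = (1 / ?V) *\<^sub>R (LINT z|lborel. indicator (ball 0 1) z *\<^sub>R g (x + r *\<^sub>R z))" .
  have "measure lebesgue (ball x r) = r ^ DIM('a) * ?V"
    using r by (simp add: content_ball)
  then show ?thesis unfolding 1 2 using r measure_unit_ball_pos[where 'a='a] by (simp add: field_simps)
qed

text \<open>The Riesz energy of the distribution of \<open>X\<close>, regularised at distance
  \<open>1 / l\<close>. Using a random variable on \<open>M\<close> instead of a measure on the
  space lets the radius vary with the base point.\<close>

definition riesz_energy :: "'w measure \<Rightarrow> ('w \<Rightarrow> 'a::real_normed_vector) \<Rightarrow> real \<Rightarrow> real \<Rightarrow> ennreal" where
  "riesz_energy M X \<gamma> l = (\<integral>\<^sup>+\<omega>. \<integral>\<^sup>+\<omega>'. ennreal ((1 + l * norm (X \<omega> - X \<omega>')) powr (- \<gamma>)) \<partial>M \<partial>M)"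

text \<open>The radius depends on the base point, so the averaged kernel is not a fixed convolution.
  As \<open>average_kernel_bound\<close> is uniform in the radius, it can be applied to each of the
  two independent points in turn, which leaves the potential of \<mu>.\<close>

lemma averaged_energy_bound:
  fixes \<mu> :: "'a::euclidean_space measure"
  assumes \<mu>: "prob_space \<mu>" "sets \<mu> = sets borel"
    and ball: "\<And>x r. 0 < r \<Longrightarrow> measure \<mu> (ball x r) \<le> C * r powr \<alpha>"
    and \<gamma>: "\<gamma> = 0 \<or> 0 < \<gamma> \<and> \<gamma> < \<alpha>" "\<gamma> = 0 \<or> \<gamma> < real DIM('a)"
  shows "\<exists>C'\<ge>0. \<forall>l \<rho>. 0 < l \<longrightarrow> \<rho> \<in> borel_measurable borel \<longrightarrow>
    riesz_energy (\<mu> \<Otimes>\<^sub>M ball_measure) (\<lambda>\<omega>. fst \<omega> + \<rho> (fst \<omega>) *\<^sub>R snd \<omega>) \<gamma> l \<le> ennreal (C' * l powr (- \<gamma>))"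
proof -
  interpret prob_space \<mu> by fact
  interpret pair_prob_space \<mu> "ball_measure :: 'a measure" ..
  interpret sw: pair_sigma_finite "ball_measure :: 'a measure" \<mu> ..
  note [measurable_cong] = \<mu>(2)
  obtain C1 where C1: "0 \<le> C1" "\<And>x l. 0 < l \<Longrightarrow>
      (\<integral>\<^sup>+y. ennreal ((1 + l * norm (y - x)) powr (- \<gamma>)) \<partial>\<mu>) \<le> ennreal (C1 * l powr (- \<gamma>))"
    using frostman_potential_bound[OF \<mu> ball \<gamma>(1)] by blast
  obtain C0 where C0: "0 \<le> C0" "\<And>(x::'a) r l. 0 < l \<Longrightarrow>
      (\<integral>\<^sup>+z. ennreal ((1 + l * norm (x + r *\<^sub>R z)) powr (- \<gamma>)) \<partial>ball_measure) \<le> ennreal (C0 * (1 + l * norm x) powr (- \<gamma>))"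
    using average_kernel_bound[of \<gamma>, where 'a='a] \<gamma> by blast
  have "riesz_energy (\<mu> \<Otimes>\<^sub>M ball_measure) (\<lambda>\<omega>. fst \<omega> + \<rho> (fst \<omega>) *\<^sub>R snd \<omega>) \<gamma> l \<le> ennreal ((C0 * C0 * C1) * l powr (- \<gamma>))"
    if l: "0 < l" and [measurable]: "\<rho> \<in> borel_measurable borel" for l \<rho>
  proof -
    let ?h = "\<lambda>v::'a. ennreal ((1 + l * norm v) powr (- \<gamma>))"
    have h_diff: "?h (a - b) = ?h (b - a)" for a b by (simp add: norm_minus_commute)
    have cmul: "ennreal (C0 * (1 + l * norm v) powr (- \<gamma>)) = ennreal C0 * ?h v" for v :: 'a
      using C0(1) by (simp add: ennreal_mult')
    have inner: "(\<integral>\<^sup>+\<omega>'. ?h (v - (fst \<omega>' + \<rho> (fst \<omega>') *\<^sub>R snd \<omega>')) \<partial>(\<mu> \<Otimes>\<^sub>M ball_measure))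
        \<le> (\<integral>\<^sup>+y. ennreal C0 * ?h (v - y) \<partial>\<mu>)" for v
    proof -
      have "(\<integral>\<^sup>+\<omega>'. ?h (v - (fst \<omega>' + \<rho> (fst \<omega>') *\<^sub>R snd \<omega>')) \<partial>(\<mu> \<Otimes>\<^sub>M ball_measure))
          = (\<integral>\<^sup>+y. \<integral>\<^sup>+z. ?h ((v - y) + (- \<rho> y) *\<^sub>R z) \<partial>ball_measure \<partial>\<mu>)"
        by (subst ball_measure.nn_integral_fst[symmetric]) (auto simp: algebra_simps)
      also have "\<dots> \<le> (\<integral>\<^sup>+y. ennreal C0 * ?h (v - y) \<partial>\<mu>)"
        by (intro nn_integral_mono order_trans[OF C0(2)[OF l]]) (simp add: cmul)
      finally show ?thesis .
    qed
    have "(\<integral>\<^sup>+\<omega>. \<integral>\<^sup>+\<omega>'. ?h ((fst \<omega> + \<rho> (fst \<omega>) *\<^sub>R snd \<omega>) - (fst \<omega>' + \<rho> (fst \<omega>') *\<^sub>R snd \<omega>'))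
        \<partial>(\<mu> \<Otimes>\<^sub>M ball_measure) \<partial>(\<mu> \<Otimes>\<^sub>M ball_measure))
      \<le> (\<integral>\<^sup>+\<omega>. \<integral>\<^sup>+y. ennreal C0 * ?h ((fst \<omega> + \<rho> (fst \<omega>) *\<^sub>R snd \<omega>) - y) \<partial>\<mu> \<partial>(\<mu> \<Otimes>\<^sub>M ball_measure))"
      by (intro nn_integral_mono inner)
    also have "\<dots> = (\<integral>\<^sup>+x. \<integral>\<^sup>+z. \<integral>\<^sup>+y. ennreal C0 * ?h ((x + \<rho> x *\<^sub>R z) - y) \<partial>\<mu> \<partial>ball_measure \<partial>\<mu>)"
      by (subst ball_measure.nn_integral_fst[symmetric]) auto
    \<comment> \<open>Exchanging \<open>y\<close> and \<open>z\<close> fixes both centres first, so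
      the average over \<open>z\<close> is taken with the constant radius \<open>\<rho> x\<close>
      about the displacement \<open>x - y\<close>.\<close>
    also have "\<dots> = (\<integral>\<^sup>+x. \<integral>\<^sup>+y. \<integral>\<^sup>+z. ennreal C0 * ?h ((x - y) + \<rho> x *\<^sub>R z) \<partial>ball_measure \<partial>\<mu> \<partial>\<mu>)"
    proof (intro nn_integral_cong)
      fix x
      have "(\<integral>\<^sup>+z. \<integral>\<^sup>+y. ennreal C0 * ?h ((x + \<rho> x *\<^sub>R z) - y) \<partial>\<mu> \<partial>ball_measure)
         = (\<integral>\<^sup>+y. \<integral>\<^sup>+z. ennreal C0 * ?h ((x + \<rho> x *\<^sub>R z) - y) \<partial>ball_measure \<partial>\<mu>)"
        by (rule Fubini') measurable
      then show "(\<integral>\<^sup>+z. \<integral>\<^sup>+y. ennreal C0 * ?h ((x + \<rho> x *\<^sub>R z) - y) \<partial>\<mu> \<partial>ball_measure)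
         = (\<integral>\<^sup>+y. \<integral>\<^sup>+z. ennreal C0 * ?h ((x - y) + \<rho> x *\<^sub>R z) \<partial>ball_measure \<partial>\<mu>)"
        by (simp add: algebra_simps)
    qed
    also have "\<dots> \<le> (\<integral>\<^sup>+x. \<integral>\<^sup>+y. ennreal (C0 * C0) * ?h (y - x) \<partial>\<mu> \<partial>\<mu>)"
    proof (intro nn_integral_mono)
      fix x y
      have "(\<integral>\<^sup>+z. ennreal C0 * ?h ((x - y) + \<rho> x *\<^sub>R z) \<partial>ball_measure) = ennreal C0 * (\<integral>\<^sup>+z. ?h ((x - y) + \<rho> x *\<^sub>R z) \<partial>ball_measure)"
        by (rule nn_integral_cmult) measurable
      also have "\<dots> \<le> ennreal C0 * (ennreal C0 * ?h (x - y))"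
        using C0(2)[OF l, of "x - y" "\<rho> x"] unfolding cmul by (intro mult_left_mono) auto
      also have "\<dots> = ennreal (C0 * C0) * ?h (y - x)"
        using C0(1) by (simp add: ennreal_mult' mult.assoc h_diff[of x y])
      finally show "(\<integral>\<^sup>+z. ennreal C0 * ?h ((x - y) + \<rho> x *\<^sub>R z) \<partial>ball_measure) \<le> ennreal (C0 * C0) * ?h (y - x)" .
    qed
    also have "\<dots> = (\<integral>\<^sup>+x. ennreal (C0 * C0) * (\<integral>\<^sup>+y. ?h (y - x) \<partial>\<mu>) \<partial>\<mu>)"
      by (intro nn_integral_cong nn_integral_cmult) measurable
    also have "\<dots> \<le> (\<integral>\<^sup>+x. ennreal (C0 * C0) * ennreal (C1 * l powr (- \<gamma>)) \<partial>\<mu>)"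
      by (intro nn_integral_mono mult_left_mono C1(2) l) auto
    also have "\<dots> = ennreal ((C0 * C0 * C1) * l powr (- \<gamma>))"
      using C0(1) prob_space.emeasure_space_1[OF \<mu>(1)] by (simp add: ennreal_mult'[symmetric] mult.assoc)
    finally show ?thesis unfolding riesz_energy_def .
  qed
  moreover have "0 \<le> C0 * C0 * C1" using C0(1) C1(1) by simp
  ultimately show ?thesis by blast
qed

section \<open>The maximal estimate\<close>

text \<open>The substitution \<open>\<xi> = l *\<^sub>R \<eta>\<close> and homogeneity reduce every
  frequency to the unit scale; the power of \<open>l\<close> in the phase is absorbed into the
  time.\<close>

lemma osc_scaled:
  fixes P :: "'a::euclidean_space \<Rightarrow> real"
  assumes P: "smooth_on (- {0}) P"
    and hom: "\<forall>l>0. \<forall>\<xi>. \<xi> \<noteq> 0 \<longrightarrow> P (l *\<^sub>R \<xi>) = l powr k * P \<xi>" and l: "0 < l"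
  shows "(LINT \<xi>|lebesgue. cbump (\<xi> /\<^sub>R l) * echar (x \<bullet> \<xi> + t * P \<xi>))
    = of_real (l ^ DIM('a)) * osc P cbump (l *\<^sub>R x) (l powr k * t)"
proof -
  have [measurable]: "P \<in> borel_measurable borel" "(cbump :: 'a \<Rightarrow> complex) \<in> borel_measurable borel"
    by (intro smooth_on_punctured_measurable P amplitude_measurable amplitude_bump)+
  have eq: "cbump ((l *\<^sub>R \<eta>) /\<^sub>R l) * echar (x \<bullet> (l *\<^sub>R \<eta>) + t * P (l *\<^sub>R \<eta>))
      = cbump \<eta> * echar ((l *\<^sub>R x) \<bullet> \<eta> + (l powr k * t) * P \<eta>)" for \<eta>
  \<comment> \<open>Homogeneity says nothing at the origin, but the bump vanishes there.\<close>
  proof (cases "\<eta> = 0")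
    case True
    have "bump (0::'a) = 0" using bump_support(1)[of "0::'a"] by force
    then show ?thesis using True by simp
  next
    case False
    then show ?thesis using hom l by (simp add: mult_ac)
  qed
  have "(LINT \<xi>|lebesgue. cbump (\<xi> /\<^sub>R l) * echar (x \<bullet> \<xi> + t * P \<xi>)) = (LINT \<xi>|lborel. cbump (\<xi> /\<^sub>R l) * echar (x \<bullet> \<xi> + t * P \<xi>))"
    by (rule integral_completion) measurable
  also have "\<dots> = l ^ DIM('a) *\<^sub>R (LINT \<eta>|lborel. cbump ((l *\<^sub>R \<eta>) /\<^sub>R l) * echar (x \<bullet> (l *\<^sub>R \<eta>) + t * P (l *\<^sub>R \<eta>)))"
    using l by (subst lborel_affine_integral[where t=0 and c=l]) auto
  also have "\<dots> = l ^ DIM('a) *\<^sub>R (LINT \<eta>|lebesgue. cbump \<eta> * echar ((l *\<^sub>R x) \<bullet> \<eta> + (l powr k * t) * P \<eta>))"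
    unfolding eq by (subst integral_completion) auto
  finally show ?thesis by (simp add: osc_eq scaleR_conv_of_real)
qed

text \<open>The functional is paired with \<open>g\<close> on the frequency side, where its dual
  object is the function \<open>W\<close>. Cauchy-Schwarz leaves the L2 norm of \<open>W\<close>
  near the annulus, and expanding its square gives a double integral of the rescaled model kernel at
  differences \<open>X \<omega> - X \<omega>'\<close>, hence the energy.\<close>

lemma TT_star_estimate:
  fixes P :: "'a::euclidean_space \<Rightarrow> real" and M :: "'w measure"
  assumes M: "prob_space M"
    and [measurable]: "X \<in> borel_measurable M" "\<tau> \<in> borel_measurable M" "w \<in> borel_measurable M"
    and w: "\<And>\<omega>. norm (w \<omega>) \<le> 1"
    and P: "smooth_on (- {0}) P"
    and hom: "\<forall>l>0. \<forall>\<xi>. \<xi> \<noteq> 0 \<longrightarrow> P (l *\<^sub>R \<xi>) = l powr k * P \<xi>"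
    and K: "0 \<le> C" "\<And>x t. norm (osc P cbump x t) \<le> C * (1 + norm x) powr (- \<gamma>)"
    and c: "0 < c" "\<And>\<xi>::'a. 1 \<le> norm \<xi> \<and> norm \<xi> \<le> 2 \<Longrightarrow> c \<le> bump \<xi>"
    and l: "0 < l" and g: "L2_fun g" "\<And>\<xi>. g \<xi> \<noteq> 0 \<Longrightarrow> l \<le> norm \<xi> \<and> norm \<xi> \<le> 2 * l"
  shows "ennreal ((norm (LINT \<omega>|M. w \<omega> * osc P g (X \<omega>) (\<tau> \<omega>)))\<^sup>2) \<le> L2sq g * (ennreal (C / c * l ^ DIM('a)) *
    riesz_energy M X \<gamma> l)"
proof -
  interpret M: prob_space M by fact
  interpret MX: pair_sigma_finite M "lebesgue :: 'a measure" ..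
  have [measurable]: "P \<in> borel_measurable borel" "(cbump :: 'a \<Rightarrow> complex) \<in> borel_measurable borel"
    by (intro smooth_on_punctured_measurable P amplitude_measurable amplitude_bump)+
  note [measurable] = L2_funD(1)[OF g(1)]
  define e where "e \<omega> \<xi> = echar (X \<omega> \<bullet> \<xi> + \<tau> \<omega> * P \<xi>)" for \<omega> \<xi>
  define W where "W \<xi> = (LINT \<omega>|M. w \<omega> * e \<omega> \<xi>)" for \<xi>
  define b where "b \<xi> = cbump (\<xi> /\<^sub>R l)" for \<xi> :: 'a
  define A where "A = {\<xi>::'a. l \<le> norm \<xi> \<and> norm \<xi> \<le> 2 * l}"
  have e_meas[measurable]: "case_prod e \<in> borel_measurable (M \<Otimes>\<^sub>M lebesgue)"
    unfolding e_def[abs_def] by measurable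
  have e_norm: "norm (e \<omega> \<xi>) \<le> 1" for \<omega> \<xi> by (simp add: e_def)
  have e_meas2[measurable]: "e \<omega> \<in> borel_measurable borel" for \<omega>
    unfolding e_def[abs_def] by measurable
  have [measurable]: "W \<in> borel_measurable borel"
    unfolding W_def[abs_def] e_def by measurable
  have [measurable]: "b \<in> borel_measurable borel" unfolding b_def[abs_def] by measurable
  have W1: "norm (W \<xi>) \<le> 1" for \<xi>
  proof -
    have "norm (W \<xi>) \<le> (LINT \<omega>|M. norm (w \<omega> * e \<omega> \<xi>))" unfolding W_def by (rule integral_norm_bound)
    also have "\<dots> \<le> 1"
      using w e_norm by (intro M.integral_le_const M.integrable_const_bound[where B=1]) 
        (auto simp: norm_mult e_def[abs_def] intro!: mult_le_one)
    finally show ?thesis .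
  qed
  have w_int: "integrable M w" using w by (intro M.integrable_const_bound[where B=1]) auto
  have g_int: "integrable lebesgue g"
    by (rule L2_bounded_support_integrable[OF g(1), of "2 * l"]) (use g(2) in fastforce)
  have b_L2: "L2_fun b" and b_int: "integrable lebesgue b"
  proof -
    obtain B where B: "\<And>\<xi>. norm (cbump (\<xi>::'a)) \<le> B" using amplitude_bounded[OF amplitude_bump] by blast
    have supp: "b \<xi> = 0" if "3 * l < norm \<xi>" for \<xi>
      using that l bump_support(2)[of "\<xi> /\<^sub>R l"] by (auto simp: b_def field_simps)
    show "L2_fun b" using B supp by (intro L2_fun_of_bounded_support[where R="3 * l" and B=B]) (auto simp: b_def)
    then show "integrable lebesgue b" using supp by (rule L2_bounded_support_integrable)
  qed
  have int_mult: "integrable lebesgue (\<lambda>\<xi>. b \<xi> * u \<xi>)" if [measurable]: "u \<in> borel_measurable borel" and "\<And>\<xi>. norm (u \<xi>) \<le> 1" for u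
  proof (rule Bochner_Integration.integrable_bound[OF b_int])
    show "AE \<xi> in lebesgue. norm (b \<xi> * u \<xi>) \<le> norm (b \<xi>)"
      using that(2) by (auto simp: norm_mult intro!: mult_left_le)
  qed (intro borel_measurable_lebesgue, measurable)
  define T where "T = (LINT \<omega>|M. w \<omega> * osc P g (X \<omega>) (\<tau> \<omega>))"
  have "T = (LINT \<omega>|M. w \<omega> * (LINT \<xi>|lebesgue. g \<xi> * e \<omega> \<xi>))"
    by (simp add: T_def osc_eq e_def)
  also have "\<dots> = (LINT \<xi>|lebesgue. g \<xi> * W \<xi>)"
    unfolding W_def by (rule MX.Fubini_bounded_kernel[OF w_int g_int e_meas e_norm])
  \<comment> \<open>\<open>W\<close> is only bounded in general; restricting it to the annulus that
    contains the support of \<open>g\<close> makes it square integrable.\<close>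
  also have "\<dots> = (LINT \<xi>|lebesgue. g \<xi> * (indicator A \<xi> * W \<xi>))"
    using g(2) by (intro Bochner_Integration.integral_cong) (auto simp: A_def indicator_def)
  finally have T_eq: "T = (LINT \<xi>|lebesgue. g \<xi> * (indicator A \<xi> * W \<xi>))" .
  have A_sets[measurable]: "A \<in> sets borel"
    unfolding A_def by (intro borel_closed closed_Collect_conj closed_Collect_le continuous_intros)
  have AW[measurable]: "(\<lambda>\<xi>. indicator A \<xi> * W \<xi>) \<in> borel_measurable borel" by measurable
  have "ennreal ((norm T)\<^sup>2) \<le> L2sq g * L2sq (\<lambda>\<xi>. indicator A \<xi> * W \<xi>)"
    unfolding T_eq by (rule L2_Cauchy_Schwarz) (auto intro: borel_measurable_lebesgue[OF AW])
  \<comment> \<open>The sharp cutoff is replaced by the smooth one at the cost of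
    \<open>1 / c\<close>, because the decay estimate \<open>K\<close> is available for the kernel of
    the smooth bump.\<close>
  also have "L2sq (\<lambda>\<xi>. indicator A \<xi> * W \<xi>) \<le> ennreal (1 / c) * (\<integral>\<^sup>+\<xi>. ennreal (bump (\<xi> /\<^sub>R l) * (norm (W \<xi>))\<^sup>2) \<partial>lebesgue)"
  proof -
    have [measurable]: "(bump :: 'a \<Rightarrow> real) \<in> borel_measurable borel"
      using bump_smooth by (intro borel_measurable_continuous_onI continuous_at_imp_continuous_on ballI differentiable_imp_continuous_within smooth_onD)
    have "L2sq (\<lambda>\<xi>. indicator A \<xi> * W \<xi>) \<le> (\<integral>\<^sup>+\<xi>. ennreal (1 / c) * ennreal (bump (\<xi> /\<^sub>R l) * (norm (W \<xi>))\<^sup>2) \<partial>lebesgue)"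
      unfolding L2sq_def
    proof (intro nn_integral_mono)
      fix \<xi> :: 'a
      show "ennreal ((norm (indicator A \<xi> * W \<xi>))\<^sup>2) \<le> ennreal (1 / c) * ennreal (bump (\<xi> /\<^sub>R l) * (norm (W \<xi>))\<^sup>2)"
      proof (cases "\<xi> \<in> A")
        case True
        then have "c \<le> bump (\<xi> /\<^sub>R l)" using l by (intro c(2)) (auto simp: A_def field_simps)
        then have "1 * (norm (W \<xi>))\<^sup>2 \<le> (1 / c * bump (\<xi> /\<^sub>R l)) * (norm (W \<xi>))\<^sup>2"
          using c(1) by (intro mult_right_mono) (auto simp: field_simps)
        then show ?thesis using True c(1) by (simp add: ennreal_mult'[symmetric] ennreal_leI)
      qed simp
    qed
    also have "\<dots> = ennreal (1 / c) * (\<integral>\<^sup>+\<xi>. ennreal (bump (\<xi> /\<^sub>R l) * (norm (W \<xi>))\<^sup>2) \<partial>lebesgue)"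
      by (intro nn_integral_cmult borel_measurable_lebesgue) measurable
    finally show ?thesis .
  qed
  also have "(\<integral>\<^sup>+\<xi>. ennreal (bump (\<xi> /\<^sub>R l) * (norm (W \<xi>))\<^sup>2) \<partial>lebesgue)
      \<le> ennreal (C * l ^ DIM('a)) * riesz_energy M X \<gamma> l"
  proof -
    have sq: "b \<xi> * cnj (W \<xi>) * W \<xi> = complex_of_real (bump (\<xi> /\<^sub>R l) * (norm (W \<xi>))\<^sup>2)" for \<xi>
      using complex_norm_square[of "W \<xi>"] by (simp add: b_def mult_ac)
    have bW: "integrable lebesgue (\<lambda>\<xi>. b \<xi> * cnj (W \<xi>))" using W1 by (intro int_mult) auto
    have bWW: "integrable lebesgue (\<lambda>\<xi>. b \<xi> * (cnj (W \<xi>) * W \<xi>))" using W1 by (intro int_mult) (auto simp: norm_mult intro!: mult_le_one)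
    have int: "integrable lebesgue (\<lambda>\<xi>. bump (\<xi> /\<^sub>R l) * (norm (W \<xi>))\<^sup>2)"
      using bWW unfolding mult.assoc[symmetric] sq complex_of_real_integrable_eq .
    have "(\<integral>\<^sup>+\<xi>. ennreal (bump (\<xi> /\<^sub>R l) * (norm (W \<xi>))\<^sup>2) \<partial>lebesgue) = ennreal (LINT \<xi>|lebesgue. bump (\<xi> /\<^sub>R l) * (norm (W \<xi>))\<^sup>2)"
      using int by (intro nn_integral_eq_integral) (auto simp: bump_nonneg)
    also have "(LINT \<xi>|lebesgue. bump (\<xi> /\<^sub>R l) * (norm (W \<xi>))\<^sup>2) = Re (LINT \<xi>|lebesgue. b \<xi> * cnj (W \<xi>) * W \<xi>)"
      unfolding sq by (simp only: integral_complex_of_real Re_complex_of_real)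
    also have "\<dots> \<le> norm (LINT \<xi>|lebesgue. b \<xi> * cnj (W \<xi>) * W \<xi>)" by (rule complex_Re_le_cmod)
    also have "(LINT \<xi>|lebesgue. b \<xi> * cnj (W \<xi>) * W \<xi>) = (LINT \<omega>|M. w \<omega> * (LINT \<xi>|lebesgue. b \<xi> * cnj (W \<xi>) * e \<omega> \<xi>))"
      unfolding W_def[of "_::'a", symmetric]
      using MX.Fubini_bounded_kernel[OF w_int bW e_meas e_norm] unfolding W_def[symmetric] by simp
    also have "ennreal (norm \<dots>) \<le> (\<integral>\<^sup>+\<omega>. ennreal (norm (w \<omega> * (LINT \<xi>|lebesgue. b \<xi> * cnj (W \<xi>) * e \<omega> \<xi>))) \<partial>M)"
      by (rule norm_integral_le_nn)
    also have "\<dots> \<le> (\<integral>\<^sup>+\<omega>. \<integral>\<^sup>+\<omega>'. ennreal (C * l ^ DIM('a)) * ennreal ((1 + l * norm (X \<omega> - X \<omega>')) powr (- \<gamma>)) \<partial>M \<partial>M)"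
    proof (intro nn_integral_mono)
      fix \<omega>
      have cm: "(\<lambda>(\<omega>', \<xi>). cnj (e \<omega>' \<xi>)) \<in> borel_measurable (M \<Otimes>\<^sub>M lebesgue)" by measurable
      have be: "integrable lebesgue (\<lambda>\<xi>. b \<xi> * e \<omega> \<xi>)" using e_norm by (intro int_mult) auto
      have cw: "integrable M (\<lambda>\<omega>. cnj (w \<omega>))" using w_int by simp
      have cW: "cnj (W \<xi>) = (LINT \<omega>'|M. cnj (w \<omega>') * cnj (e \<omega>' \<xi>))" for \<xi>
        using Bochner_Integration.integral_cnj[of M "\<lambda>\<omega>'. w \<omega>' * e \<omega>' \<xi>"] by (simp add: W_def)
      have "(LINT \<xi>|lebesgue. b \<xi> * cnj (W \<xi>) * e \<omega> \<xi>) = (LINT \<xi>|lebesgue. (b \<xi> * e \<omega> \<xi>) * (LINT \<omega>'|M. cnj (w \<omega>') * cnj (e \<omega>' \<xi>)))"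
        unfolding cW[symmetric] by (simp add: mult_ac)
      also have "\<dots> = (LINT \<omega>'|M. cnj (w \<omega>') * (LINT \<xi>|lebesgue. (b \<xi> * e \<omega> \<xi>) * cnj (e \<omega>' \<xi>)))"
        by (rule MX.Fubini_bounded_kernel[OF cw be cm, where B=1, symmetric]) (use e_norm in simp)
      finally have eq: "(LINT \<xi>|lebesgue. b \<xi> * cnj (W \<xi>) * e \<omega> \<xi>) = \<dots>" .
      \<comment> \<open>The product of one character with the conjugate of another depends only on
        differences of positions and times. The time difference is arbitrary, which is why the
        kernel bound must be uniform in time.\<close>
      have kern: "norm (LINT \<xi>|lebesgue. (b \<xi> * e \<omega> \<xi>) * cnj (e \<omega>' \<xi>)) \<le> C * l ^ DIM('a) * (1 + l * norm (X \<omega> - X \<omega>')) powr (- \<gamma>)" for \<omega>'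
      proof -
        have "(LINT \<xi>|lebesgue. (b \<xi> * e \<omega> \<xi>) * cnj (e \<omega>' \<xi>))
            = (LINT \<xi>|lebesgue. cbump (\<xi> /\<^sub>R l) * echar ((X \<omega> - X \<omega>') \<bullet> \<xi> + (\<tau> \<omega> - \<tau> \<omega>') * P \<xi>))"
          by (intro Bochner_Integration.integral_cong)
             (auto simp: b_def e_def mult.assoc inner_diff_left left_diff_distrib algebra_simps simp flip: echar_add)
        also have "norm \<dots> = l ^ DIM('a) * norm (osc P cbump (l *\<^sub>R (X \<omega> - X \<omega>')) (l powr k * (\<tau> \<omega> - \<tau> \<omega>')))"
          unfolding osc_scaled[OF P hom l] using l by (simp add: norm_mult norm_power)
        also have "\<dots> \<le> l ^ DIM('a) * (C * (1 + norm (l *\<^sub>R (X \<omega> - X \<omega>'))) powr (- \<gamma>))"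
          using l by (intro mult_left_mono K(2)) auto
        finally show ?thesis using l by (simp add: mult_ac)
      qed
      have "ennreal (norm (w \<omega> * (LINT \<xi>|lebesgue. b \<xi> * cnj (W \<xi>) * e \<omega> \<xi>))) \<le> ennreal (norm (LINT \<xi>|lebesgue. b \<xi> * cnj (W \<xi>) * e \<omega> \<xi>))"
        using w[of \<omega>] by (intro ennreal_leI) (simp add: norm_mult mult_left_le_one_le)
      also have "\<dots> \<le> (\<integral>\<^sup>+\<omega>'. ennreal (norm (cnj (w \<omega>') * (LINT \<xi>|lebesgue. (b \<xi> * e \<omega> \<xi>) * cnj (e \<omega>' \<xi>)))) \<partial>M)"
        unfolding eq by (rule norm_integral_le_nn)
      also have "\<dots> \<le> (\<integral>\<^sup>+\<omega>'. ennreal (C * l ^ DIM('a)) * ennreal ((1 + l * norm (X \<omega> - X \<omega>')) powr (- \<gamma>)) \<partial>M)"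
      proof (intro nn_integral_mono)
        fix \<omega>'
        have "norm (cnj (w \<omega>') * (LINT \<xi>|lebesgue. (b \<xi> * e \<omega> \<xi>) * cnj (e \<omega>' \<xi>))) \<le> 1 * norm (LINT \<xi>|lebesgue. (b \<xi> * e \<omega> \<xi>) * cnj (e \<omega>' \<xi>))"
          unfolding norm_mult using w[of \<omega>'] by (intro mult_right_mono) auto
        also have "\<dots> \<le> C * l ^ DIM('a) * (1 + l * norm (X \<omega> - X \<omega>')) powr (- \<gamma>)" using kern by simp
        finally show "ennreal (norm (cnj (w \<omega>') * (LINT \<xi>|lebesgue. (b \<xi> * e \<omega> \<xi>) * cnj (e \<omega>' \<xi>)))) \<le> ennreal (C * l ^ DIM('a)) * ennreal ((1 + l * norm (X \<omega> - X \<omega>')) powr (- \<gamma>))"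
          using K(1) l by (simp add: ennreal_mult'[symmetric] ennreal_leI)
      qed
      finally show "ennreal (norm (w \<omega> * (LINT \<xi>|lebesgue. b \<xi> * cnj (W \<xi>) * e \<omega> \<xi>))) \<le> \<dots>" .
    qed
    also have "\<dots> = ennreal (C * l ^ DIM('a)) * riesz_energy M X \<gamma> l"
      by (simp add: nn_integral_cmult riesz_energy_def)
    finally show ?thesis by (simp add: ennreal_leI)
  qed
  finally have "ennreal ((norm T)\<^sup>2) \<le> L2sq g * (ennreal (1 / c) * (ennreal (C * l ^ DIM('a)) *
      riesz_energy M X \<gamma> l))"
    by (simp add: mult_left_mono)
  also have "ennreal (1 / c) * (ennreal (C * l ^ DIM('a)) * I) = ennreal (C / c * l ^ DIM('a)) * I" for I
    using K(1) c(1) l by (simp add: ennreal_mult'[symmetric] mult.assoc[symmetric])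
  finally show ?thesis unfolding T_def .
qed

text \<open>The pair \<open>p\<close> consists of a time and a radius. At radius 0 the value is
  \<open>osc\<close> itself, since \<open>ball_measure\<close> has total mass 1.\<close>

definition avg :: "('a::euclidean_space \<Rightarrow> real) \<Rightarrow> ('a \<Rightarrow> complex) \<Rightarrow> real \<times> real \<Rightarrow> 'a \<Rightarrow> complex" where
  "avg P g p x = (LINT z|ball_measure. osc P g (x + snd p *\<^sub>R z) (fst p))"

lemma osc_borel_measurable [measurable]:
  fixes P :: "'a::euclidean_space \<Rightarrow> real"
  assumes "integrable lebesgue g" "P \<in> borel_measurable borel"
  shows "(\<lambda>(t, x). osc P g x t) \<in> borel_measurable borel"
  by (intro borel_measurable_continuous_onI continuous_on_osc assms)

lemma osc_measurable_compose:
  fixes P :: "'a::euclidean_space \<Rightarrow> real"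
  assumes g: "integrable lebesgue g" "P \<in> borel_measurable borel"
    and [measurable]: "\<tau> \<in> borel_measurable M" "X \<in> borel_measurable M"
  shows "(\<lambda>\<omega>. osc P g (X \<omega>) (\<tau> \<omega>)) \<in> borel_measurable M"
proof -
  have "(\<lambda>\<omega>. (\<tau> \<omega>, X \<omega>)) \<in> borel_measurable M" by measurable
  from measurable_compose[OF this osc_borel_measurable[OF g]] show ?thesis by simp
qed

lemma norm_avg_le:
  assumes "integrable lebesgue g" "P \<in> borel_measurable borel"
  shows "norm (avg P g p x) \<le> (LINT \<xi>|lebesgue. norm (g \<xi>))"
proof -
  have "norm (avg P g p x) \<le> (LINT z|ball_measure. norm (osc P g (x + snd p *\<^sub>R z) (fst p)))"
    unfolding avg_def by (rule integral_norm_bound)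
  also have "\<dots> \<le> (LINT \<xi>|lebesgue. norm (g \<xi>))"
  proof (rule ball_measure.integral_le_const)
    have [measurable]: "(\<lambda>z. osc P g (x + snd p *\<^sub>R z) (fst p)) \<in> borel_measurable ball_measure"
      by (intro osc_measurable_compose assms) auto
    show "integrable ball_measure (\<lambda>z. norm (osc P g (x + snd p *\<^sub>R z) (fst p)))"
      using norm_osc_le[OF assms]
      by (intro ball_measure.integrable_const_bound[where B="LINT \<xi>|lebesgue. norm (g \<xi>)"]) auto
    show "AE z in ball_measure. norm (osc P g (x + snd p *\<^sub>R z) (fst p)) \<le> (LINT \<xi>|lebesgue. norm (g \<xi>))"
      by (intro AE_I2 norm_osc_le assms)
  qed
  finally show ?thesis .
qed

text \<open>Joint continuity makes \<open>avg\<close> measurable along every measurable choice of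
  time and radius, and it reduces suprema over all pairs to a countable dense set.\<close>

lemma continuous_on_avg:
  fixes P :: "'a::euclidean_space \<Rightarrow> real"
  assumes g: "integrable lebesgue g" "P \<in> borel_measurable borel"
  shows "continuous_on UNIV (\<lambda>(p, x). avg P g p x)"
  unfolding continuous_on_eq_continuous_at[OF open_UNIV] continuous_at_sequentially
proof (intro ballI allI impI)
  fix q :: "(real \<times> real) \<times> 'a" and s assume s: "s \<longlonglongrightarrow> q"
  have s1: "(\<lambda>n. fst (s n)) \<longlonglongrightarrow> fst q" and s2: "(\<lambda>n. snd (s n)) \<longlonglongrightarrow> snd q"
    using s by (auto intro: tendsto_intros)
  have "(\<lambda>n. LINT z|ball_measure. osc P g (snd (s n) + snd (fst (s n)) *\<^sub>R z) (fst (fst (s n))))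
      \<longlonglongrightarrow> (LINT z|ball_measure. osc P g (snd q + snd (fst q) *\<^sub>R z) (fst (fst q)))"
  proof (rule integral_dominated_convergence[where w="\<lambda>_. LINT \<xi>|lebesgue. norm (g \<xi>)"])
    show "AE z in ball_measure. (\<lambda>n. osc P g (snd (s n) + snd (fst (s n)) *\<^sub>R z) (fst (fst (s n)))) \<longlonglongrightarrow> osc P g (snd q + snd (fst q) *\<^sub>R z) (fst (fst q))"
    proof (rule AE_I2)
      fix z :: 'a
      have "(\<lambda>n. (fst (fst (s n)), snd (s n) + snd (fst (s n)) *\<^sub>R z)) \<longlonglongrightarrow> (fst (fst q), snd q + snd (fst q) *\<^sub>R z)"
        by (intro tendsto_intros s1 s2)
      moreover have "isCont (\<lambda>(t, x). osc P g x t) (fst (fst q), snd q + snd (fst q) *\<^sub>R z)"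
        using continuous_on_osc[OF g] by (simp add: continuous_on_eq_continuous_at)
      ultimately have "(\<lambda>n. (\<lambda>(t, x). osc P g x t) (fst (fst (s n)), snd (s n) + snd (fst (s n)) *\<^sub>R z))
          \<longlonglongrightarrow> (\<lambda>(t, x). osc P g x t) (fst (fst q), snd q + snd (fst q) *\<^sub>R z)"
        by (rule isCont_tendsto_compose[rotated])
      then show "(\<lambda>n. osc P g (snd (s n) + snd (fst (s n)) *\<^sub>R z) (fst (fst (s n)))) \<longlonglongrightarrow> osc P g (snd q + snd (fst q) *\<^sub>R z) (fst (fst q))" by simp
    qed
    show "AE z in ball_measure. norm (osc P g (snd (s n) + snd (fst (s n)) *\<^sub>R z) (fst (fst (s n)))) \<le> (LINT \<xi>|lebesgue. norm (g \<xi>))" for n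
      by (intro AE_I2 norm_osc_le g)
  qed (auto intro!: osc_measurable_compose g)
  then show "((\<lambda>(p, x). avg P g p x) \<circ> s) \<longlonglongrightarrow> (case q of (p, x) \<Rightarrow> avg P g p x)"
    by (simp add: avg_def o_def split_beta)
qed

lemma avg_measurable_compose:
  fixes P :: "'a::euclidean_space \<Rightarrow> real"
  assumes g: "integrable lebesgue g" "P \<in> borel_measurable borel"
    and [measurable]: "p \<in> borel_measurable M" "X \<in> borel_measurable M"
  shows "(\<lambda>\<omega>. avg P g (p \<omega>) (X \<omega>)) \<in> borel_measurable M"
proof -
  have 1: "(\<lambda>\<omega>. (p \<omega>, X \<omega>)) \<in> borel_measurable M" by measurable
  have 2: "(\<lambda>(p, x). avg P g p x) \<in> borel_measurable borel"
    by (intro borel_measurable_continuous_onI continuous_on_avg g)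
  from measurable_compose[OF 1 2] show ?thesis by simp
qed

text \<open>Time and radius are arbitrary measurable functions of the point, which stands in for a
  supremum. The averaging variable becomes the second factor of the probability space, and a bounded
  weight removes the absolute value, so \<open>TT_star_estimate\<close> applies.\<close>

lemma linearized_maximal_estimate:
  fixes P :: "'a::euclidean_space \<Rightarrow> real"
  assumes \<mu>: "prob_space \<mu>" "sets \<mu> = sets borel"
    and energy: "\<And>l \<rho>. 0 < l \<Longrightarrow> \<rho> \<in> borel_measurable borel \<Longrightarrow>
      riesz_energy (\<mu> \<Otimes>\<^sub>M ball_measure) (\<lambda>\<omega>. fst \<omega> + \<rho> (fst \<omega>) *\<^sub>R snd \<omega>) \<gamma> l \<le> ennreal (C' * l powr (- \<gamma>))"
    and C': "0 \<le> C'"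
    and P: "smooth_on (- {0}) P"
    and hom: "\<forall>l>0. \<forall>\<xi>. \<xi> \<noteq> 0 \<longrightarrow> P (l *\<^sub>R \<xi>) = l powr k * P \<xi>"
    and K: "0 \<le> C" "\<And>x t. norm (osc P cbump x t) \<le> C * (1 + norm x) powr (- \<gamma>)"
    and c: "0 < c" "\<And>\<xi>::'a. 1 \<le> norm \<xi> \<and> norm \<xi> \<le> 2 \<Longrightarrow> c \<le> bump \<xi>"
    and l: "0 < l" and g: "L2_fun g" "\<And>\<xi>. g \<xi> \<noteq> 0 \<Longrightarrow> l \<le> norm \<xi> \<and> norm \<xi> \<le> 2 * l"
    and p: "p \<in> borel_measurable borel"
  shows "(\<integral>\<^sup>+x. ennreal (norm (avg P g (p x) x)) \<partial>\<mu>)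
    \<le> ennreal (sqrt (enn2real (L2sq g) * (C * C' / c * l powr (real DIM('a) - \<gamma>))))"
proof -
  interpret prob_space \<mu> by fact
  interpret pp: pair_prob_space \<mu> "ball_measure :: 'a measure" ..
  note [measurable_cong] = \<mu>(2)
  note [measurable] = p
  note Pm = smooth_on_punctured_measurable[OF P]
  have g_int: "integrable lebesgue g"
    by (rule L2_bounded_support_integrable[OF g(1), of "2 * l"]) (use g(2) in fastforce)
  let ?M = "\<mu> \<Otimes>\<^sub>M (ball_measure :: 'a measure)"
  define F where "F x = avg P g (p x) x" for x
  have Fm: "F \<in> borel_measurable borel" unfolding F_def[abs_def] by (intro avg_measurable_compose g_int Pm p) simp
  \<comment> \<open>The conjugate phase of \<open>F x\<close>; where \<open>F x = 0\<close> it is 0,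
    and the identity \<open>uF\<close> still holds.\<close>
  define u where "u x = cnj (sgn (F x))" for x
  have [measurable]: "u \<in> borel_measurable borel" using Fm unfolding u_def[abs_def] by measurable
  have u1: "norm (u x) \<le> 1" for x by (simp add: u_def norm_sgn)
  have uF: "u x * F x = complex_of_real (norm (F x))" for x
    using complex_norm_square[of "F x"]
    by (cases "F x = 0") (auto simp: u_def sgn_div_norm scaleR_conv_of_real power2_eq_square field_simps)
  define X where "X \<omega> = fst \<omega> + snd (p (fst \<omega>)) *\<^sub>R snd \<omega>" for \<omega> :: "'a \<times> 'a"
  define \<tau> where "\<tau> \<omega> = fst (p (fst \<omega>))" for \<omega> :: "'a \<times> 'a"
  have [measurable]: "(\<lambda>x. fst (p x)) \<in> borel_measurable borel" "(\<lambda>x. snd (p x)) \<in> borel_measurable borel"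
    by (intro measurable_compose[OF p] borel_measurable_continuous_onI continuous_intros)+
  have Xm[measurable]: "X \<in> borel_measurable ?M" unfolding X_def[abs_def] by measurable
  have \<tau>m[measurable]: "\<tau> \<in> borel_measurable ?M" unfolding \<tau>_def[abs_def] by measurable
  have om[measurable]: "(\<lambda>\<omega>. osc P g (X \<omega>) (\<tau> \<omega>)) \<in> borel_measurable ?M"
    by (intro osc_measurable_compose g_int Pm Xm \<tau>m)
  have um[measurable]: "(\<lambda>\<omega>. u (fst \<omega>)) \<in> borel_measurable ?M" by measurable
  have int: "integrable ?M (\<lambda>\<omega>. u (fst \<omega>) * osc P g (X \<omega>) (\<tau> \<omega>))"
  proof (rule pp.P.integrable_const_bound[where B="1 * (LINT \<xi>|lebesgue. norm (g \<xi>))"])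
    show "AE \<omega> in ?M. norm (u (fst \<omega>) * osc P g (X \<omega>) (\<tau> \<omega>)) \<le> 1 * (LINT \<xi>|lebesgue. norm (g \<xi>))"
      unfolding norm_mult by (intro AE_I2 mult_mono u1 norm_osc_le g_int Pm) auto
  qed measurable
  have F_bound: "norm (F x) \<le> (LINT \<xi>|lebesgue. norm (g \<xi>))" for x
    unfolding F_def by (rule norm_avg_le[OF g_int Pm])
  have F_int: "integrable \<mu> (\<lambda>x. norm (F x))"
    using Fm F_bound by (intro integrable_const_bound[where B="LINT \<xi>|lebesgue. norm (g \<xi>)"]) auto
  have "(LINT \<omega>|?M. u (fst \<omega>) * osc P g (X \<omega>) (\<tau> \<omega>)) = (LINT x|\<mu>. LINT z|ball_measure. u x * osc P g (x + snd (p x) *\<^sub>R z) (fst (p x)))"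
    using pp.integral_fst'[OF int] by (simp add: X_def \<tau>_def)
  also have "\<dots> = (LINT x|\<mu>. u x * F x)"
    by (simp add: F_def avg_def)
  also have "\<dots> = complex_of_real (LINT x|\<mu>. norm (F x))"
    unfolding uF by (rule integral_complex_of_real)
  finally have I: "norm (LINT \<omega>|?M. u (fst \<omega>) * osc P g (X \<omega>) (\<tau> \<omega>)) = (LINT x|\<mu>. norm (F x))"
    by (simp add: integral_nonneg_AE)
  have fin: "L2sq g = ennreal (enn2real (L2sq g))"
    using g(1) by (simp add: L2_fun_iff less_top)
  have "ennreal ((LINT x|\<mu>. norm (F x))\<^sup>2) \<le> L2sq g * (ennreal (C / c * l ^ DIM('a)) *
    riesz_energy ?M X \<gamma> l)"
    unfolding I[symmetric]
    by (rule TT_star_estimate[OF pp.P.prob_space_axioms Xm \<tau>m um u1 P hom K c l g])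
  also have "\<dots> \<le> L2sq g * (ennreal (C / c * l ^ DIM('a)) * ennreal (C' * l powr (- \<gamma>)))"
    unfolding X_def[abs_def] by (intro mult_left_mono energy l) auto
  also have "\<dots> = ennreal (enn2real (L2sq g) * (C / c * l ^ DIM('a) * (C' * l powr (- \<gamma>))))"
    using K(1) c(1) l C' by (subst fin) (simp add: ennreal_mult'[symmetric])
  also have "C / c * l ^ DIM('a) * (C' * l powr (- \<gamma>)) = C * C' / c * l powr (real DIM('a) - \<gamma>)"
    using l by (simp add: powr_diff powr_minus powr_realpow field_simps)
  finally have "(LINT x|\<mu>. norm (F x))\<^sup>2 \<le> enn2real (L2sq g) * (C * C' / c * l powr (real DIM('a) - \<gamma>))"
    using K(1) c(1) C' by (subst (asm) ennreal_le_iff) auto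
  then have "(LINT x|\<mu>. norm (F x)) \<le> sqrt (enn2real (L2sq g) * (C * C' / c * l powr (real DIM('a) - \<gamma>)))"
    by (rule real_le_rsqrt)
  then show ?thesis
    using F_int unfolding F_def by (subst nn_integral_eq_integral) (auto intro: ennreal_leI)
qed

text \<open>A maximising index is updated one candidate at a time, which keeps the choice
  measurable.\<close>

lemma measurable_argmax:
  fixes F :: "nat \<Rightarrow> 'a \<Rightarrow> real"
  assumes [measurable]: "\<And>i. F i \<in> borel_measurable M"
  shows "\<exists>j. j \<in> measurable M (count_space UNIV) \<and> (\<forall>x. \<forall>i\<le>m. F i x \<le> F (j x) x)"
proof (induction m)
  case 0
  show ?case by (intro exI[of _ "\<lambda>_. 0"]) auto
next
  case (Suc m)
  then obtain j where j[measurable]: "j \<in> measurable M (count_space UNIV)" and jm: "\<And>x i. i \<le> m \<Longrightarrow> F i x \<le> F (j x) x" by blast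
  have [measurable]: "(\<lambda>x. F (j x) x) \<in> borel_measurable M"
    by (rule measurable_compose_countable) auto
  show ?case
  proof (intro exI conjI allI impI)
    show "(\<lambda>x. if F (j x) x < F (Suc m) x then Suc m else j x) \<in> measurable M (count_space UNIV)" by measurable
    fix x i assume "i \<le> Suc m"
    then consider "i \<le> m" | "i = Suc m" by linarith
    then show "F i x \<le> F (if F (j x) x < F (Suc m) x then Suc m else j x) x"
      using jm[of i x] by cases auto
  qed
qed

text \<open>Undoes the linearisation. A maximum over finitely many parameters is attained along a
  measurable choice, monotone convergence passes to a dense sequence, and continuity passes to all
  parameters. The resulting majorant is measurable although the supremum is over an uncountable
  set.\<close>

lemma maximal_estimate:
  fixes A :: "real \<times> real \<Rightarrow> 'a::euclidean_space \<Rightarrow> complex" and \<mu> :: "'a measure"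
  assumes \<mu>: "sets \<mu> = sets borel" and cont: "continuous_on UNIV (\<lambda>(p, x). A p x)"
    and lin: "\<And>p. p \<in> borel_measurable borel \<Longrightarrow> (\<integral>\<^sup>+x. ennreal (norm (A (p x) x)) \<partial>\<mu>) \<le> B"
  shows "\<exists>S. S \<in> borel_measurable \<mu> \<and> (\<forall>p x. ennreal (norm (A p x)) \<le> S x) \<and> (\<integral>\<^sup>+x. S x \<partial>\<mu>) \<le> B"
proof -
  note [measurable_cong] = \<mu>
  obtain D :: "(real \<times> real) set" where D: "countable D" "\<And>T. open T \<Longrightarrow> T \<noteq> {} \<Longrightarrow> \<exists>d\<in>D. d \<in> T"
    using countable_dense_setE by blast
  then have "D \<noteq> {}" using D(2)[of UNIV] by auto
  define q where "q = from_nat_into D"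
  have q: "range q = D" using D(1) \<open>D \<noteq> {}\<close> by (simp add: q_def range_from_nat_into)
  have Am: "A p \<in> borel_measurable borel" for p
  proof -
    have "continuous_on UNIV (\<lambda>x. (\<lambda>(p, x). A p x) (p, x))"
      by (rule continuous_on_compose2[OF cont]) (auto intro!: continuous_intros)
    then show ?thesis by (intro borel_measurable_continuous_onI) simp
  qed
  define S where "S x = (SUP i. ennreal (norm (A (q i) x)))" for x
  have [measurable]: "S \<in> borel_measurable borel" unfolding S_def[abs_def] using Am by measurable
  have "(\<integral>\<^sup>+x. S x \<partial>\<mu>) = (\<integral>\<^sup>+x. (SUP m. Max ((\<lambda>i. ennreal (norm (A (q i) x))) ` {..m})) \<partial>\<mu>)"
  proof (rule nn_integral_cong)
    fix x
    show "S x = (SUP m. Max ((\<lambda>i. ennreal (norm (A (q i) x))) ` {..m}))"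
      unfolding S_def
    proof (rule antisym)
      show "(SUP i. ennreal (norm (A (q i) x))) \<le> (SUP m. Max ((\<lambda>i. ennreal (norm (A (q i) x))) ` {..m}))"
        by (rule SUP_mono) (auto intro!: exI Max_ge)
      show "(SUP m. Max ((\<lambda>i. ennreal (norm (A (q i) x))) ` {..m})) \<le> (SUP i. ennreal (norm (A (q i) x)))"
        by (rule SUP_least) (auto intro!: SUP_upper simp: Max_le_iff)
    qed
  qed
  also have "\<dots> = (SUP m. \<integral>\<^sup>+x. Max ((\<lambda>i. ennreal (norm (A (q i) x))) ` {..m}) \<partial>\<mu>)"
  proof (rule nn_integral_monotone_convergence_SUP)
    show "incseq (\<lambda>m x. Max ((\<lambda>i. ennreal (norm (A (q i) x))) ` {..m}))"
      by (auto simp: incseq_def le_fun_def intro!: Max_mono)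
    show "(\<lambda>x. Max ((\<lambda>i. ennreal (norm (A (q i) x))) ` {..m})) \<in> borel_measurable \<mu>" for m
      using Am by (intro borel_measurable_Max) auto
  qed
  also have "\<dots> \<le> B"
  proof (rule SUP_least)
    fix m :: nat
    have "\<exists>j. j \<in> measurable borel (count_space UNIV) \<and> (\<forall>x. \<forall>i\<le>m. norm (A (q i) x) \<le> norm (A (q (j x)) x))"
      using Am by (intro measurable_argmax) auto
    then obtain j where j: "j \<in> measurable borel (count_space UNIV)" "\<And>x i. i \<le> m \<Longrightarrow> norm (A (q i) x) \<le> norm (A (q (j x)) x)" by blast
    have "(\<lambda>x. q (j x)) \<in> borel_measurable borel" by (rule measurable_compose[OF j(1)]) simp
    then have "(\<integral>\<^sup>+x. ennreal (norm (A (q (j x)) x)) \<partial>\<mu>) \<le> B" by (rule lin)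
    moreover have "(\<integral>\<^sup>+x. Max ((\<lambda>i. ennreal (norm (A (q i) x))) ` {..m}) \<partial>\<mu>) \<le> (\<integral>\<^sup>+x. ennreal (norm (A (q (j x)) x)) \<partial>\<mu>)"
      using j(2) by (intro nn_integral_mono) (auto simp: ennreal_leI)
    ultimately show "(\<integral>\<^sup>+x. Max ((\<lambda>i. ennreal (norm (A (q i) x))) ` {..m}) \<partial>\<mu>) \<le> B" by simp
  qed
  finally have int: "(\<integral>\<^sup>+x. S x \<partial>\<mu>) \<le> B" .
  \<comment> \<open>A strict violation at \<open>p\<close> is an open condition in the parameter, so
    it would also occur at a member of the dense set.\<close>
  have "ennreal (norm (A p x)) \<le> S x" for p x
  proof (rule ccontr)
    assume "\<not> ennreal (norm (A p x)) \<le> S x"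
    then have lt: "S x < ennreal (norm (A p x))" by (simp add: not_le)
    then obtain s where s: "S x = ennreal s" "0 \<le> s" by (cases "S x") auto
    have contx: "continuous_on UNIV (\<lambda>p. norm (A p x))"
    proof -
      have "continuous_on UNIV (\<lambda>p. (\<lambda>(p, x). A p x) (p, x))"
        by (rule continuous_on_compose2[OF cont]) (auto intro!: continuous_intros)
      then show ?thesis by (intro continuous_on_norm) simp
    qed
    have "open {p. s < norm (A p x)}" using contx by (intro open_Collect_less) auto
    moreover have "p \<in> {p. s < norm (A p x)}" using lt s by (simp add: ennreal_less_iff)
    ultimately obtain d where d: "d \<in> D" "s < norm (A d x)" using D(2)[of "{p. s < norm (A p x)}"] by blast
    then obtain i where "d = q i" using q by auto
    then have "ennreal (norm (A d x)) \<le> S x" unfolding S_def by (auto intro: SUP_upper)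
    then show False using d s by (simp add: ennreal_le_iff)
  qed
  then show ?thesis using int by (intro exI[of _ S]) auto
qed

section \<open>Pointwise convergence\<close>

text \<open>Index 0 collects the low frequencies, which the annular amplitudes do not reach. The
  shift by one makes shell \<open>Suc j\<close> the one at scale \<open>2 ^ j\<close>, and the
  half-open shells add up exactly to the truncation at \<open>2 ^ J\<close>.\<close>

primrec dyadic_shell :: "nat \<Rightarrow> 'a::euclidean_space set" where
  "dyadic_shell 0 = cball 0 1"
| "dyadic_shell (Suc j) = cball 0 (2 * 2 ^ j) - cball 0 (2 ^ j)"

definition dyadic_piece :: "('a::euclidean_space \<Rightarrow> complex) \<Rightarrow> nat \<Rightarrow> 'a \<Rightarrow> complex" where
  "dyadic_piece F j \<xi> = indicator (dyadic_shell j) \<xi> *\<^sub>R F \<xi>"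

lemma sets_dyadic_shell [measurable]: "dyadic_shell j \<in> sets lebesgue"
  by (cases j) auto

lemma dyadic_shell_subset: "dyadic_shell j \<subseteq> cball 0 (2 ^ j)"
  by (cases j) auto

lemma dyadic_piece_L2:
  assumes "L2_fun F" shows "L2_fun (dyadic_piece F j)"
proof (rule L2_fun_mono[OF assms])
  have [measurable]: "F \<in> borel_measurable lebesgue" using assms by (rule L2_funD)
  show "dyadic_piece F j \<in> borel_measurable lebesgue" unfolding dyadic_piece_def[abs_def] by measurable
qed (auto simp: dyadic_piece_def indicator_def)

lemma dyadic_piece_integrable:
  fixes F :: "'a::euclidean_space \<Rightarrow> complex"
  assumes "L2_fun F" shows "integrable lebesgue (dyadic_piece F j)"
proof (rule L2_bounded_support_integrable[OF dyadic_piece_L2[OF assms]])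
  show "dyadic_piece F j x = 0" if "2 ^ j < norm x" for x
    using that dyadic_shell_subset[of j, where 'a='a] by (auto simp: dyadic_piece_def indicator_def)
qed

lemma sum_dyadic_piece: "(\<Sum>j\<le>J. dyadic_piece F j \<xi>) = trunc (2 ^ J) F \<xi>"
proof (induction J)
  case 0
  show ?case by (simp add: dyadic_piece_def trunc_def)
next
  case (Suc J)
  have "(2::real) ^ J \<le> 2 * 2 ^ J" by simp
  then have "norm \<xi> \<le> 2 * 2 ^ J" if "norm \<xi> \<le> 2 ^ J" using that by linarith
  then show ?case using Suc by (auto simp: dyadic_piece_def trunc_def indicator_def)
qed

lemma dyadic_piece_support: "dyadic_piece F (Suc j) \<xi> \<noteq> 0 \<Longrightarrow> 2 ^ j \<le> norm \<xi> \<and> norm \<xi> \<le> 2 * 2 ^ j"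
  by (auto simp: dyadic_piece_def indicator_def split: if_splits)

lemma dyadic_piece_sobolev:
  fixes F :: "'a::euclidean_space \<Rightarrow> complex"
  assumes s: "0 \<le> s"
    and F: "L2_fun F" "L2_fun (\<lambda>\<xi>. (1 + (norm \<xi>)\<^sup>2) powr (s / 2) *\<^sub>R F \<xi>)"
  shows "L2sq (dyadic_piece F (Suc j)) \<le> ennreal ((2 ^ j) powr (- 2 * s)) * L2sq (\<lambda>\<xi>. (1 + (norm \<xi>)\<^sup>2) powr (s / 2) *\<^sub>R F \<xi>)"
proof -
  let ?w = "\<lambda>\<xi>. (1 + (norm \<xi>)\<^sup>2) powr (s / 2) *\<^sub>R F \<xi>"
  have [measurable]: "?w \<in> borel_measurable lebesgue" using F(2) by (rule L2_funD)
  have "L2sq (dyadic_piece F (Suc j)) \<le> (\<integral>\<^sup>+\<xi>. ennreal ((2 ^ j) powr (- 2 * s)) * ennreal ((norm (?w \<xi>))\<^sup>2) \<partial>lebesgue)"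
    unfolding L2sq_def
  proof (intro nn_integral_mono)
    fix \<xi> :: 'a
    have "(norm (dyadic_piece F (Suc j) \<xi>))\<^sup>2 \<le> (2 ^ j) powr (- 2 * s) * (norm (?w \<xi>))\<^sup>2"
    proof (cases "\<xi> \<in> dyadic_shell (Suc j)")
      case True
      then have gt: "2 ^ j \<le> norm \<xi>" by auto
      have "(2 ^ j) powr (2 * s) = ((2 ^ j)\<^sup>2) powr s"
        by (simp add: powr_powr flip: powr_numeral)
      also have "\<dots> \<le> (1 + (norm \<xi>)\<^sup>2) powr s"
      proof (rule powr_mono2[OF s])
        have "(2 ^ j)\<^sup>2 \<le> (norm \<xi>)\<^sup>2" using gt by (intro power_mono) auto
        then show "(2 ^ j)\<^sup>2 \<le> 1 + (norm \<xi>)\<^sup>2" by (rule add_increasing[OF zero_le_one])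
      qed simp
      also have "\<dots> = ((1 + (norm \<xi>)\<^sup>2) powr (s / 2))\<^sup>2"
        by (simp add: power2_eq_square flip: powr_add)
      finally have "(2 ^ j) powr (2 * s) * (norm (F \<xi>))\<^sup>2 \<le> (norm (?w \<xi>))\<^sup>2"
        by (simp add: power_mult_distrib mult_right_mono)
      then have "(2 ^ j) powr (- 2 * s) * ((2 ^ j) powr (2 * s) * (norm (F \<xi>))\<^sup>2) \<le> (2 ^ j) powr (- 2 * s) * (norm (?w \<xi>))\<^sup>2"
        by (intro mult_left_mono) auto
      moreover have "(2 ^ j) powr (- 2 * s) * (2 ^ j) powr (2 * s) = (1::real)"
        by (simp flip: powr_add)
      ultimately have "(norm (F \<xi>))\<^sup>2 \<le> (2 ^ j) powr (- 2 * s) * (norm (?w \<xi>))\<^sup>2"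
        by (simp only: mult.assoc[symmetric] mult_1)
      then show ?thesis using True by (simp add: dyadic_piece_def del: dyadic_shell.simps)
    qed (simp add: dyadic_piece_def)
    then show "ennreal ((norm (dyadic_piece F (Suc j) \<xi>))\<^sup>2) \<le> ennreal ((2 ^ j) powr (- 2 * s)) * ennreal ((norm (?w \<xi>))\<^sup>2)"
      by (simp add: ennreal_mult'[symmetric] ennreal_leI)
  qed
  also have "\<dots> = ennreal ((2 ^ j) powr (- 2 * s)) * L2sq ?w"
    unfolding L2sq_def by (rule nn_integral_cmult) measurable
  finally show ?thesis .
qed

lemma ifourier_trunc_evolved:
  assumes F: "L2_fun F" and P: "P \<in> borel_measurable borel"
  shows "ifourier (trunc (2 ^ J) (evolved P t F)) x = (\<Sum>j\<le>J. osc P (dyadic_piece F j) x t)"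
proof -
  have "ifourier (trunc (2 ^ J) (evolved P t F)) x = (LINT \<xi>|lebesgue. (\<Sum>j\<le>J. dyadic_piece F j \<xi> * echar (x \<bullet> \<xi> + t * P \<xi>)))"
    unfolding ifourier_def
    by (intro Bochner_Integration.integral_cong)
       (auto simp: sum_dyadic_piece trunc_def evolved_def echar_add scaleR_conv_of_real mult_ac simp flip: sum_distrib_left sum_distrib_right)
  also have "\<dots> = (\<Sum>j\<le>J. osc P (dyadic_piece F j) x t)"
    unfolding osc_eq by (intro Bochner_Integration.integral_sum osc_integrable dyadic_piece_integrable F P)
  finally show ?thesis .
qed

lemma ball_average_trunc:
  fixes F :: "'a::euclidean_space \<Rightarrow> complex"
  assumes F: "L2_fun F" and P: "P \<in> borel_measurable borel" and r: "0 < r"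
  shows "(LINT y:ball x r|lebesgue. ifourier (trunc (2 ^ J) (evolved P t F)) y) /\<^sub>R measure lebesgue (ball x r)
    = (\<Sum>j\<le>J. avg P (dyadic_piece F j) (t, r) x)"
proof -
  note d = dyadic_piece_integrable[OF F]
  have "ifourier (trunc (2 ^ J) (evolved P t F)) \<in> borel_measurable borel"
    by (intro ifourier_measurable trunc_measurable L2_funD evolved_L2 F P)
  then have "(LINT y:ball x r|lebesgue. ifourier (trunc (2 ^ J) (evolved P t F)) y) /\<^sub>R measure lebesgue (ball x r)
     = (LINT z|ball_measure. (\<Sum>j\<le>J. osc P (dyadic_piece F j) (x + r *\<^sub>R z) t))"
    using r by (subst ball_average_eq) (auto simp: ifourier_trunc_evolved[OF F P])
  also have "\<dots> = (\<Sum>j\<le>J. LINT z|ball_measure. osc P (dyadic_piece F j) (x + r *\<^sub>R z) t)"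
  proof (rule Bochner_Integration.integral_sum)
    fix j
    show "integrable ball_measure (\<lambda>z. osc P (dyadic_piece F j) (x + r *\<^sub>R z) t)"
      by (intro ball_measure.integrable_const_bound[where B="LINT \<xi>|lebesgue. norm (dyadic_piece F j \<xi>)"] osc_measurable_compose
          AE_I2 norm_osc_le d P) auto
  qed
  finally show ?thesis by (simp add: avg_def)
qed

text \<open>Where the maximal functions are summable, the dyadic series converges uniformly in \<open>t\<close> and in the
  radius, and its value at radius \<open>0\<close> is the pointwise value.\<close>

lemma pointwise_convergence_if_summable:
  fixes f :: "'a::euclidean_space \<Rightarrow> complex"
  assumes f: "L2_fun f" and P: "P \<in> borel_measurable borel"
    and bound: "\<And>j p. norm (avg P (dyadic_piece (fourier_L2 f) j) p x) \<le> m j" and m: "summable m"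
  shows "\<exists>v u. has_value_at f x v \<and> (\<forall>t. has_value_at (propagator P t f) x (u t)) \<and> (u \<longlongrightarrow> v) (at 0)"
proof -
  let ?F = "fourier_L2 f"
  note F = fourier_L2_L2[OF f]
  define h where "h j p = avg P (dyadic_piece ?F j) p x" for j p
  define H where "H p = (\<Sum>j. h j p)" for p
  have h_cont: "continuous_on UNIV (h j)" for j
  proof -
    have "continuous_on UNIV (\<lambda>p. (\<lambda>(p, x). avg P (dyadic_piece ?F j) p x) (p, x))"
      by (rule continuous_on_compose2[OF continuous_on_avg[OF dyadic_piece_integrable[OF F] P]]) (auto intro!: continuous_intros)
    then show ?thesis by (simp add: h_def[abs_def])
  qed
  have "uniform_limit UNIV (\<lambda>n p. \<Sum>j<n. h j p) H sequentially"
    unfolding H_def[abs_def] by (rule Weierstrass_m_test[OF _ m]) (use bound in \<open>simp add: h_def\<close>)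
  then have H_cont: "continuous_on UNIV H"
    by (rule uniform_limit_theorem[rotated]) (auto intro!: always_eventually continuous_on_sum h_cont)
  have h_sums: "(\<lambda>J. \<Sum>j\<le>J. h j p) \<longlonglongrightarrow> H p" for p
  proof -
    have "summable (\<lambda>j. h j p)"
      by (rule summable_comparison_test'[OF m]) (use bound in \<open>simp add: h_def\<close>)
    then show ?thesis unfolding H_def by (rule summable_LIMSEQ')
  qed
  have radii: "filterlim (\<lambda>J. 2 ^ J :: real) at_top sequentially"
    by (rule filterlim_at_top_mono[OF filterlim_real_sequentially])
       (auto intro!: always_eventually less_imp_le of_nat_less_two_power)
  \<comment> \<open>One identity serves both functions: \<open>I\<close> will be the ball integral
    of \<open>f\<close>, with \<open>t = 0\<close>, and that of \<open>propagator P t f\<close>. It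
    holds exactly for every positive radius, so the limit in \<open>r\<close> concerns
    \<open>H\<close> alone.\<close>
  have avg_eq: "I r /\<^sub>R measure lebesgue (ball x r) = H (t, r)"
    if r: "0 < r" and I: "((\<lambda>R. LINT y:ball x r|lebesgue. ifourier (trunc R (evolved P t ?F)) y) \<longlongrightarrow> I r) at_top" for I r t
  proof (rule LIMSEQ_unique)
    have "(\<lambda>J. (LINT y:ball x r|lebesgue. ifourier (trunc (2 ^ J) (evolved P t ?F)) y) /\<^sub>R measure lebesgue (ball x r))
        \<longlonglongrightarrow> I r /\<^sub>R measure lebesgue (ball x r)"
      by (intro tendsto_scaleR tendsto_const filterlim_compose[OF I radii])
    then show "(\<lambda>J. \<Sum>j\<le>J. h j (t, r)) \<longlonglongrightarrow> I r /\<^sub>R measure lebesgue (ball x r)"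
      unfolding ball_average_trunc[OF F P r] h_def .
    show "(\<lambda>J. \<Sum>j\<le>J. h j (t, r)) \<longlonglongrightarrow> H (t, r)" by (rule h_sums)
  qed
  have lim: "((\<lambda>r. H (t, r)) \<longlongrightarrow> H (t, 0)) (at_right 0)" for t
  proof -
    have "continuous_on UNIV (\<lambda>r. H (t, r))"
      by (rule continuous_on_compose2[OF H_cont]) (auto intro!: continuous_intros)
    then have "((\<lambda>r. H (t, r)) \<longlongrightarrow> H (t, 0)) (at 0)" by (simp add: continuous_on_def)
    then show ?thesis by (rule filterlim_mono) (auto simp: at_le)
  qed
  have ev: "\<forall>\<^sub>F r in at_right (0::real). 0 < r" by (rule eventually_at_right_less)
  have "has_value_at f x (H (0, 0))"
    unfolding has_value_at_def
  proof (rule Lim_transform_eventually[OF lim])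
    show "\<forall>\<^sub>F r in at_right 0. H (0, r) = (LINT y:ball x r|lebesgue. f y) /\<^sub>R measure lebesgue (ball x r)"
      using ev by eventually_elim (rule avg_eq[symmetric], auto intro: ball_integral_tendsto[OF f])
  qed
  moreover have "has_value_at (propagator P t f) x (H (t, 0))" for t
    unfolding has_value_at_def
  proof (rule Lim_transform_eventually[OF lim])
    show "\<forall>\<^sub>F r in at_right 0. H (t, r) = (LINT y:ball x r|lebesgue. propagator P t f y) /\<^sub>R measure lebesgue (ball x r)"
      using ev by eventually_elim (rule avg_eq[symmetric], auto intro: ball_integral_propagator_tendsto[OF f P])
  qed
  moreover have "((\<lambda>t. H (t, 0)) \<longlongrightarrow> H (0, 0)) (at 0)"
  proof -
    have "continuous_on UNIV (\<lambda>t. H (t, 0))"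
      by (rule continuous_on_compose2[OF H_cont]) (auto intro!: continuous_intros)
    then show ?thesis by (simp add: continuous_on_def)
  qed
  ultimately show ?thesis by (intro exI[of _ "H (0, 0)"] exI[of _ "\<lambda>t. H (t, 0)"]) blast
qed

text \<open>The dyadic maximal functions have majorants whose integrals form a summable sequence.
  Their sum is therefore finite almost everywhere, and a single exceptional set serves all times and
  all radii.\<close>

lemma fractal_pointwise_convergence:
  fixes P :: "'a::euclidean_space \<Rightarrow> real" and \<mu> :: "'a measure"
  assumes P: "smooth_on (- {0}) P"
    and hom: "\<forall>l>0. \<forall>\<xi>. \<xi> \<noteq> 0 \<longrightarrow> P (l *\<^sub>R \<xi>) = l powr k * P \<xi>"
    and decay: "\<forall>\<phi>\<in>schwartz.
      (\<exists>c1 c2. 0 < c1 \<and> c1 < c2 \<and> (\<forall>\<xi>. fourier \<phi> \<xi> \<noteq> 0 \<longrightarrow> c1 \<le> norm \<xi> \<and> norm \<xi> \<le> c2)) \<longrightarrow>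
      (\<exists>C. \<forall>t. t \<noteq> 0 \<longrightarrow> Linf_norm (propagator P t \<phi>) \<le> ereal (C * \<bar>t\<bar> powr (- \<beta>)))"
    and \<alpha>: "0 \<le> \<alpha>" "\<alpha> \<le> real DIM('a)" "\<alpha> < \<beta>"
    and s: "(real DIM('a) - \<alpha>) / 2 < s"
    and \<mu>: "\<mu> \<in> frostman_measures \<alpha>"
    and f: "f \<in> sobolev s"
  shows "AE x in \<mu>. \<exists>v u. has_value_at f x v \<and> (\<forall>t. has_value_at (propagator P t f) x (u t)) \<and> (u \<longlongrightarrow> v) (at 0)"
proof -
  let ?n = "real DIM('a)"
  note Pm = smooth_on_punctured_measurable[OF P]
  obtain \<gamma> where \<gamma>: "\<gamma> = 0 \<or> 0 < \<gamma> \<and> \<gamma> < \<alpha>" "\<gamma> = 0 \<or> \<gamma> < ?n" "0 \<le> \<gamma>" "\<gamma> < \<beta>" "(?n - \<gamma>) / 2 < s" "\<gamma> \<le> ?n"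
  proof (cases "\<alpha> = 0")
    case True
    then show ?thesis using that[of 0] \<alpha> s by auto
  next
    case False
    \<comment> \<open>The assumption on \<open>s\<close> says exactly that
      \<open>?n - 2 * s < \<alpha>\<close>, so there is room for \<gamma> strictly below \<alpha>
      with \<open>(?n - \<gamma>) / 2 < s\<close>.\<close>
    then have "max 0 (?n - 2 * s) < \<alpha>" using \<alpha>(1) s by auto
    then obtain \<gamma> where "max 0 (?n - 2 * s) < \<gamma>" "\<gamma> < \<alpha>" using dense by blast
    then show ?thesis using that[of \<gamma>] \<alpha> by auto
  qed
  have "0 \<le> (?n - \<gamma>) / 2" using \<gamma>(6) by simp
  then have s0: "0 < s" using \<gamma>(5) by (rule le_less_trans)
  have \<mu>p: "prob_space \<mu>" and \<mu>s: "sets \<mu> = sets borel" using \<mu> by (auto simp: frostman_measures_def)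
  note [measurable_cong] = \<mu>s
  interpret prob_space \<mu> by (rule \<mu>p)
  obtain C0 where C0: "\<And>x r. 0 < r \<Longrightarrow> measure \<mu> (ball x r) \<le> C0 * r powr \<alpha>"
    using \<mu> unfolding frostman_measures_def by blast
  obtain C where C: "0 \<le> C" "\<And>x t. norm (osc P cbump x t) \<le> C * (1 + norm x) powr (- \<gamma>)"
    using dispersive_kernel_bound[OF P decay \<gamma>(3,4)] by blast
  obtain C' where C': "0 \<le> C'" "\<And>l \<rho>. 0 < l \<Longrightarrow> \<rho> \<in> borel_measurable borel \<Longrightarrow>
    riesz_energy (\<mu> \<Otimes>\<^sub>M ball_measure) (\<lambda>\<omega>. fst \<omega> + \<rho> (fst \<omega>) *\<^sub>R snd \<omega>) \<gamma> l \<le> ennreal (C' * l powr (- \<gamma>))"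
    using averaged_energy_bound[OF \<mu>p \<mu>s C0 \<gamma>(1,2)] by blast
  obtain c where c: "0 < c" "\<And>\<xi>::'a. 1 \<le> norm \<xi> \<and> norm \<xi> \<le> 2 \<Longrightarrow> c \<le> bump \<xi>"
    using bump_lower_bound by blast
  let ?F = "fourier_L2 f"
  let ?w = "\<lambda>\<xi>. (1 + (norm \<xi>)\<^sup>2) powr (s / 2) *\<^sub>R ?F \<xi>"
  have f2: "L2_fun f" and w2: "L2_fun ?w" using f by (auto simp: sobolev_def)
  note F2 = fourier_L2_L2[OF f2]
  note d2 = dyadic_piece_L2[OF F2] and d1 = dyadic_piece_integrable[OF F2]
  define N where "N = enn2real (L2sq ?w)"
  have N: "L2sq ?w = ennreal N" "0 \<le> N" using L2_funD(2)[OF w2] by (auto simp: N_def less_top)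
  define \<kappa> where "\<kappa> = C * C' / c"
  have \<kappa>: "0 \<le> \<kappa>" using C(1) C'(1) c(1) by (simp add: \<kappa>_def)
  \<comment> \<open>At frequency \<open>2 ^ i\<close> the maximal estimate loses
    \<open>2 powr (i * (?n - \<gamma>) / 2)\<close> and Sobolev regularity gains
    \<open>2 powr (i * s)\<close>; \<open>q\<close> is the resulting ratio.\<close>
  define q where "q = 2 powr ((?n - \<gamma>) / 2 - s)"
  have q: "0 \<le> q" "q < 1" using \<gamma>(5) by (auto simp: q_def powr_less_one)
  \<comment> \<open>The piece of index 0 is bounded by the L1 norm of its transform, finite because
    the unit ball is bounded.\<close>
  define B where "B j = (case j of 0 \<Rightarrow> (LINT \<xi>|lebesgue. norm (dyadic_piece ?F 0 \<xi>)) | Suc i \<Rightarrow> sqrt (N * \<kappa>) * q ^ i)" for j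
  have B_nonneg: "0 \<le> B j" for j
    using N(2) \<kappa> q by (auto simp: B_def split: nat.split intro!: mult_nonneg_nonneg)
  have "summable (\<lambda>j. B (Suc j))" using q by (auto simp: B_def intro!: summable_mult summable_geometric)
  then have B_summable: "summable B" by (simp only: summable_Suc_iff)
  have "\<exists>S. S \<in> borel_measurable \<mu> \<and> (\<forall>p x. ennreal (norm (avg P (dyadic_piece ?F j) p x)) \<le> S x) \<and> (\<integral>\<^sup>+x. S x \<partial>\<mu>) \<le> ennreal (B j)" for j
  proof (cases j)
    case 0
    then show ?thesis
      using norm_avg_le[OF d1 Pm, of 0] emeasure_space_1
      by (intro exI[of _ "\<lambda>_. ennreal (B 0)"]) (auto simp: B_def intro: ennreal_leI)
  next
    case (Suc i)
    let ?l = "2 ^ i :: real"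
    let ?g = "dyadic_piece ?F (Suc i)"
    have E: "enn2real (L2sq ?g) \<le> ?l powr (- 2 * s) * N"
    proof -
      have "L2sq ?g \<le> ennreal (?l powr (- 2 * s) * N)"
        using dyadic_piece_sobolev[OF less_imp_le[OF s0] F2 w2, of i] unfolding N(1) using N(2) by (simp add: ennreal_mult')
      then show ?thesis using N(2) by (intro enn2real_leI) auto
    qed
    have "sqrt (enn2real (L2sq ?g) * (C * C' / c * ?l powr (?n - \<gamma>))) \<le> sqrt ((?l powr (- 2 * s) * N) * (\<kappa> * ?l powr (?n - \<gamma>)))"
      unfolding \<kappa>_def[symmetric] using \<kappa> E by (intro real_sqrt_le_mono mult_right_mono) auto
    also have "(?l powr (- 2 * s) * N) * (\<kappa> * ?l powr (?n - \<gamma>)) = N * \<kappa> * (?l powr (- 2 * s) * ?l powr (?n - \<gamma>))" by simp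
    also have "?l powr (- 2 * s) * ?l powr (?n - \<gamma>) = (q ^ i)\<^sup>2"
    proof -
      have "?l powr (- 2 * s) * ?l powr (?n - \<gamma>) = ?l powr (2 * ((?n - \<gamma>) / 2 - s))"
      proof -
        have "- 2 * s + (?n - \<gamma>) = 2 * ((?n - \<gamma>) / 2 - s)" by (simp add: field_simps)
        then show ?thesis by (simp only: powr_add[symmetric])
      qed
      also have "\<dots> = 2 powr (real i * (2 * ((?n - \<gamma>) / 2 - s)))"
        by (simp only: powr_realpow[symmetric, of 2] zero_less_numeral powr_powr)
      also have "\<dots> = q powr (real i * 2)" unfolding q_def powr_powr by (simp add: algebra_simps)
      also have "\<dots> = (q ^ i)\<^sup>2"
      proof -
        have "0 < q" by (simp add: q_def)
        then show ?thesis using powr_realpow[of q "i * 2"] by (simp add: power_mult)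
      qed
      finally show ?thesis .
    qed
    also have "sqrt (N * \<kappa> * (q ^ i)\<^sup>2) = B j"
      using q Suc by (simp add: B_def real_sqrt_mult)
    finally have le: "ennreal (sqrt (enn2real (L2sq ?g) * (C * C' / c * ?l powr (?n - \<gamma>)))) \<le> ennreal (B j)"
      by (rule ennreal_leI)
    show ?thesis unfolding Suc
    proof (rule maximal_estimate[OF \<mu>s continuous_on_avg[OF d1 Pm]])
      fix p :: "'a \<Rightarrow> real \<times> real" assume p: "p \<in> borel_measurable borel"
      have "(\<integral>\<^sup>+x. ennreal (norm (avg P ?g (p x) x)) \<partial>\<mu>) \<le> ennreal (sqrt (enn2real (L2sq ?g) * (C * C' / c * ?l powr (?n - \<gamma>))))"
        by (rule linearized_maximal_estimate[OF \<mu>p \<mu>s C'(2,1) P hom C c _ d2 dyadic_piece_support p]) simp_all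
      then show "(\<integral>\<^sup>+x. ennreal (norm (avg P ?g (p x) x)) \<partial>\<mu>) \<le> ennreal (B (Suc i))" using le Suc by simp
    qed
  qed
  then obtain S where S: "\<And>j. S j \<in> borel_measurable \<mu>" "\<And>j p x. ennreal (norm (avg P (dyadic_piece ?F j) p x)) \<le> S j x"
      "\<And>j. (\<integral>\<^sup>+x. S j x \<partial>\<mu>) \<le> ennreal (B j)"
    by metis
  note [measurable] = S(1)
  have "(\<integral>\<^sup>+x. (\<Sum>j. S j x) \<partial>\<mu>) = (\<Sum>j. \<integral>\<^sup>+x. S j x \<partial>\<mu>)"
    by (rule nn_integral_suminf) measurable
  also have "\<dots> \<le> (\<Sum>j. ennreal (B j))" by (intro suminf_le S(3)) auto
  also have "\<dots> < \<infinity>" using B_summable B_nonneg by (subst suminf_ennreal2) auto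
  finally have "AE x in \<mu>. (\<Sum>j. S j x) \<noteq> \<infinity>" by (intro nn_integral_PInf_AE) auto
  then show ?thesis
  proof eventually_elim
    case (elim x)
    have fin: "S j x < top" for j
    proof -
      have "sum (\<lambda>j. S j x) {j} \<le> (\<Sum>j. S j x)" by (rule sum_le_suminf) auto
      also have "\<dots> < top" using elim by (simp add: less_top)
      finally show ?thesis by simp
    qed
    define m where "m j = enn2real (S j x)" for j
    have Sm: "S j x = ennreal (m j)" for j using fin[of j] by (simp add: m_def)
    have "(\<Sum>j. ennreal (m j)) \<noteq> top" using elim unfolding Sm by simp
    then have "summable m" by (intro summable_suminf_not_top) (auto simp: m_def)
    moreover have "norm (avg P (dyadic_piece ?F j) p x) \<le> m j" for j p
      using S(2)[of j p x] unfolding Sm by (subst (asm) ennreal_le_iff) (auto simp: m_def)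
    ultimately show ?case by (intro pointwise_convergence_if_summable[OF f2 Pm])
  qed
qed

theorem theorem1p2:
  fixes P :: "real ^ 'n \<Rightarrow> real" and k \<alpha> \<beta> s :: real
    and \<mu> :: "(real ^ 'n) measure" and f :: "real ^ 'n \<Rightarrow> complex"
  assumes P_smooth: "smooth_on (- {0}) P"
    and k: "1 \<le> k"
    and P_homogeneous: "\<forall>l>0. \<forall>\<xi>. \<xi> \<noteq> 0 \<longrightarrow> P (l *\<^sub>R \<xi>) = l powr k * P \<xi>"
    and P_nonsingular: "\<forall>\<xi>. \<xi> \<noteq> 0 \<longrightarrow> (\<exists>D. GDERIV P \<xi> :> D \<and> D \<noteq> 0)"
    and \<beta>: "0 < \<beta>"
    and decay: "\<forall>\<phi>\<in>schwartz.
      (\<exists>c1 c2. 0 < c1 \<and> c1 < c2 \<and> (\<forall>\<xi>. fourier \<phi> \<xi> \<noteq> 0 \<longrightarrow> c1 \<le> norm \<xi> \<and> norm \<xi> \<le> c2)) \<longrightarrow>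
      (\<exists>C. \<forall>t. t \<noteq> 0 \<longrightarrow> Linf_norm (propagator P t \<phi>) \<le> ereal (C * \<bar>t\<bar> powr (- \<beta>)))"
    and \<alpha>: "0 \<le> \<alpha>" "\<alpha> \<le> real CARD('n)" "\<alpha> < \<beta>"
    and s: "(real CARD('n) - \<alpha>) / 2 < s"
    and \<mu>: "\<mu> \<in> frostman_measures \<alpha>"
    and f: "f \<in> sobolev s"
  shows "AE x in \<mu>. \<exists>v u. has_value_at f x v \<and>
    (\<forall>\<^sub>F t in at 0. has_value_at (propagator P t f) x (u t)) \<and> (u \<longlongrightarrow> v) (at 0)"
proof -
  \<comment> \<open>The values exist for every \<open>t\<close> at almost every point, which gives
    the eventual existence claimed.\<close>
  have "AE x in \<mu>. \<exists>v u. has_value_at f x v \<and> (\<forall>t. has_value_at (propagator P t f) x (u t)) \<and> (u \<longlongrightarrow> v) (at 0)"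
    using \<alpha> s by (intro fractal_pointwise_convergence[OF P_smooth P_homogeneous decay _ _ _ _ \<mu> f]) auto
  then show ?thesis by eventually_elim (blast intro: always_eventually)
qed

end
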